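(* Let $g',g,d',d\in\mathbb N$, let $L$ be a $d'\times d$ NC analytic truly linear pencil and let $f:\mathcal B_{g'\times g}\to\mathcal B_L$ be a pencil ball map with $f(0)=0$. Write $h:=L\circ f$. Then there exist unitaries $U:\mathbb C^d\to\mathbb C^d$ and $V:\mathbb C^{d'}\to\mathbb C^{d'}$ such that $$h(x)=V\begin{bmatrix}x&0\\0&\tilde h(x)\end{bmatrix}U^*,$$ where $\tilde h$ is an NC analytic contraction-valued map.
   Context: For $N\in\mathbb N$, $\mathcal M_{d'\times d}(N)$ is the set of $d'\times d$ block matrices $X=[X_{j\ell}]$ with $X_{j\ell}\in\mathbb C^{N\times N}$, regarded as $d'N\times dN$ matrices with the operator norm; $\mathcal M_{d'\times d}=\bigsqcup_N\mathcal M_{d'\times d}(N)$. Put $\mathcal B_{g'\times g}=\{X\in\mathcal M_{g'\times g}:\|X\|\le1\}$, $\operatorname{int}\mathcal B_{g'\times g}=\{\|X\|<1\}$. NC analytic functions: let $x=(x_{j\ell})$ be $g'g$ noncommuting variables and $\langle x\rangle$ the set of words in them; for $X\in\mathcal M_{g'\times g}(N)$, $w(X)\in\mathbb C^{N\times N}$ is the evaluation of the word $w$. For $k',k\in\mathbb N$, an NC analytic function $f:\mathcal B_{g'\times g}\to\mathcal M_{k'\times k}$ assigns to each $X\in\operatorname{int}\mathcal B_{g'\times g}$ of size $N$ a matrix $f(X)\in\mathcal M_{k'\times k}(N)$, such that: (1) there are $a_w\in\mathbb C^{k'\times k}$ and $\varepsilon>0$ such that for all $N$ and all $X\in\mathcal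 M_{g'\times g}(N)$ with $\|X\|<\varepsilon$, $f(X)=\sum_{\alpha=0}^\infty\sum_{|w|=\alpha}a_w\otimes w(X)$, the outer sum converging; (2) for every analytic $a$ from a domain $W\subseteq\mathbb C^K$ into $\operatorname{int}\mathcal B_{g'\times g}$ (at a fixed size), $f\circ a$ is analytic on $W$, and continuous up to $\partial W$ whenever $a$ extends continuously to $\overline W$ with values in $\operatorname{int}\mathcal B_{g'\times g}$. A $d'\times d$ NC analytic truly linear pencil is $L(x)=\sum_{i=1}^{g'}\sum_{j=1}^{g}A_{ij}x_{ij}$ with $A_{ij}\in\mathbb C^{d'\times d}$; $L(X)=\sum A_{ij}\otimes X_{ij}$ for $X\in\mathcal M_{g'\times g}$. Its pencil ball is $\mathcal B_L=\{X\in\mathcal M_{g'\times g}:\|L(X)\|\le1\}$. A pencil ball map $f:\mathcal B_{g'\times g}\to\mathcal B_L$ is an NC analytic function $f:\mathcal B_{g'\times g}\to\mathcal M_{g'\times g}$ with values in $\mathcal B_L$ such that $\|L(f(X))\|=1$ whenever $\|X\|=1$ and $f(X):=\lim_{r\nearrow1}f(rX)$ exists. Contraction-valued means $\|\tilde h(X)\|\le1$ for all $X$ in the interior. The identity for $h$ means: for all $N$ and $X\in\operatorname{int}\mathcal B_{g'\times g}$ of size $N$, $h(X)=(V\otimes I_N)\begin{bmatrix}X&0\\0&\tilde h(X)\end{bmatrix}(U\otimes I_N)^*$ with $\tilde h(X)\in\mathcal M_{(d'-g')\times(d-g)}(N)$; it is understood to include $g'\le d'$, $g\le d$, and block rows or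 columns of size zero are absent. *)

theory Defs
  imports "HOL-Analysis.Analysis" "Jordan_Normal_Form.Schur_Decomposition"
begin

text \<open>
  A block matrix in \<open>\<M>\<^bsub>d'\<times>d\<^esub>(N)\<close> is stored as the flat \<open>d'N \<times> dN\<close> matrix whose entry at
  \<open>(j * N + r, l * N + s)\<close> is the \<open>(r, s)\<close> entry of the \<open>N \<times> N\<close> block \<open>X\<^bsub>jl\<^esub>\<close>.  The Kronecker
  product below uses the same ordering, so \<open>A \<otimes> Y\<close> has the block \<open>A\<^bsub>jl\<^esub> Y\<close> at position \<open>(j, l)\<close>.
  An NC map is a family \<open>f N X\<close> indexed by the size \<open>N \<ge> 1\<close>; only its values at
  \<open>X \<in> nc_int_ball g' g N\<close> are meaningful.  Row and column numbers may be zero, which renders absent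
  block rows or columns.
\<close>

definition nc_mat :: "nat \<Rightarrow> nat \<Rightarrow> nat \<Rightarrow> complex mat set" where
  "nc_mat d' d N = carrier_mat (d' * N) (d * N)"

definition nc_block :: "nat \<Rightarrow> complex mat \<Rightarrow> nat \<Rightarrow> nat \<Rightarrow> complex mat" where
  "nc_block N X j l = mat N N (\<lambda>(r, s). X $$ (j * N + r, l * N + s))"

definition kron :: "complex mat \<Rightarrow> complex mat \<Rightarrow> complex mat" where
  "kron A B = mat (dim_row A * dim_row B) (dim_col A * dim_col B)
     (\<lambda>(i, j). A $$ (i div dim_row B, j div dim_col B) * B $$ (i mod dim_row B, j mod dim_col B))"

definition eucl_norm :: "complex vec \<Rightarrow> real" where
  "eucl_norm v = L2_set (\<lambda>i. cmod (vec_index v i)) {..<dim_vec v}"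

definition op_norm :: "complex mat \<Rightarrow> real" where
  "op_norm A = (SUP v \<in> {v \<in> carrier_vec (dim_col A). eucl_norm v \<le> 1}. eucl_norm (A *\<^sub>v v))"

definition nc_int_ball :: "nat \<Rightarrow> nat \<Rightarrow> nat \<Rightarrow> complex mat set" where
  "nc_int_ball g' g N = {X \<in> nc_mat g' g N. op_norm X < 1}"

definition unitary_mat :: "nat \<Rightarrow> complex mat \<Rightarrow> bool" where
  "unitary_mat n U \<longleftrightarrow>
     U \<in> carrier_mat n n \<and> mat_adjoint U * U = 1\<^sub>m n \<and> U * mat_adjoint U = 1\<^sub>m n"

text \<open>
  The dimension \<open>K\<close> of \<open>\<complex>\<^sup>K\<close> is quantified over inside the definition of NC analyticity, so \<open>\<complex>\<^sup>K\<close> is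
  the space of sequences vanishing from index \<open>K\<close> on.  The product topology of the function type
  induces the usual topology there, and as this set is closed, so do closures.
\<close>

definition cspace :: "nat \<Rightarrow> (nat \<Rightarrow> complex) set" where
  "cspace K = {z. \<forall>i\<ge>K. z i = 0}"

definition cdomain :: "nat \<Rightarrow> (nat \<Rightarrow> complex) set \<Rightarrow> bool" where
  "cdomain K W \<longleftrightarrow> openin (top_of_set (cspace K)) W \<and> connected W \<and> W \<noteq> {}"

text \<open>Local expansion into a convergent power series in \<open>K\<close> variables; \<open>m\<close> is a multi-index.\<close>

definition cfun_analytic_on :: "nat \<Rightarrow> ((nat \<Rightarrow> complex) \<Rightarrow> complex) \<Rightarrow> (nat \<Rightarrow> complex) set \<Rightarrow> bool" where
  "cfun_analytic_on K F W \<longleftrightarrow>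
     (\<forall>p\<in>W. \<exists>(c :: (nat \<Rightarrow> nat) \<Rightarrow> complex) r. r > 0 \<and>
        (\<forall>z\<in>W. (\<forall>i<K. cmod (z i - p i) < r) \<longrightarrow>
           ((\<lambda>m. c m * (\<Prod>i<K. (z i - p i) ^ m i)) has_sum F z) {m. \<forall>i\<ge>K. m i = 0}))"

text \<open>Analyticity, continuity and limits of matrices of a fixed size are meant entrywise.\<close>

definition mat_analytic_on ::
  "nat \<Rightarrow> nat \<Rightarrow> nat \<Rightarrow> ((nat \<Rightarrow> complex) \<Rightarrow> complex mat) \<Rightarrow> (nat \<Rightarrow> complex) set \<Rightarrow> bool" where
  "mat_analytic_on K m n F W \<longleftrightarrow>
     (\<forall>z\<in>W. F z \<in> carrier_mat m n) \<and>
     (\<forall>i<m. \<forall>j<n. cfun_analytic_on K (\<lambda>z. F z $$ (i, j)) W)"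

definition mat_continuous_on ::
  "nat \<Rightarrow> nat \<Rightarrow> ((nat \<Rightarrow> complex) \<Rightarrow> complex mat) \<Rightarrow> (nat \<Rightarrow> complex) set \<Rightarrow> bool" where
  "mat_continuous_on m n F W \<longleftrightarrow>
     (\<forall>z\<in>W. F z \<in> carrier_mat m n) \<and>
     (\<forall>i<m. \<forall>j<n. continuous_on W (\<lambda>z. F z $$ (i, j)))"

definition mat_tendsto ::
  "nat \<Rightarrow> nat \<Rightarrow> ('a \<Rightarrow> complex mat) \<Rightarrow> complex mat \<Rightarrow> 'a filter \<Rightarrow> bool" where
  "mat_tendsto m n F Y \<F> \<longleftrightarrow>
     Y \<in> carrier_mat m n \<and>
     (\<forall>i<m. \<forall>j<n. ((\<lambda>t. F t $$ (i, j)) \<longlongrightarrow> Y $$ (i, j)) \<F>)"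

text \<open>A word in the variables \<open>x\<^bsub>jl\<^esub>\<close> is the list of the index pairs of its letters.\<close>

type_synonym word = "(nat \<times> nat) list"

definition words :: "nat \<Rightarrow> nat \<Rightarrow> nat \<Rightarrow> word set" where
  "words g' g n = {w. length w = n \<and> set w \<subseteq> {..<g'} \<times> {..<g}}"

definition word_eval :: "nat \<Rightarrow> complex mat \<Rightarrow> word \<Rightarrow> complex mat" where
  "word_eval N X w = foldr (\<lambda>(j, l) Y. nc_block N X j l * Y) w (1\<^sub>m N)"

definition homog_term ::
  "nat \<Rightarrow> nat \<Rightarrow> nat \<Rightarrow> nat \<Rightarrow> (word \<Rightarrow> complex mat) \<Rightarrow> nat \<Rightarrow> nat \<Rightarrow> complex mat \<Rightarrow> complex mat" where
  "homog_term g' g k' k a n N X =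
     mat (k' * N) (k * N) (\<lambda>ij. \<Sum>w\<in>words g' g n. kron (a w) (word_eval N X w) $$ ij)"

definition nc_power_series ::
  "nat \<Rightarrow> nat \<Rightarrow> nat \<Rightarrow> nat \<Rightarrow> (nat \<Rightarrow> complex mat \<Rightarrow> complex mat) \<Rightarrow> bool" where
  "nc_power_series g' g k' k f \<longleftrightarrow>
     (\<exists>a \<epsilon>. (\<forall>w. a w \<in> carrier_mat k' k) \<and> \<epsilon> > 0 \<and>
        (\<forall>N>0. \<forall>X\<in>nc_mat g' g N. op_norm X < \<epsilon> \<longrightarrow>
           (\<forall>i < k' * N. \<forall>j < k * N.
              (\<lambda>n. homog_term g' g k' k a n N X $$ (i, j)) sums (f N X $$ (i, j)))))"

definition nc_analytic_along_maps ::
  "nat \<Rightarrow> nat \<Rightarrow> nat \<Rightarrow> nat \<Rightarrow> (nat \<Rightarrow> complex mat \<Rightarrow> complex mat) \<Rightarrow> bool" where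
  "nc_analytic_along_maps g' g k' k f \<longleftrightarrow>
     (\<forall>K>0. \<forall>N>0. \<forall>W a.
        cdomain K W \<and> mat_analytic_on K (g' * N) (g * N) a W \<and> a ` W \<subseteq> nc_int_ball g' g N \<longrightarrow>
          mat_analytic_on K (k' * N) (k * N) (\<lambda>z. f N (a z)) W \<and>
          (mat_continuous_on (g' * N) (g * N) a (closure W) \<and>
             a ` closure W \<subseteq> nc_int_ball g' g N \<longrightarrow>
           mat_continuous_on (k' * N) (k * N) (\<lambda>z. f N (a z)) (closure W)))"

definition nc_analytic ::
  "nat \<Rightarrow> nat \<Rightarrow> nat \<Rightarrow> nat \<Rightarrow> (nat \<Rightarrow> complex mat \<Rightarrow> complex mat) \<Rightarrow> bool" where
  "nc_analytic g' g k' k f \<longleftrightarrow>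
     (\<forall>N>0. \<forall>X\<in>nc_int_ball g' g N. f N X \<in> nc_mat k' k N) \<and>
     nc_power_series g' g k' k f \<and>
     nc_analytic_along_maps g' g k' k f"

definition contraction_valued ::
  "nat \<Rightarrow> nat \<Rightarrow> (nat \<Rightarrow> complex mat \<Rightarrow> complex mat) \<Rightarrow> bool" where
  "contraction_valued g' g f \<longleftrightarrow> (\<forall>N>0. \<forall>X\<in>nc_int_ball g' g N. op_norm (f N X) \<le> 1)"

definition truly_linear_pencil ::
  "nat \<Rightarrow> nat \<Rightarrow> nat \<Rightarrow> nat \<Rightarrow> (nat \<Rightarrow> nat \<Rightarrow> complex mat) \<Rightarrow> bool" where
  "truly_linear_pencil g' g d' d A \<longleftrightarrow> (\<forall>i<g'. \<forall>j<g. A i j \<in> carrier_mat d' d)"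

definition pencil_eval ::
  "nat \<Rightarrow> nat \<Rightarrow> nat \<Rightarrow> nat \<Rightarrow> (nat \<Rightarrow> nat \<Rightarrow> complex mat) \<Rightarrow> nat \<Rightarrow> complex mat \<Rightarrow> complex mat" where
  "pencil_eval g' g d' d A N X =
     mat (d' * N) (d * N) (\<lambda>rc. \<Sum>i<g'. \<Sum>j<g. kron (A i j) (nc_block N X i j) $$ rc)"

definition pencil_ball ::
  "nat \<Rightarrow> nat \<Rightarrow> nat \<Rightarrow> nat \<Rightarrow> (nat \<Rightarrow> nat \<Rightarrow> complex mat) \<Rightarrow> nat \<Rightarrow> complex mat set" where
  "pencil_ball g' g d' d A N = {X \<in> nc_mat g' g N. op_norm (pencil_eval g' g d' d A N X) \<le> 1}"

definition pencil_ball_map ::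
  "nat \<Rightarrow> nat \<Rightarrow> nat \<Rightarrow> nat \<Rightarrow> (nat \<Rightarrow> nat \<Rightarrow> complex mat) \<Rightarrow>
     (nat \<Rightarrow> complex mat \<Rightarrow> complex mat) \<Rightarrow> bool" where
  "pencil_ball_map g' g d' d A f \<longleftrightarrow>
     nc_analytic g' g g' g f \<and>
     (\<forall>N>0. \<forall>X\<in>nc_int_ball g' g N. f N X \<in> pencil_ball g' g d' d A N) \<and>
     (\<forall>N>0. \<forall>X\<in>nc_mat g' g N. \<forall>Y.
        op_norm X = 1 \<and>
        mat_tendsto (g' * N) (g * N) (\<lambda>r. f N (complex_of_real r \<cdot>\<^sub>m X)) Y (at_left 1) \<longrightarrow>
        op_norm (pencil_eval g' g d' d A N Y) = 1)"

end

theory Submission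
  imports "HOL-Complex_Analysis.Conformal_Mappings" Defs
begin

text \<open>
  The idea is to test \<open>h = L \<circ> f\<close> at nilpotent block matrices.  There the power series of \<open>h\<close>,
  with coefficients \<open>c\<^sub>w\<close>, is a finite sum, radial limits of \<open>f\<close> exist for trivial reasons although \<open>f\<close> itself may be
  unbounded, and the test matrices can be chosen so that different words do not interfere.

  Contractivity at matrices built from rooted trees (\<open>tree_inequality\<close>) yields, for words that can share
  such a tree, inequalities of the form \<open>\<parallel>c\<^sub>w u\<parallel>\<^sup>2 + \<parallel>c\<^sub>i\<^sub>j u\<parallel>\<^sup>2 \<le> \<parallel>u\<parallel>\<^sup>2\<close>, together with the dual ones for the
  adjoints \<open>c\<^sub>w\<^sup>*\<close>.  The boundary condition is needed at only one point, a nilpotent matrix of rank one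
  at which \<open>h\<close> reduces to its linear part (\<open>attained_of_pencil_ball_map\<close>).  Since \<open>h\<close> has norm one there,
  the Cauchy--Schwarz inequality becomes an equality and produces unit vectors \<open>u\<^sub>l\<close>, \<open>v\<^sub>k\<close> with
  \<open>c\<^sub>k\<^sub>l u\<^sub>l = v\<^sub>k\<close> for all \<open>k\<close> and \<open>l\<close> (\<open>exists_isometric_frames\<close>).  By the inequalities above, every other coefficient
  annihilates \<open>u\<^sub>l\<close>, the adjoint statement holds for \<open>v\<^sub>k\<close>, and both families are orthonormal
  (\<open>frames_properties\<close>).

  Extending the two families to unitary matrices \<open>U\<close> and \<open>V\<close> gives the block form of \<open>h\<close> near \<open>0\<close>, and the identity
  theorem on the discs \<open>z \<mapsto> z X\<close> (\<open>nc_identity_on_disc\<close>) carries it to the whole open ball.  The remaining corner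
  is a linear pencil composed with \<open>f\<close>, hence NC analytic, and a compression of a unitary transform of \<open>h\<close>,
  hence contractive.
\<close>

section \<open>Contractive matrices over finite index sets\<close>

text \<open>
  The matrix with entries \<open>A i j\<close>, rows indexed by \<open>I\<close> and columns by \<open>J\<close>, does not increase the
  Euclidean norm.  Arbitrary index types are allowed because a block matrix is most conveniently
  indexed by pairs consisting of a block number and a position inside the block.
\<close>

definition contr :: "'i set \<Rightarrow> 'j set \<Rightarrow> ('i \<Rightarrow> 'j \<Rightarrow> complex) \<Rightarrow> bool" where
  "contr I J A \<longleftrightarrow>
     (\<forall>\<xi>. (\<Sum>i\<in>I. (cmod (\<Sum>j\<in>J. A i j * \<xi> j))\<^sup>2) \<le> (\<Sum>j\<in>J. (cmod (\<xi> j))\<^sup>2))"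

lemma contr_cong:
  assumes "contr I J A" and "\<And>i j. i \<in> I \<Longrightarrow> j \<in> J \<Longrightarrow> A i j = B i j"
  shows "contr I J B"
  using assms unfolding contr_def by (simp cong: sum.cong)

lemma Cauchy_Schwarz_complex_sum:
  fixes a b :: "'i \<Rightarrow> complex"
  shows "(cmod (\<Sum>i\<in>I. a i * b i))\<^sup>2 \<le> (\<Sum>i\<in>I. (cmod (a i))\<^sup>2) * (\<Sum>i\<in>I. (cmod (b i))\<^sup>2)"
proof -
  have "cmod (\<Sum>i\<in>I. a i * b i) \<le> (\<Sum>i\<in>I. cmod (a i) * cmod (b i))"
    by (rule order_trans[OF norm_sum]) (simp add: norm_mult)
  then have "(cmod (\<Sum>i\<in>I. a i * b i))\<^sup>2 \<le> (\<Sum>i\<in>I. cmod (a i) * cmod (b i))\<^sup>2"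
    by (rule power_mono) simp
  also have "\<dots> \<le> (\<Sum>i\<in>I. (cmod (a i))\<^sup>2) * (\<Sum>i\<in>I. (cmod (b i))\<^sup>2)"
    by (rule Cauchy_Schwarz_ineq_sum)
  finally show ?thesis .
qed

text \<open>With \<open>\<zeta> = A\<^sup>* \<eta>\<close>, Cauchy--Schwarz applied to \<open>\<parallel>\<zeta>\<parallel>\<^sup>2 = \<langle>\<eta>, A \<zeta>\<rangle>\<close> gives the claim.\<close>

lemma contr_adjoint:
  assumes "contr I J A"
  shows "contr J I (\<lambda>j i. cnj (A i j))"
  unfolding contr_def
proof (intro allI)
  fix \<eta> :: "'a \<Rightarrow> complex"
  define \<zeta> where "\<zeta> j = (\<Sum>i\<in>I. cnj (A i j) * \<eta> i)" for j
  define S where "S = (\<Sum>j\<in>J. (cmod (\<zeta> j))\<^sup>2)"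
  have S0: "S \<ge> 0" unfolding S_def by (simp add: sum_nonneg)
  have "complex_of_real S = (\<Sum>j\<in>J. \<zeta> j * cnj (\<zeta> j))"
    unfolding S_def by (simp only: of_real_sum complex_norm_square)
  also have "\<dots> = (\<Sum>j\<in>J. \<Sum>i\<in>I. \<eta> i * cnj (A i j * \<zeta> j))"
    by (subst (1) \<zeta>_def) (simp add: sum_distrib_left mult_ac)
  also have "\<dots> = (\<Sum>i\<in>I. \<eta> i * cnj (\<Sum>j\<in>J. A i j * \<zeta> j))"
    by (subst sum.swap) (simp add: sum_distrib_left)
  finally have "cmod (complex_of_real S) = cmod (\<Sum>i\<in>I. \<eta> i * cnj (\<Sum>j\<in>J. A i j * \<zeta> j))"
    by (rule arg_cong)
  then have "S\<^sup>2 = (cmod (\<Sum>i\<in>I. \<eta> i * cnj (\<Sum>j\<in>J. A i j * \<zeta> j)))\<^sup>2"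
    using S0 by simp
  also have "\<dots> \<le> (\<Sum>i\<in>I. (cmod (\<eta> i))\<^sup>2) * (\<Sum>i\<in>I. (cmod (cnj (\<Sum>j\<in>J. A i j * \<zeta> j)))\<^sup>2)"
    by (rule Cauchy_Schwarz_complex_sum)
  also have "(\<Sum>i\<in>I. (cmod (cnj (\<Sum>j\<in>J. A i j * \<zeta> j)))\<^sup>2) \<le> S"
    unfolding complex_mod_cnj S_def using assms by (simp add: contr_def)
  finally have "S * S \<le> (\<Sum>i\<in>I. (cmod (\<eta> i))\<^sup>2) * S"
    by (simp add: power2_eq_square mult_left_mono sum_nonneg)
  then have "S \<le> (\<Sum>i\<in>I. (cmod (\<eta> i))\<^sup>2)"
    using S0 by (cases "S = 0") (auto simp: sum_nonneg)
  then show "(\<Sum>j\<in>J. (cmod (\<Sum>i\<in>I. cnj (A i j) * \<eta> i))\<^sup>2) \<le> (\<Sum>i\<in>I. (cmod (\<eta> i))\<^sup>2)"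
    by (simp add: S_def \<zeta>_def)
qed

text \<open>A matrix of zeros and ones with at most one 1 in each row and in each column is contractive.\<close>

lemma contr_partial_injection:
  assumes "finite I" "finite J"
    and A: "\<And>i j. i \<in> I \<Longrightarrow> j \<in> J \<Longrightarrow> A i j = (if P i \<and> j = \<phi> i then 1 else 0)"
    and \<phi>: "\<And>i. i \<in> I \<Longrightarrow> P i \<Longrightarrow> \<phi> i \<in> J"
    and inj: "inj_on \<phi> {i \<in> I. P i}"
  shows "contr I J A"
  unfolding contr_def
proof (intro allI)
  fix \<xi> :: "'b \<Rightarrow> complex"
  have "(\<Sum>j\<in>J. A i j * \<xi> j) = (if P i then \<xi> (\<phi> i) else 0)" if "i \<in> I" for i
  proof -
    have "(\<Sum>j\<in>J. A i j * \<xi> j) = (\<Sum>j\<in>J. if j = \<phi> i then (if P i then \<xi> j else 0) else 0)"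
      using that by (intro sum.cong) (auto simp: A)
    then show ?thesis using \<phi>[OF that] \<open>finite J\<close> by (auto simp: sum.delta)
  qed
  then have "(\<Sum>i\<in>I. (cmod (\<Sum>j\<in>J. A i j * \<xi> j))\<^sup>2) = (\<Sum>i\<in>{i \<in> I. P i}. (cmod (\<xi> (\<phi> i)))\<^sup>2)"
    using \<open>finite I\<close> by (subst sum.inter_filter) (auto intro!: sum.cong)
  also have "\<dots> = (\<Sum>j\<in>\<phi> ` {i \<in> I. P i}. (cmod (\<xi> j))\<^sup>2)"
    by (simp add: sum.reindex[OF inj])
  also have "\<dots> \<le> (\<Sum>j\<in>J. (cmod (\<xi> j))\<^sup>2)"
    using \<phi> \<open>finite J\<close> by (intro sum_mono2) auto
  finally show "(\<Sum>i\<in>I. (cmod (\<Sum>j\<in>J. A i j * \<xi> j))\<^sup>2) \<le> (\<Sum>j\<in>J. (cmod (\<xi> j))\<^sup>2)" .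
qed

section \<open>Words evaluated at families of scalar matrices\<close>

text \<open>
  The \<open>(r, s)\<close> entry of a word evaluated at \<open>N \<times> N\<close> matrices, where \<open>x a\<close> lists the entries of the matrix
  substituted for the letter \<open>a\<close>.
\<close>

fun wev :: "nat \<Rightarrow> ('l \<Rightarrow> nat \<Rightarrow> nat \<Rightarrow> complex) \<Rightarrow> 'l list \<Rightarrow> nat \<Rightarrow> nat \<Rightarrow> complex" where
  "wev N x [] r s = (if r = s then 1 else 0)"
| "wev N x (a # w) r s = (\<Sum>t<N. x a r t * wev N x w t s)"

lemma wev_append:
  assumes "r < N"
  shows "wev N x (v @ w) r s = (\<Sum>t<N. wev N x v r t * wev N x w t s)"
  using assms
proof (induction v arbitrary: r)
  case Nil
  then show ?case by (simp add: if_distrib[of "\<lambda>z. z * _"] cong: if_cong)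
next
  case (Cons a v)
  have "wev N x ((a # v) @ w) r s = (\<Sum>t<N. \<Sum>q<N. x a r t * wev N x v t q * wev N x w q s)"
    using Cons by (simp add: sum_distrib_left mult.assoc)
  also have "\<dots> = (\<Sum>q<N. wev N x (a # v) r q * wev N x w q s)"
    by (subst sum.swap) (simp add: sum_distrib_right)
  finally show ?case .
qed

text \<open>
  Passing from \<open>X\<close> to \<open>X\<^sup>*\<close> exchanges the two indices of a letter and reverses the order of a product.
\<close>

definition dual_word :: "word \<Rightarrow> word" where
  "dual_word w = rev (map prod.swap w)"

lemma dual_word_dual_word [simp]: "dual_word (dual_word w) = w"
  by (simp add: dual_word_def rev_map)

lemma length_dual_word [simp]: "length (dual_word w) = length w"
  by (simp add: dual_word_def)

lemma set_dual_word: "set (dual_word w) \<subseteq> B \<times> A \<longleftrightarrow> set w \<subseteq> A \<times> B"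
  by (auto simp: dual_word_def)

lemma bij_betw_dual_word: "bij_betw dual_word (words g' g n) (words g g' n)"
  by (rule bij_betwI[where g = dual_word]) (auto simp: words_def set_dual_word)

lemma wev_dual:
  assumes "r < N" "s < N"
  shows "wev N (\<lambda>a r s. cnj (x (prod.swap a) s r)) w r s = cnj (wev N x (dual_word w) s r)"
  using assms
proof (induction w arbitrary: r)
  case Nil
  then show ?case by (simp add: dual_word_def)
next
  case (Cons a w)
  have d: "dual_word (a # w) = dual_word w @ [prod.swap a]" by (simp add: dual_word_def)
  have one: "wev N x [prod.swap a] t r = x (prod.swap a) t r" for t
    using Cons.prems by (simp add: if_distrib[of "\<lambda>z. _ * z"] cong: if_cong)
  have "wev N (\<lambda>a r s. cnj (x (prod.swap a) s r)) (a # w) r s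
      = (\<Sum>t<N. cnj (x (prod.swap a) t r) * cnj (wev N x (dual_word w) s t))"
    using Cons by (auto intro!: sum.cong)
  also have "\<dots> = cnj (wev N x (dual_word (a # w)) s r)"
    unfolding d wev_append[OF Cons.prems(2)] one by (simp add: mult.commute)
  finally show ?case .
qed

section \<open>Noncommutative power series that are contractive at nilpotent contractions\<close>

text \<open>
  The coefficients \<open>c w\<close>, which are \<open>d' \<times> d\<close> matrices given by their entries, of a power series without constant term
  whose value is a contraction at every contractive \<open>X\<close> that makes all words of length at least \<open>m\<close>
  vanish, for some \<open>m\<close>.  At such \<open>X\<close> the series is a finite sum, so no convergence is involved.
\<close>

locale contractive_series =
  fixes g' g d' d :: nat and c :: "word \<Rightarrow> nat \<Rightarrow> nat \<Rightarrow> complex"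
  assumes contr_series:
    "\<And>N m x. 0 < N \<Longrightarrow>
       contr ({..<g'} \<times> {..<N}) ({..<g} \<times> {..<N}) (\<lambda>(k, r) (l, s). x (k, l) r s) \<Longrightarrow>
       (\<And>w r s. set w \<subseteq> {..<g'} \<times> {..<g} \<Longrightarrow> m \<le> length w \<Longrightarrow> r < N \<Longrightarrow> s < N \<Longrightarrow> wev N x w r s = 0) \<Longrightarrow>
       contr ({..<d'} \<times> {..<N}) ({..<d} \<times> {..<N})
         (\<lambda>(a, r) (b, s). \<Sum>n<m. \<Sum>w\<in>words g' g n. c w a b * wev N x w r s)"
    and c_Nil: "\<And>a b. a < d' \<Longrightarrow> b < d \<Longrightarrow> c [] a b = 0"

context contractive_series
begin

text \<open>
  The series \<open>X \<mapsto> h(X\<^sup>*)\<^sup>*\<close> has the same property, so that everything proved below about columns of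
  the coefficients also holds for their rows.
\<close>

lemma dual: "contractive_series g g' d d' (\<lambda>w b a. cnj (c (dual_word w) a b))"
proof
  fix N m :: nat and x :: "nat \<times> nat \<Rightarrow> nat \<Rightarrow> nat \<Rightarrow> complex"
  assume N: "0 < N"
    and con: "contr ({..<g} \<times> {..<N}) ({..<g'} \<times> {..<N}) (\<lambda>(k, r) (l, s). x (k, l) r s)"
    and nil: "\<And>w r s. set w \<subseteq> {..<g} \<times> {..<g'} \<Longrightarrow> m \<le> length w \<Longrightarrow> r < N \<Longrightarrow> s < N \<Longrightarrow> wev N x w r s = 0"
  define y where "y = (\<lambda>a r s. cnj (x (prod.swap a) s r))"
  have "contr ({..<g'} \<times> {..<N}) ({..<g} \<times> {..<N}) (\<lambda>(k, r) (l, s). y (k, l) r s)"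
    using contr_adjoint[OF con] unfolding y_def
    by (rule contr_cong) auto
  moreover have "wev N y w r s = 0"
    if "set w \<subseteq> {..<g'} \<times> {..<g}" "m \<le> length w" "r < N" "s < N" for w r s
    unfolding y_def using that by (simp add: wev_dual nil set_dual_word)
  ultimately have "contr ({..<d'} \<times> {..<N}) ({..<d} \<times> {..<N})
         (\<lambda>(a, r) (b, s). \<Sum>n<m. \<Sum>w\<in>words g' g n. c w a b * wev N y w r s)"
    by (rule contr_series[OF N])
  then have adj: "contr ({..<d} \<times> {..<N}) ({..<d'} \<times> {..<N}) (\<lambda>j i. cnj ((\<lambda>(a, r) (b, s).
      \<Sum>n<m. \<Sum>w\<in>words g' g n. c w a b * wev N y w r s) i j))"
    by (rule contr_adjoint)
  have val: "cnj (\<Sum>n<m. \<Sum>w\<in>words g' g n. c w a b * wev N y w r s)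
      = (\<Sum>n<m. \<Sum>w\<in>words g g' n. cnj (c (dual_word w) a b) * wev N x w s r)"
    if "r < N" "s < N" for a b r s
  proof -
    have "(\<Sum>w\<in>words g g' n. cnj (c (dual_word w) a b) * wev N x w s r)
        = (\<Sum>w\<in>words g' g n. cnj (c w a b * wev N y w r s))" for n
      using that sum.reindex_bij_betw[OF bij_betw_dual_word[of g' g n],
          of "\<lambda>w. cnj (c (dual_word w) a b) * wev N x w s r"]
      by (simp add: wev_dual y_def cong: sum.cong)
    then show ?thesis by (simp only: cnj_sum)
  qed
  show "contr ({..<d} \<times> {..<N}) ({..<d'} \<times> {..<N})
         (\<lambda>(a, r) (b, s). \<Sum>n<m. \<Sum>w\<in>words g g' n. cnj (c (dual_word w) b a) * wev N x w r s)"
    by (rule contr_cong[OF adj], clarify) (simp only: case_prod_conv val mem_Times_iff fst_conv snd_conv lessThan_iff)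
next
  fix a b assume "a < d" "b < d'"
  then show "cnj (c (dual_word []) b a) = 0" by (simp add: dual_word_def c_Nil)
qed

end

text \<open>
  A rooted tree on the vertices \<open>0, \<dots>, N - 1\<close> with root \<open>0\<close>: the vertex \<open>r > 0\<close> hangs below \<open>par r < r\<close> by an
  edge labelled \<open>lab r\<close>.  \<open>tree_word\<close> collects the labels on the path from \<open>r\<close> up to the root; the
  test \<open>par r \<ge> r\<close> only serves to make the recursion total.  \<open>tree_mat\<close> moves the basis vector of a
  vertex along the edges that carry a given label.
\<close>

function tree_word :: "(nat \<Rightarrow> nat) \<Rightarrow> (nat \<Rightarrow> 'l) \<Rightarrow> nat \<Rightarrow> 'l list" where
  "tree_word par lab r = (if r = 0 \<or> par r \<ge> r then [] else lab r # tree_word par lab (par r))"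
  by pat_completeness auto
termination by (relation "Wellfounded.measure (\<lambda>(par, lab, r). r)") auto

declare tree_word.simps [simp del]

definition tree_mat :: "(nat \<Rightarrow> nat) \<Rightarrow> (nat \<Rightarrow> 'l) \<Rightarrow> 'l \<Rightarrow> nat \<Rightarrow> nat \<Rightarrow> complex" where
  "tree_mat par lab a r s = (if 0 < r \<and> s = par r \<and> a = lab r then 1 else 0)"

text \<open>
  Applied to the basis vector of the root, different words reach different vertices, so that the
  coefficients of a series are separated.
\<close>

lemma wev_tree_root:
  assumes "\<And>r. 0 < r \<Longrightarrow> r < N \<Longrightarrow> par r < r" and "r < N"
  shows "wev N (tree_mat par lab) w r 0 = (if w = tree_word par lab r then 1 else 0)"
  using assms(2)
proof (induction w arbitrary: r)
  case Nil
  show ?case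
    using assms(1)[of r] Nil by (cases "r = 0") (auto simp: tree_word.simps[of par lab])
next
  case (Cons a w)
  have "wev N (tree_mat par lab) (a # w) r 0
     = (\<Sum>t<N. if t = par r then (if 0 < r \<and> a = lab r then wev N (tree_mat par lab) w t 0 else 0) else 0)"
    by (simp only: wev.simps, rule sum.cong) (auto simp: tree_mat_def[of _ _ _ r])
  also have "\<dots> = (if 0 < r \<and> a = lab r then wev N (tree_mat par lab) w (par r) 0 else 0)"
    using assms(1)[of r] Cons.prems by (cases "r = 0") (auto simp: sum.delta)
  also have "\<dots> = (if a # w = tree_word par lab r then 1 else 0)"
    using assms(1)[of r] Cons by (auto simp: tree_word.simps[of par lab r])
  finally show ?case .
qed

lemma wev_tree_zero:
  assumes "\<And>r. 0 < r \<Longrightarrow> r < N \<Longrightarrow> par r < r" and "r < N" and "s + length w > r"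
  shows "wev N (tree_mat par lab) w r s = 0"
  using assms(2,3)
proof (induction w arbitrary: r)
  case Nil
  then show ?case by simp
next
  case (Cons a w)
  have "tree_mat par lab a r t * wev N (tree_mat par lab) w t s = 0" if "t < N" for t
    using assms(1)[of r] Cons.prems Cons.IH[of t] that
    by (cases "0 < r \<and> t = par r") (auto simp: tree_mat_def[of _ _ _ r])
  then show ?case by (auto intro!: sum.neutral simp del: mult_eq_0_iff)
qed

lemma length_tree_word: "length (tree_word par lab r) \<le> r"
proof (induction r rule: less_induct)
  case (less r)
  show ?case
    using less[of "par r"] by (subst tree_word.simps) fastforce
qed

lemma set_tree_word:
  assumes "\<And>r. 0 < r \<Longrightarrow> r < N \<Longrightarrow> lab r \<in> S" and "r < N"
  shows "set (tree_word par lab r) \<subseteq> S"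
  using assms(2)
  by (induction r rule: less_induct) (subst tree_word.simps, auto simp: assms(1))

lemma finite_words: "finite (words g' g n)"
  using finite_lists_length_eq[of "{..<g'} \<times> {..<g}" n] by (simp add: words_def conj_commute)

context contractive_series
begin

text \<open>
  If no vertex has two edges going down whose labels share the second index, then \<open>X\<close> built
  from \<open>tree_mat\<close> is a partial isometry.  Contractivity of the series at \<open>X\<close>, applied to \<open>u\<close> tensored with
  the basis vector of the root, is the stated inequality.
\<close>

lemma tree_inequality:
  assumes N: "0 < N"
    and par: "\<And>r. 0 < r \<Longrightarrow> r < N \<Longrightarrow> par r < r"
    and lab: "\<And>r. 0 < r \<Longrightarrow> r < N \<Longrightarrow> lab r \<in> {..<g'} \<times> {..<g}"
    and inj: "inj_on (\<lambda>r. (snd (lab r), par r)) {0<..<N}"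
  shows "(\<Sum>r<N. \<Sum>a<d'. (cmod (\<Sum>b<d. c (tree_word par lab r) a b * u b))\<^sup>2)
       \<le> (\<Sum>b<d. (cmod (u b))\<^sup>2)"
proof -
  let ?x = "tree_mat par lab"
  have "contr ({..<g'} \<times> {..<N}) ({..<g} \<times> {..<N}) (\<lambda>(k, r) (l, s). ?x (k, l) r s)"
  proof (rule contr_partial_injection[where P = "\<lambda>(k, r). 0 < r \<and> k = fst (lab r)"
        and \<phi> = "\<lambda>(k, r). (snd (lab r), par r)"])
    show "inj_on (\<lambda>(k, r). (snd (lab r), par r))
       {i \<in> {..<g'} \<times> {..<N}. case i of (k, r) \<Rightarrow> 0 < r \<and> k = fst (lab r)}"
    proof (rule inj_onI, clarsimp)
      fix r r' assume "r < N" "0 < r" "r' < N" "0 < r'" "snd (lab r) = snd (lab r')" "par r = par r'"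
      then have "r = r'" using inj by (auto dest: inj_onD)
      then show "fst (lab r) = fst (lab r') \<and> r = r'" by simp
    qed
  next
    fix i assume "i \<in> {..<g'} \<times> {..<N}" "case i of (k, r) \<Rightarrow> 0 < r \<and> k = fst (lab r)"
    then show "(case i of (k, r) \<Rightarrow> (snd (lab r), par r)) \<in> {..<g} \<times> {..<N}"
      using lab[of "snd i"] par[of "snd i"] by (auto simp: mem_Times_iff)
  qed (auto simp: tree_mat_def prod_eq_iff split: if_splits)
  moreover have "wev N ?x w r s = 0" if "N \<le> length w" "r < N" for w r s
    using that by (intro wev_tree_zero par) auto
  ultimately have con: "contr ({..<d'} \<times> {..<N}) ({..<d} \<times> {..<N})
         (\<lambda>(a, r) (b, s). \<Sum>n<N. \<Sum>w\<in>words g' g n. c w a b * wev N ?x w r s)"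
    by (intro contr_series[OF N])
  have val: "(\<Sum>n<N. \<Sum>w\<in>words g' g n. c w a b * wev N ?x w r 0) = c (tree_word par lab r) a b"
    if r: "r < N" for a b r
  proof -
    let ?v = "tree_word par lab r"
    have v: "length ?v < N" "?v \<in> words g' g (length ?v)"
      using length_tree_word[of par lab r] r set_tree_word[of N lab "{..<g'} \<times> {..<g}", OF lab r]
      by (auto simp: words_def)
    have "(\<Sum>n<N. \<Sum>w\<in>words g' g n. c w a b * wev N ?x w r 0)
        = (\<Sum>n<N. \<Sum>w\<in>words g' g n. if w = ?v then c w a b else 0)"
      using wev_tree_root[of N par r lab, OF par r] by (auto intro!: sum.cong)
    also have "\<dots> = (\<Sum>n<N. if n = length ?v then c ?v a b else 0)"
    proof (rule sum.cong[OF refl])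
      fix n show "(\<Sum>w\<in>words g' g n. if w = ?v then c w a b else 0) = (if n = length ?v then c ?v a b else 0)"
        using v by (subst sum.delta'[OF finite_words] sum.delta[OF finite_words]) (auto simp: words_def)
    qed
    also have "\<dots> = c ?v a b" using v by (simp add: sum.delta)
    finally show ?thesis .
  qed
  let ?\<xi> = "\<lambda>(b, s). if s = 0 then u b else 0 :: complex"
  have *: "(\<Sum>j\<in>{..<d} \<times> {..<N}. (case (a, r) of (a, r) \<Rightarrow> \<lambda>(b, s). \<Sum>n<N. \<Sum>w\<in>words g' g n. c w a b * wev N ?x w r s) j * ?\<xi> j)
     = (\<Sum>b<d. c (tree_word par lab r) a b * u b)" if "r < N" for a r
    unfolding sum.cartesian_product'
    using N that val by (auto simp: if_distrib[of "\<lambda>z. _ * z"] sum.delta cong: if_cong intro!: sum.cong)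
  have "(\<Sum>i\<in>{..<d'} \<times> {..<N}. (cmod (\<Sum>j\<in>{..<d} \<times> {..<N}. (case i of (a, r) \<Rightarrow> \<lambda>(b, s). \<Sum>n<N. \<Sum>w\<in>words g' g n. c w a b * wev N ?x w r s) j * ?\<xi> j))\<^sup>2)
     \<le> (\<Sum>j\<in>{..<d} \<times> {..<N}. (cmod (?\<xi> j))\<^sup>2)"
    using con unfolding contr_def by blast
  also have "(\<Sum>j\<in>{..<d} \<times> {..<N}. (cmod (?\<xi> j))\<^sup>2) = (\<Sum>b<d. (cmod (u b))\<^sup>2)"
    unfolding sum.cartesian_product'
    using N by (auto simp: if_distrib[of cmod] if_distrib[of "\<lambda>z. z\<^sup>2"] sum.delta cong: if_cong intro!: sum.cong)
  also have "(\<Sum>i\<in>{..<d'} \<times> {..<N}. (cmod (\<Sum>j\<in>{..<d} \<times> {..<N}. (case i of (a, r) \<Rightarrow> \<lambda>(b, s). \<Sum>n<N. \<Sum>w\<in>words g' g n. c w a b * wev N ?x w r s) j * ?\<xi> j))\<^sup>2)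
     = (\<Sum>(a, r)\<in>{..<d'} \<times> {..<N}. (cmod (\<Sum>b<d. c (tree_word par lab r) a b * u b))\<^sup>2)"
  proof (rule sum.cong[OF refl], clarify)
    fix a r assume "a < d'" "r < N"
    then show "(cmod (\<Sum>j\<in>{..<d} \<times> {..<N}. (case j of (b, s) \<Rightarrow> \<Sum>n<N. \<Sum>w\<in>words g' g n. c w a b * wev N ?x w r s) * ?\<xi> j))\<^sup>2
        = (cmod (\<Sum>b<d. c (tree_word par lab r) a b * u b))\<^sup>2"
      using *[of r a] by (simp only: case_prod_conv)
  qed
  also have "\<dots> = (\<Sum>a<d'. \<Sum>r<N. (cmod (\<Sum>b<d. c (tree_word par lab r) a b * u b))\<^sup>2)"
    by (simp add: sum.cartesian_product)
  finally show ?thesis by (subst sum.swap)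
qed

end

context contractive_series
begin

text \<open>
  The tree consists of the path spelling \<open>w\<close> and an edge \<open>(i, j)\<close> at the root, which is either
  the first edge of that path or a separate branch.
\<close>

lemma two_branch_inequality:
  assumes w: "w \<noteq> []" "set w \<subseteq> {..<g'} \<times> {..<g}" and ij: "(i, j) \<in> {..<g'} \<times> {..<g}"
    and "w \<noteq> [(i, j)]" and br: "last w = (i, j) \<or> snd (last w) \<noteq> j"
  shows "(\<Sum>a<d'. (cmod (\<Sum>b<d. c w a b * u b))\<^sup>2) + (\<Sum>a<d'. (cmod (\<Sum>b<d. c [(i, j)] a b * u b))\<^sup>2)
       \<le> (\<Sum>b<d. (cmod (u b))\<^sup>2)"
proof -
  define m where "m = length w"
  have m: "m > 0" using w by (simp add: m_def)
  define lab where "lab = (\<lambda>r. if r \<le> m then w ! (m - r) else (i, j))"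
  define par where "par = (\<lambda>r. if r \<le> m then r - 1 else (0::nat))"
  \<comment> \<open>The extra vertex \<open>m + 1\<close> is only needed when the path for \<open>w\<close> does not start with \<open>(i, j)\<close>.\<close>
  define N where "N = (if last w = (i, j) then m + 1 else m + 2)"
  define q where "q = (if last w = (i, j) then 1 else m + 1)"
  have path: "tree_word par lab r = drop (m - r) w" if "r \<le> m" for r
    using that
  proof (induction r)
    case 0
    then show ?case by (simp add: tree_word.simps[of _ _ 0] m_def)
  next
    case (Suc r)
    have "tree_word par lab (Suc r) = w ! (m - Suc r) # drop (m - r) w"
      using Suc by (subst tree_word.simps) (simp add: lab_def par_def)
    also have "\<dots> = drop (m - Suc r) w"
      using Suc.prems by (subst (2) Cons_nth_drop_Suc[symmetric]) (auto simp: m_def Suc_diff_Suc)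
    finally show ?case .
  qed
  have last: "w ! (m - 1) = last w" using w by (simp add: last_conv_nth m_def)
  have tw: "tree_word par lab m = w" "tree_word par lab q = [(i, j)]"
  proof -
    show "tree_word par lab m = w" by (simp add: path)
    have "tree_word par lab (m + 1) = [(i, j)]"
      by (subst tree_word.simps) (simp add: lab_def par_def tree_word.simps[of _ _ 0])
    moreover have "tree_word par lab 1 = [last w]"
      using m by (subst tree_word.simps) (simp add: lab_def par_def tree_word.simps[of _ _ 0] last[simplified])
    ultimately show "tree_word par lab q = [(i, j)]" by (simp add: q_def)
  qed
  have qm: "q \<noteq> m" "q < N" "m < N" "0 < N"
    using \<open>w \<noteq> [(i, j)]\<close> tw m by (auto simp: q_def N_def)
  have "inj_on (\<lambda>r. (snd (lab r), par r)) {0<..<N}"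
  proof (rule inj_onI)
    fix r r' assume r: "r \<in> {0<..<N}" "r' \<in> {0<..<N}" "(snd (lab r), par r) = (snd (lab r'), par r')"
    have *: False if "r \<le> m" "\<not> r' \<le> m" "0 < r" "r' < N" "(snd (lab r), par r) = (snd (lab r'), par r')" for r r'
    proof -
      have "r = 1" "N = m + 2" using that by (auto simp: par_def N_def split: if_splits)
      then have "snd (last w) = j" "last w \<noteq> (i, j)"
        using that last by (auto simp: lab_def N_def split: if_splits)
      then show False using br by auto
    qed
    have "r \<le> m \<and> r' \<le> m \<or> r = m + 1 \<and> r' = m + 1"
    proof (cases "r \<le> m \<longleftrightarrow> r' \<le> m")
      case True
      then show ?thesis using r by (auto simp: N_def split: if_splits)
    next
      case False
      then show ?thesis using *[of r r'] *[of r' r] r by auto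
    qed
    then show "r = r'" using r by (auto simp: par_def)
  qed
  moreover have "lab r \<in> {..<g'} \<times> {..<g}" if "0 < r" for r
    using that m w ij nth_mem[of "m - r" w] by (auto simp: lab_def m_def)
  moreover have "par r < r" if "0 < r" for r using that by (auto simp: par_def)
  ultimately have ineq: "(\<Sum>r<N. \<Sum>a<d'. (cmod (\<Sum>b<d. c (tree_word par lab r) a b * u b))\<^sup>2)
       \<le> (\<Sum>b<d. (cmod (u b))\<^sup>2)"
    using qm by (intro tree_inequality) auto
  have "(\<Sum>r\<in>{m, q}. \<Sum>a<d'. (cmod (\<Sum>b<d. c (tree_word par lab r) a b * u b))\<^sup>2)
      \<le> (\<Sum>r<N. \<Sum>a<d'. (cmod (\<Sum>b<d. c (tree_word par lab r) a b * u b))\<^sup>2)"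
    using qm by (intro sum_mono2) (auto intro!: sum_nonneg)
  with ineq show ?thesis using qm by (simp add: tw)
qed

lemma letter_inequality:
  assumes "i < g'" "j < g"
  shows "(\<Sum>a<d'. (cmod (\<Sum>b<d. c [(i, j)] a b * u b))\<^sup>2) \<le> (\<Sum>b<d. (cmod (u b))\<^sup>2)"
proof -
  have "(\<Sum>r<2. \<Sum>a<d'. (cmod (\<Sum>b<d. c (tree_word (\<lambda>_. 0) (\<lambda>_. (i, j)) r) a b * u b))\<^sup>2)
       \<le> (\<Sum>b<d. (cmod (u b))\<^sup>2)"
    using assms by (intro tree_inequality) (auto simp: inj_on_def)
  moreover have "tree_word (\<lambda>_. 0) (\<lambda>_. (i, j)) 1 = [(i, j)]"
    by (subst tree_word.simps) (simp add: tree_word.simps[of _ _ 0])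
  moreover have "(\<Sum>a<d'. (cmod (\<Sum>b<d. c (tree_word (\<lambda>_. 0) (\<lambda>_. (i, j)) 0) a b * u b))\<^sup>2) \<ge> 0"
    by (simp add: sum_nonneg)
  ultimately show ?thesis by (simp add: numeral_2_eq_2)
qed

text \<open>
  A unit vector whose norm is preserved by the coefficients of all letters \<open>(k, j)\<close>, with \<open>j\<close> fixed, is
  annihilated by the coefficients of all other words.
\<close>

lemma annihilates:
  assumes "0 < g'" "j < g" and u: "(\<Sum>b<d. (cmod (u b))\<^sup>2) = 1"
    and iso: "\<And>k. k < g' \<Longrightarrow> (\<Sum>a<d'. (cmod (\<Sum>b<d. c [(k, j)] a b * u b))\<^sup>2) = 1"
    and w: "set w \<subseteq> {..<g'} \<times> {..<g}" "\<And>k. w \<noteq> [(k, j)]"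
    and "a < d'"
  shows "(\<Sum>b<d. c w a b * u b) = 0"
proof (cases "w = []")
  case True
  then show ?thesis using \<open>a < d'\<close> by (simp add: c_Nil)
next
  case False
  \<comment> \<open>The letter \<open>(i, j)\<close> extends \<open>w\<close> to a tree as required in \<open>two_branch_inequality\<close>.\<close>
  define i where "i = (if snd (last w) = j then fst (last w) else 0)"
  have "last w \<in> {..<g'} \<times> {..<g}" using False w(1) by auto
  then have i: "i < g'" using \<open>0 < g'\<close> by (auto simp: i_def mem_Times_iff)
  have "(\<Sum>a<d'. (cmod (\<Sum>b<d. c w a b * u b))\<^sup>2) + (\<Sum>a<d'. (cmod (\<Sum>b<d. c [(i, j)] a b * u b))\<^sup>2)
       \<le> (\<Sum>b<d. (cmod (u b))\<^sup>2)"
    using False w i \<open>j < g\<close> by (intro two_branch_inequality) (auto simp: i_def prod_eq_iff)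
  then have "(\<Sum>a<d'. (cmod (\<Sum>b<d. c w a b * u b))\<^sup>2) \<le> 0" using iso[OF i] u by simp
  then have "(\<Sum>a<d'. (cmod (\<Sum>b<d. c w a b * u b))\<^sup>2) = 0" by (meson order_antisym sum_nonneg zero_le_power2)
  then show ?thesis using \<open>a < d'\<close> by (simp add: sum_nonneg_eq_0_iff)
qed

end

lemma sum_norm_square_diff:
  fixes y z :: "'i \<Rightarrow> complex"
  shows "(\<Sum>i\<in>I. (cmod (y i - z i))\<^sup>2)
     = (\<Sum>i\<in>I. (cmod (y i))\<^sup>2) + (\<Sum>i\<in>I. (cmod (z i))\<^sup>2) - 2 * Re (\<Sum>i\<in>I. y i * cnj (z i))"
proof -
  have "(cmod (y i - z i))\<^sup>2 = (cmod (y i))\<^sup>2 + (cmod (z i))\<^sup>2 - 2 * Re (y i * cnj (z i))" for i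
    unfolding cmod_power2 by (simp add: power2_eq_square algebra_simps)
  then show ?thesis by (simp add: sum.distrib sum_subtractf sum_distrib_left)
qed

text \<open>The variance identity for finitely many complex numbers.\<close>

lemma sum_norm_square_mean:
  fixes y :: "'i \<Rightarrow> complex"
  assumes "finite I" "I \<noteq> {}"
  shows "(\<Sum>i\<in>I. (cmod (y i - (\<Sum>i\<in>I. y i) / of_nat (card I)))\<^sup>2)
     = (\<Sum>i\<in>I. (cmod (y i))\<^sup>2) - (cmod (\<Sum>i\<in>I. y i))\<^sup>2 / card I"
proof -
  let ?s = "\<Sum>i\<in>I. y i" and ?n = "card I"
  have n: "real ?n > 0" using assms by (simp add: card_gt_0_iff)
  have "(\<Sum>i\<in>I. y i * cnj (?s / of_nat ?n)) = ?s * cnj ?s / of_nat ?n"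
    by (simp only: complex_cnj_divide complex_cnj_of_nat times_divide_eq_right
        sum_divide_distrib[symmetric] sum_distrib_right[symmetric])
  then have "Re (\<Sum>i\<in>I. y i * cnj (?s / of_nat ?n)) = (cmod ?s)\<^sup>2 / ?n"
    by (simp only: complex_norm_square[symmetric]) (simp only: Re_divide_of_nat Re_complex_of_real)
  moreover have "(\<Sum>i\<in>I. (cmod (?s / of_nat ?n))\<^sup>2) = (cmod ?s)\<^sup>2 / ?n"
    using n by (simp add: norm_divide power_divide power2_eq_square)
  ultimately show ?thesis unfolding sum_norm_square_diff by simp
qed

text \<open>If \<open>M u = v\<close> for unit vectors \<open>u\<close>, \<open>v\<close> and \<open>\<parallel>M\<^sup>* v\<parallel> \<le> 1\<close>, then \<open>M\<^sup>* v = u\<close>.\<close>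

lemma adjoint_of_attained:
  fixes M :: "'i \<Rightarrow> 'j \<Rightarrow> complex"
  assumes Mu: "\<And>i. i \<in> I \<Longrightarrow> (\<Sum>j\<in>J. M i j * u j) = v i" and "finite J"
    and u: "(\<Sum>j\<in>J. (cmod (u j))\<^sup>2) = 1" and v: "(\<Sum>i\<in>I. (cmod (v i))\<^sup>2) = 1"
    and le: "(\<Sum>j\<in>J. (cmod (\<Sum>i\<in>I. cnj (M i j) * v i))\<^sup>2) \<le> 1" and "j \<in> J"
  shows "(\<Sum>i\<in>I. cnj (M i j) * v i) = u j"
proof -
  let ?t = "\<lambda>j. \<Sum>i\<in>I. cnj (M i j) * v i"
  have "(\<Sum>j\<in>J. ?t j * cnj (u j)) = (\<Sum>i\<in>I. v i * cnj (\<Sum>j\<in>J. M i j * u j))"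
    by (simp add: sum_distrib_left sum_distrib_right) (subst sum.swap, simp add: mult_ac)
  also have "\<dots> = (\<Sum>i\<in>I. v i * cnj (v i))" by (simp add: Mu)
  also have "\<dots> = of_real (\<Sum>i\<in>I. (cmod (v i))\<^sup>2)" by (simp only: of_real_sum complex_norm_square)
  finally have "(\<Sum>j\<in>J. (cmod (?t j - u j))\<^sup>2) \<le> 0"
    unfolding sum_norm_square_diff using le u v by simp
  then have "(\<Sum>j\<in>J. (cmod (?t j - u j))\<^sup>2) = 0" by (meson order_antisym sum_nonneg zero_le_power2)
  then show ?thesis using \<open>finite J\<close> \<open>j \<in> J\<close> by (simp add: sum_nonneg_eq_0_iff)
qed

context contractive_series
begin

text \<open>
  The hypothesis says that the coefficients of the letters attain on \<open>\<zeta>\<close> the largest value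
  \<open>g' g\<close> that contractivity of each single coefficient permits.  Hence equality holds in the
  Cauchy--Schwarz and triangle inequalities: for fixed \<open>k\<close> the vectors \<open>c\<^sub>k\<^sub>l \<zeta>\<^sub>l\<close> coincide for all \<open>l\<close>, and
  all \<open>\<zeta>\<^sub>l\<close> have the same norm.
\<close>

lemma exists_isometric_frames:
  assumes g: "0 < g'" "0 < g"
    and le: "(\<Sum>l<g. \<Sum>b<d. (cmod (\<zeta> l b))\<^sup>2) \<le> 1"
    and att: "(\<Sum>k<g'. \<Sum>a<d'. (cmod (\<Sum>l<g. \<Sum>b<d. c [(k, l)] a b * \<zeta> l b))\<^sup>2) = g' * g"
  obtains u v where "\<And>l. l < g \<Longrightarrow> (\<Sum>b<d. (cmod (u l b))\<^sup>2) = 1"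
    and "\<And>k. k < g' \<Longrightarrow> (\<Sum>a<d'. (cmod (v k a))\<^sup>2) = 1"
    and "\<And>k l a. k < g' \<Longrightarrow> l < g \<Longrightarrow> a < d' \<Longrightarrow> (\<Sum>b<d. c [(k, l)] a b * u l b) = v k a"
proof -
  define y where "y k l a = (\<Sum>b<d. c [(k, l)] a b * \<zeta> l b)" for k l a
  define E where "E l = (\<Sum>b<d. (cmod (\<zeta> l b))\<^sup>2)" for l
  define s where "s k a = (\<Sum>l<g. y k l a)" for k a
  define T where "T k = (\<Sum>a<d'. (cmod (s k a))\<^sup>2)" for k
  have yE: "(\<Sum>a<d'. (cmod (y k l a))\<^sup>2) \<le> E l" if "k < g'" "l < g" for k l
    unfolding y_def E_def by (rule letter_inequality[OF that])
  have var: "(\<Sum>a<d'. \<Sum>l<g. (cmod (y k l a - s k a / g))\<^sup>2) = (\<Sum>l<g. \<Sum>a<d'. (cmod (y k l a))\<^sup>2) - T k / g" for k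
  proof -
    have "(\<Sum>l<g. (cmod (y k l a - s k a / g))\<^sup>2) = (\<Sum>l<g. (cmod (y k l a))\<^sup>2) - (cmod (s k a))\<^sup>2 / g" for a
      using sum_norm_square_mean[of "{..<g}" "\<lambda>l. y k l a"] g by (simp add: s_def lessThan_empty_iff)
    then show ?thesis unfolding T_def
      by (subst (2) sum.swap) (simp add: sum_subtractf sum_divide_distrib)
  qed
  have le1: "(\<Sum>l<g. \<Sum>a<d'. (cmod (y k l a))\<^sup>2) \<le> 1" if "k < g'" for k
  proof -
    have "(\<Sum>l<g. \<Sum>a<d'. (cmod (y k l a))\<^sup>2) \<le> (\<Sum>l<g. E l)"
      using yE[OF that] by (intro sum_mono) auto
    then show ?thesis using le by (simp add: E_def)
  qed
  have Tle: "T k \<le> g" if "k < g'" for k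
  proof -
    have "0 \<le> (\<Sum>a<d'. \<Sum>l<g. (cmod (y k l a - s k a / g))\<^sup>2)" by (intro sum_nonneg) simp
    then have "T k / g \<le> 1" unfolding var using le1[OF that] by simp
    then show ?thesis using g by (simp add: divide_le_eq)
  qed
  have "(\<Sum>k<g'. T k) = g' * g" using att by (simp add: T_def s_def y_def)
  then have "(\<Sum>k<g'. g - T k) = 0" by (simp add: sum_subtractf)
  then have T: "T k = g" if "k < g'" for k
    using Tle that by (subst (asm) sum_nonneg_eq_0_iff) auto
  have y: "y k l a = s k a / g" if "k < g'" "l < g" "a < d'" for k l a
  proof -
    have "(\<Sum>a<d'. \<Sum>l<g. (cmod (y k l a - s k a / g))\<^sup>2) \<le> 0"
      unfolding var using le1 T that g by simp
    then have "(\<Sum>a<d'. \<Sum>l<g. (cmod (y k l a - s k a / g))\<^sup>2) = 0"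
      by (meson order_antisym sum_nonneg zero_le_power2)
    then show ?thesis using that by (simp add: sum_nonneg_eq_0_iff sum_nonneg)
  qed
  have vs: "(\<Sum>a<d'. (cmod (s k a / g))\<^sup>2) = 1 / g" if "k < g'" for k
    using T[OF that] g by (simp add: T_def norm_divide power_divide power2_eq_square flip: sum_divide_distrib)
  have Ege: "1 / g \<le> E l" if "l < g" for l
  proof -
    have "1 / g = (\<Sum>a<d'. (cmod (y 0 l a))\<^sup>2)" using vs[of 0] y[of 0 l] g that by simp
    then show ?thesis using yE[of 0 l] g that by simp
  qed
  have "(\<Sum>l<g. E l - 1 / g) \<le> 0" using le g by (simp add: sum_subtractf E_def)
  then have "(\<Sum>l<g. E l - 1 / g) = 0" using Ege by (intro order_antisym sum_nonneg) auto
  then have E: "E l = 1 / g" if "l < g" for l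
    using Ege that by (subst (asm) sum_nonneg_eq_0_iff) auto
  have sq: "(cmod (of_real (sqrt g) * z))\<^sup>2 = g * (cmod z)\<^sup>2" for z
    by (simp add: norm_mult power_mult_distrib)
  show thesis
  proof (rule that[of "\<lambda>l b. of_real (sqrt g) * \<zeta> l b" "\<lambda>k a. of_real (sqrt g) * (s k a / g)"])
    fix l assume "l < g"
    then show "(\<Sum>b<d. (cmod (of_real (sqrt g) * \<zeta> l b))\<^sup>2) = 1"
      unfolding sq using E g by (simp add: E_def flip: sum_distrib_left)
  next
    fix k assume "k < g'"
    then show "(\<Sum>a<d'. (cmod (of_real (sqrt g) * (s k a / g)))\<^sup>2) = 1"
      unfolding sq using vs g by (simp flip: sum_distrib_left)
  next
    fix k l a assume "k < g'" "l < g" "a < d'"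
    then have "(\<Sum>b<d. c [(k, l)] a b * \<zeta> l b) = s k a / g" using y by (simp add: y_def)
    then show "(\<Sum>b<d. c [(k, l)] a b * (of_real (sqrt g) * \<zeta> l b)) = of_real (sqrt g) * (s k a / g)"
      by (simp add: mult.left_commute flip: sum_distrib_left)
  qed
qed

text \<open>
  In coordinates that start with the \<open>u\<^sub>l\<close> and the \<open>v\<^sub>k\<close>, the coefficient of \<open>(k, l)\<close> has the matrix unit
  \<open>E\<^sub>k\<^sub>l\<close> in its upper left corner and no other entry in the first \<open>g'\<close> rows or \<open>g\<close> columns, while the coefficients of
  all other words vanish in these rows and columns.
\<close>

lemma frames_properties:
  assumes g: "0 < g'" "0 < g"
    and unit_u: "\<forall>l<g. (\<Sum>b<d. (cmod (u l b))\<^sup>2) = 1"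
    and unit_v: "\<forall>k<g'. (\<Sum>a<d'. (cmod (v k a))\<^sup>2) = 1"
    and maps: "\<forall>k<g'. \<forall>l<g. \<forall>a<d'. (\<Sum>b<d. c [(k, l)] a b * u l b) = v k a"
  shows adjoint_frame: "\<And>k l b. k < g' \<Longrightarrow> l < g \<Longrightarrow> b < d \<Longrightarrow> (\<Sum>a<d'. cnj (c [(k, l)] a b) * v k a) = u l b"
    and right_annihilated: "\<And>w l a. set w \<subseteq> {..<g'} \<times> {..<g} \<Longrightarrow> l < g \<Longrightarrow> a < d' \<Longrightarrow> (\<And>k. w \<noteq> [(k, l)]) \<Longrightarrow>
          (\<Sum>b<d. c w a b * u l b) = 0"
    and left_annihilated: "\<And>w k b. set w \<subseteq> {..<g'} \<times> {..<g} \<Longrightarrow> k < g' \<Longrightarrow> b < d \<Longrightarrow> (\<And>l. w \<noteq> [(k, l)]) \<Longrightarrow>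
          (\<Sum>a<d'. cnj (c w a b) * v k a) = 0"
    and right_orthogonal: "\<And>l m. l < g \<Longrightarrow> m < g \<Longrightarrow> l \<noteq> m \<Longrightarrow> (\<Sum>b<d. u l b * cnj (u m b)) = 0"
    and left_orthogonal: "\<And>k m. k < g' \<Longrightarrow> m < g' \<Longrightarrow> k \<noteq> m \<Longrightarrow> (\<Sum>a<d'. v k a * cnj (v m a)) = 0"
proof -
  note u = unit_u[rule_format] and v = unit_v[rule_format] and cu = maps[rule_format]
  interpret dual: contractive_series g g' d d' "\<lambda>w b a. cnj (c (dual_word w) a b)" by (rule dual)
  have dw: "dual_word [(l, k)] = [(k, l)]" for k l by (simp add: dual_word_def)
  show adj: "(\<Sum>a<d'. cnj (c [(k, l)] a b) * v k a) = u l b" if "k < g'" "l < g" "b < d" for k l b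
    using dual.letter_inequality[of l k "v k"] that
    by (intro adjoint_of_attained[where J = "{..<d}"]) (auto simp: u v cu dw)
  show right: "(\<Sum>b<d. c w a b * u l b) = 0"
    if "set w \<subseteq> {..<g'} \<times> {..<g}" "l < g" "a < d'" "\<And>k. w \<noteq> [(k, l)]" for w l a
    using that g by (intro annihilates) (auto simp: u v cu)
  show left: "(\<Sum>a<d'. cnj (c w a b) * v k a) = 0"
    if w: "set w \<subseteq> {..<g'} \<times> {..<g}" "k < g'" "b < d" "\<And>l. w \<noteq> [(k, l)]" for w k b
  proof -
    have "dual_word w \<noteq> [(l, k)]" for l
      using w(4)[of l] dual_word_dual_word[of w] dw[of l k] by metis
    then have "(\<Sum>a<d'. cnj (c (dual_word (dual_word w)) a b) * v k a) = 0"
      using w g by (intro dual.annihilates) (auto simp: u v adj dw set_dual_word)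
    then show ?thesis by simp
  qed
  show "(\<Sum>b<d. u l b * cnj (u m b)) = 0" if lm: "l < g" "m < g" "l \<noteq> m" for l m
  proof -
    have "(\<Sum>b<d. u l b * cnj (u m b)) = (\<Sum>b<d. (\<Sum>a<d'. cnj (c [(0, l)] a b) * v 0 a) * cnj (u m b))"
      using adj g lm by simp
    also have "\<dots> = (\<Sum>a<d'. v 0 a * cnj (\<Sum>b<d. c [(0, l)] a b * u m b))"
      by (simp add: sum_distrib_left sum_distrib_right) (subst sum.swap, simp add: mult_ac)
    also have "\<dots> = 0" using right[of "[(0, l)]" m] g lm by simp
    finally show ?thesis .
  qed
  show "(\<Sum>a<d'. v k a * cnj (v m a)) = 0" if km: "k < g'" "m < g'" "k \<noteq> m" for k m
  proof -
    have "(\<Sum>a<d'. v k a * cnj (v m a)) = (\<Sum>a<d'. (\<Sum>b<d. c [(k, 0)] a b * u 0 b) * cnj (v m a))"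
      using cu g km by simp
    also have "\<dots> = (\<Sum>b<d. u 0 b * cnj (\<Sum>a<d'. cnj (c [(k, 0)] a b) * v m a))"
      by (simp add: sum_distrib_left sum_distrib_right) (subst sum.swap, simp add: mult_ac)
    also have "\<dots> = 0" using left[of "[(k, 0)]" m] g km by simp
    finally show ?thesis .
  qed
qed

end

section \<open>The operator norm and contractive matrices\<close>

lemma contr_reindex_imp:
  assumes "contr I J A" and \<phi>: "bij_betw \<phi> I' I" and \<psi>: "bij_betw \<psi> J' J"
  shows "contr I' J' (\<lambda>i j. A (\<phi> i) (\<psi> j))"
  unfolding contr_def
proof (intro allI)
  fix \<xi> :: "'d \<Rightarrow> complex"
  let ?\<eta> = "\<lambda>j. \<xi> (inv_into J' \<psi> j)"
  have inv: "?\<eta> (\<psi> j) = \<xi> j" if "j \<in> J'" for j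
    using that \<psi> by (simp add: bij_betw_inv_into_left)
  have "(\<Sum>i\<in>I'. (cmod (\<Sum>j\<in>J'. A (\<phi> i) (\<psi> j) * \<xi> j))\<^sup>2) = (\<Sum>i\<in>I'. (cmod (\<Sum>j\<in>J. A (\<phi> i) j * ?\<eta> j))\<^sup>2)"
    by (simp add: sum.reindex_bij_betw[OF \<psi>, symmetric] inv cong: sum.cong)
  also have "\<dots> = (\<Sum>i\<in>I. (cmod (\<Sum>j\<in>J. A i j * ?\<eta> j))\<^sup>2)"
    by (rule sum.reindex_bij_betw[OF \<phi>])
  also have "\<dots> \<le> (\<Sum>j\<in>J. (cmod (?\<eta> j))\<^sup>2)" by (rule assms(1)[unfolded contr_def, rule_format])
  also have "\<dots> = (\<Sum>j\<in>J'. (cmod (\<xi> j))\<^sup>2)"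
    by (simp add: sum.reindex_bij_betw[OF \<psi>, symmetric] inv cong: sum.cong)
  finally show "(\<Sum>i\<in>I'. (cmod (\<Sum>j\<in>J'. A (\<phi> i) (\<psi> j) * \<xi> j))\<^sup>2) \<le> (\<Sum>j\<in>J'. (cmod (\<xi> j))\<^sup>2)" .
qed

lemma block_index_less: "(k * N + r < m * N)" if "k < m" "r < N" for k r m N :: nat
proof -
  have "k * N + r < Suc k * N" using that by simp
  also have "\<dots> \<le> m * N" using that by (intro mult_le_mono1) simp
  finally show ?thesis .
qed

lemma block_index_cases:
  fixes i m N :: nat
  assumes "i < m * N"
  obtains k r where "k < m" "r < N" "i = k * N + r"
proof
  have "N > 0" using assms by (cases N) auto
  then show "i div N < m" "i mod N < N" "i = i div N * N + i mod N"
    using assms by (auto simp: less_mult_imp_div_less)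
qed

lemma bij_betw_block_index: "bij_betw (\<lambda>(k, r). k * N + r) ({..<m} \<times> {..<N}) {..<m * N :: nat}"
  by (rule bij_betwI[where g = "\<lambda>i. (i div N, i mod N)"])
     (auto simp: block_index_less less_mult_imp_div_less elim: block_index_cases)

lemma sum_block_index: "(\<Sum>i<m * N. F i) = (\<Sum>k<m. \<Sum>r<N. F (k * N + r))" for N :: nat
  using sum.reindex_bij_betw[OF bij_betw_block_index[of N m], of F]
  by (simp add: sum.cartesian_product' split_def)

lemma contr_blocks_iff:
  fixes m n N :: nat
  shows "contr {..<m * N} {..<n * N} F \<longleftrightarrow>
     contr ({..<m} \<times> {..<N}) ({..<n} \<times> {..<N}) (\<lambda>(k, r) (l, s). F (k * N + r) (l * N + s))"
proof
  assume "contr {..<m * N} {..<n * N} F"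
  from contr_reindex_imp[OF this bij_betw_block_index bij_betw_block_index]
  show "contr ({..<m} \<times> {..<N}) ({..<n} \<times> {..<N}) (\<lambda>(k, r) (l, s). F (k * N + r) (l * N + s))"
    by (simp add: split_def)
next
  assume *: "contr ({..<m} \<times> {..<N}) ({..<n} \<times> {..<N}) (\<lambda>(k, r) (l, s). F (k * N + r) (l * N + s))"
  have "bij_betw (\<lambda>i. (i div N, i mod N)) {..<m * N} ({..<m} \<times> {..<N})" for m
    by (rule bij_betwI[where g = "\<lambda>(k, r). k * N + r"])
       (auto simp: block_index_less less_mult_imp_div_less elim: block_index_cases)
  from contr_reindex_imp[OF * this this] show "contr {..<m * N} {..<n * N} F" by simp
qed

lemma eucl_norm_square: "(eucl_norm v)\<^sup>2 = (\<Sum>i<dim_vec v. (cmod (vec_index v i))\<^sup>2)"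
  by (simp add: eucl_norm_def L2_set_def sum_nonneg)

lemma eucl_norm_nonneg: "0 \<le> eucl_norm v"
  by (simp add: eucl_norm_def)

lemma mult_mat_vec_index:
  assumes "A \<in> carrier_mat m n" "v \<in> carrier_vec n" "i < m"
  shows "vec_index (A *\<^sub>v v) i = (\<Sum>j<n. A $$ (i, j) * vec_index v j)"
  using assms by (auto simp: scalar_prod_def lessThan_atLeast0 intro!: sum.cong)

lemma eucl_norm_mult_mat_vec:
  assumes "A \<in> carrier_mat m n" "v \<in> carrier_vec n"
  shows "(eucl_norm (A *\<^sub>v v))\<^sup>2 = (\<Sum>i<m. (cmod (\<Sum>j<n. A $$ (i, j) * vec_index v j))\<^sup>2)"
proof -
  have "dim_vec (A *\<^sub>v v) = m" using assms by simp
  then show ?thesis unfolding eucl_norm_square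
    by (simp only:) (intro sum.cong refl, simp only: mult_mat_vec_index[OF assms] lessThan_iff)
qed

lemma bdd_above_op_norm:
  "bdd_above ((\<lambda>v. eucl_norm (A *\<^sub>v v)) ` {v \<in> carrier_vec (dim_col A). eucl_norm v \<le> 1})"
proof (rule bdd_aboveI2)
  fix v assume v: "v \<in> {v \<in> carrier_vec (dim_col A). eucl_norm v \<le> 1}"
  then have "(eucl_norm v)\<^sup>2 \<le> 1" using eucl_norm_nonneg[of v] by (auto intro: power_le_one)
  have A: "A \<in> carrier_mat (dim_row A) (dim_col A)" by simp
  have "(eucl_norm (A *\<^sub>v v))\<^sup>2
      = (\<Sum>i<dim_row A. (cmod (\<Sum>j<dim_col A. A $$ (i, j) * vec_index v j))\<^sup>2)"
    using v by (intro eucl_norm_mult_mat_vec) auto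
  also have "\<dots> \<le> (\<Sum>i<dim_row A. (\<Sum>j<dim_col A. (cmod (A $$ (i, j)))\<^sup>2) * (eucl_norm v)\<^sup>2)"
    using v unfolding eucl_norm_square by (intro sum_mono Cauchy_Schwarz_complex_sum[THEN order_trans]) auto
  also have "\<dots> \<le> (\<Sum>i<dim_row A. (\<Sum>j<dim_col A. (cmod (A $$ (i, j)))\<^sup>2) * 1)"
    using \<open>(eucl_norm v)\<^sup>2 \<le> 1\<close> by (intro sum_mono mult_left_mono) (auto intro: sum_nonneg)
  finally show "eucl_norm (A *\<^sub>v v) \<le> sqrt (\<Sum>i<dim_row A. \<Sum>j<dim_col A. (cmod (A $$ (i, j)))\<^sup>2)"
    by (simp add: real_le_rsqrt)
qed

lemma op_norm_ge:
  assumes "A \<in> carrier_mat m n" "v \<in> carrier_vec n" "eucl_norm v \<le> 1"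
  shows "eucl_norm (A *\<^sub>v v) \<le> op_norm A"
  unfolding op_norm_def using assms by (intro cSUP_upper bdd_above_op_norm) auto

lemma op_norm_le:
  assumes "A \<in> carrier_mat m n" "\<And>v. v \<in> carrier_vec n \<Longrightarrow> eucl_norm v \<le> 1 \<Longrightarrow> eucl_norm (A *\<^sub>v v) \<le> K"
  shows "op_norm A \<le> K"
  unfolding op_norm_def
proof (rule cSUP_least)
  have "eucl_norm (0\<^sub>v (dim_col A)) \<le> 1" by (simp add: eucl_norm_def L2_set_def)
  then show "{v \<in> carrier_vec (dim_col A). eucl_norm v \<le> 1} \<noteq> {}"
    using zero_carrier_vec by blast
qed (use assms in auto)

lemma op_norm_nonneg: "0 \<le> op_norm A"
proof -
  have "eucl_norm (0\<^sub>v (dim_col A)) \<le> 1" by (simp add: eucl_norm_def L2_set_def)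
  then have "eucl_norm (A *\<^sub>v 0\<^sub>v (dim_col A)) \<le> op_norm A" by (intro op_norm_ge) auto
  then show ?thesis using eucl_norm_nonneg order_trans by blast
qed

lemma op_norm_le_1_iff:
  assumes A: "A \<in> carrier_mat m n"
  shows "op_norm A \<le> 1 \<longleftrightarrow> contr {..<m} {..<n} (\<lambda>i j. A $$ (i, j))"
proof
  assume le: "op_norm A \<le> 1"
  show "contr {..<m} {..<n} (\<lambda>i j. A $$ (i, j))"
    unfolding contr_def
  proof (intro allI)
    fix \<xi> :: "nat \<Rightarrow> complex"
    define S where "S = (\<Sum>j<n. (cmod (\<xi> j))\<^sup>2)"
    have S: "S \<ge> 0" by (simp add: S_def sum_nonneg)
    show "(\<Sum>i<m. (cmod (\<Sum>j<n. A $$ (i, j) * \<xi> j))\<^sup>2) \<le> (\<Sum>j<n. (cmod (\<xi> j))\<^sup>2)"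
    proof (cases "S = 0")
      case True
      then have "\<forall>j\<in>{..<n}. \<xi> j = 0" by (simp add: S_def sum_nonneg_eq_0_iff)
      then show ?thesis by simp
    next
      case False
      define v where "v = Matrix.vec n (\<lambda>j. \<xi> j / of_real (sqrt S))"
      have v: "v \<in> carrier_vec n" by (simp add: v_def)
      have sq: "(cmod (z / of_real (sqrt S)))\<^sup>2 = (cmod z)\<^sup>2 / S" for z
        using S by (simp add: norm_divide power_divide)
      have "(eucl_norm v)\<^sup>2 = 1"
        using False unfolding eucl_norm_square
        by (simp add: v_def sq del: of_real_sqrt) (simp add: S_def flip: sum_divide_distrib)
      then have "eucl_norm v \<le> 1" using eucl_norm_nonneg[of v] by (auto simp: power2_eq_1_iff)
      with op_norm_ge[OF A v] le have "(eucl_norm (A *\<^sub>v v))\<^sup>2 \<le> 1"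
        by (simp add: eucl_norm_nonneg power_le_one)
      also have "(eucl_norm (A *\<^sub>v v))\<^sup>2 = (\<Sum>i<m. (cmod ((\<Sum>j<n. A $$ (i, j) * \<xi> j) / of_real (sqrt S)))\<^sup>2)"
        unfolding eucl_norm_mult_mat_vec[OF A v] by (simp add: v_def sum_divide_distrib)
      also have "\<dots> = (\<Sum>i<m. (cmod (\<Sum>j<n. A $$ (i, j) * \<xi> j))\<^sup>2) / S"
        unfolding sq by (simp add: sum_divide_distrib)
      finally show ?thesis using False S by (simp add: divide_le_eq S_def)
    qed
  qed
next
  assume con: "contr {..<m} {..<n} (\<lambda>i j. A $$ (i, j))"
  show "op_norm A \<le> 1"
  proof (rule op_norm_le[OF A])
    fix v :: "complex Matrix.vec" assume v: "v \<in> carrier_vec n" "eucl_norm v \<le> 1"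
    have "(eucl_norm (A *\<^sub>v v))\<^sup>2 \<le> (\<Sum>j<n. (cmod (vec_index v j))\<^sup>2)"
      unfolding eucl_norm_mult_mat_vec[OF A v(1)] using con by (simp add: contr_def)
    also have "\<dots> = (eucl_norm v)\<^sup>2" using v unfolding eucl_norm_square by simp
    finally show "eucl_norm (A *\<^sub>v v) \<le> 1"
      using v eucl_norm_nonneg[of v] by (simp add: abs_le_square_iff[symmetric] eucl_norm_nonneg)
  qed
qed

lemma op_norm_smult_le:
  assumes A: "A \<in> carrier_mat m n"
  shows "op_norm (z \<cdot>\<^sub>m A) \<le> cmod z * op_norm A"
proof (rule op_norm_le)
  fix v :: "complex Matrix.vec" assume v: "v \<in> carrier_vec n" "eucl_norm v \<le> 1"
  have zA: "z \<cdot>\<^sub>m A \<in> carrier_mat m n" using A by simp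
  have "(eucl_norm ((z \<cdot>\<^sub>m A) *\<^sub>v v))\<^sup>2 = (\<Sum>i<m. (cmod (z * (\<Sum>j<n. A $$ (i, j) * vec_index v j)))\<^sup>2)"
    unfolding eucl_norm_mult_mat_vec[OF zA v(1)] using A by (auto simp: sum_distrib_left mult.assoc intro!: sum.cong)
  also have "\<dots> = (cmod z * eucl_norm (A *\<^sub>v v))\<^sup>2"
    unfolding power_mult_distrib eucl_norm_mult_mat_vec[OF A v(1)]
    by (simp only: norm_mult power_mult_distrib sum_distrib_left[symmetric])
  finally have "eucl_norm ((z \<cdot>\<^sub>m A) *\<^sub>v v) = cmod z * eucl_norm (A *\<^sub>v v)"
    by (simp add: eucl_norm_nonneg)
  also have "\<dots> \<le> cmod z * op_norm A" using op_norm_ge[OF A v] by (simp add: mult_left_mono)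
  finally show "eucl_norm ((z \<cdot>\<^sub>m A) *\<^sub>v v) \<le> cmod z * op_norm A" .
qed (use A in auto)

text \<open>The supremum in the operator norm is attained, by compactness of the unit ball.\<close>

lemma op_norm_attained:
  assumes A: "A \<in> carrier_mat m n"
  obtains \<xi> where "(\<Sum>j<n. (cmod (\<xi> j))\<^sup>2) \<le> 1"
    and "(\<Sum>i<m. (cmod (\<Sum>j<n. A $$ (i, j) * \<xi> j))\<^sup>2) = (op_norm A)\<^sup>2"
proof -
  define F where "F \<xi> = sqrt (\<Sum>i<m. (cmod (\<Sum>j<n. A $$ (i, j) * \<xi> j))\<^sup>2)" for \<xi>
  define B where "B = (PiE UNIV (\<lambda>j. if j < n then cball 0 1 else {0 :: complex}))"
  have "compactin (product_topology (\<lambda>_. euclidean) UNIV) B"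
    unfolding B_def by (subst compactin_PiE) auto
  then have B: "compact B" by (simp add: euclidean_product_topology)
  have cont: "continuous_on S (\<lambda>\<xi>. \<Sum>j<n. (cmod (\<xi> j))\<^sup>2)" "continuous_on S F" for S
    unfolding F_def by (intro continuous_intros continuous_on_subset[OF continuous_on_product_coordinates]; simp)+
  define K where "K = B \<inter> {\<xi>. (\<Sum>j<n. (cmod (\<xi> j))\<^sup>2) \<le> 1}"
  have "compact K" unfolding K_def
    by (intro compact_Int_closed B closed_Collect_le cont continuous_intros)
  moreover have "(\<lambda>_. 0) \<in> K" by (auto simp: K_def B_def)
  ultimately obtain \<xi> where \<xi>: "\<xi> \<in> K" "\<And>\<eta>. \<eta> \<in> K \<Longrightarrow> F \<eta> \<le> F \<xi>"
    using continuous_attains_sup[of K F] cont by blast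
  have Fe: "F \<eta> = eucl_norm (A *\<^sub>v Matrix.vec n \<eta>)" for \<eta>
  proof -
    have v: "Matrix.vec n \<eta> \<in> carrier_vec n" by simp
    show ?thesis unfolding F_def
      by (rule real_sqrt_unique) (simp_all add: eucl_norm_mult_mat_vec[OF A v] eucl_norm_nonneg)
  qed
  have unit: "eucl_norm v \<le> 1 \<longleftrightarrow> (\<Sum>j<n. (cmod (vec_index v j))\<^sup>2) \<le> 1" if "v \<in> carrier_vec n" for v
    using that by (simp add: eucl_norm_def L2_set_def)
  have "op_norm A = F \<xi>"
  proof (rule order_antisym)
    show "op_norm A \<le> F \<xi>"
    proof (rule op_norm_le[OF A])
      fix v :: "complex Matrix.vec" assume v: "v \<in> carrier_vec n" "eucl_norm v \<le> 1"
      define \<eta> where "\<eta> = (\<lambda>j. if j < n then vec_index v j else 0)"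
      have S: "(\<Sum>j<n. (cmod (vec_index v j))\<^sup>2) \<le> 1" using unit v by simp
      have "cmod (vec_index v j) \<le> 1" if "j < n" for j
      proof -
        have "(cmod (vec_index v j))\<^sup>2 \<le> 1"
          using S that member_le_sum[of j "{..<n}" "\<lambda>j. (cmod (vec_index v j))\<^sup>2"] by auto
        then show ?thesis by (simp add: power_le_one_iff)
      qed
      then have "\<eta> \<in> K" using S by (auto simp: K_def B_def \<eta>_def)
      moreover have "Matrix.vec n \<eta> = v" using v by (auto simp: \<eta>_def)
      ultimately show "eucl_norm (A *\<^sub>v v) \<le> F \<xi>" using \<xi>(2)[of \<eta>] by (simp add: Fe)
    qed
    show "F \<xi> \<le> op_norm A"
      unfolding Fe using \<xi>(1) by (intro op_norm_ge[OF A]) (auto simp: unit K_def)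
  qed
  moreover have "(F \<xi>)\<^sup>2 = (\<Sum>i<m. (cmod (\<Sum>j<n. A $$ (i, j) * \<xi> j))\<^sup>2)"
    by (simp add: F_def sum_nonneg)
  ultimately show thesis using \<xi>(1) by (intro that[of \<xi>]) (auto simp: K_def)
qed

section \<open>Entries of evaluated words\<close>

text \<open>The entries of the blocks of a block matrix, in the form expected by \<open>wev\<close>.\<close>

definition entries :: "nat \<Rightarrow> complex mat \<Rightarrow> nat \<times> nat \<Rightarrow> nat \<Rightarrow> nat \<Rightarrow> complex" where
  "entries N X = (\<lambda>(k, l) r s. X $$ (k * N + r, l * N + s))"

lemma word_eval_carrier: "word_eval N X w \<in> carrier_mat N N"
  by (induction w) (auto simp: word_eval_def nc_block_def split_def)

lemma word_eval_index:
  assumes "r < N" "s < N"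
  shows "word_eval N X w $$ (r, s) = wev N (entries N X) w r s"
  using assms
proof (induction w arbitrary: r)
  case Nil
  then show ?case by (simp add: word_eval_def)
next
  case (Cons a w)
  have "word_eval N X (a # w) = nc_block N X (fst a) (snd a) * word_eval N X w"
    by (simp add: word_eval_def split_def)
  moreover have "nc_block N X (fst a) (snd a) \<in> carrier_mat N N" by (simp add: nc_block_def)
  ultimately have "word_eval N X (a # w) $$ (r, s)
      = (\<Sum>t<N. nc_block N X (fst a) (snd a) $$ (r, t) * word_eval N X w $$ (t, s))"
    using Cons.prems word_eval_carrier[of N X w]
    by (auto simp: scalar_prod_def lessThan_atLeast0 intro!: sum.cong)
  also have "\<dots> = (\<Sum>t<N. entries N X a r t * wev N (entries N X) w t s)"
    using Cons by (intro sum.cong) (auto simp: nc_block_def entries_def split_def)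
  finally show ?case by simp
qed

lemma wev_scaled:
  assumes "\<And>a r s. a \<in> S \<Longrightarrow> r < N \<Longrightarrow> s < N \<Longrightarrow> y a r s = z * x a r s"
    and "set w \<subseteq> S" "r < N" "s < N"
  shows "wev N y w r s = z ^ length w * wev N x w r s"
  using assms(2-)
proof (induction w arbitrary: r)
  case (Cons a w)
  then have "wev N y (a # w) r s = (\<Sum>t<N. z * x a r t * (z ^ length w * wev N x w t s))"
    by (auto simp: assms(1) intro!: sum.cong)
  then show ?case by (simp add: sum_distrib_left mult_ac)
qed auto

lemma entries_smult:
  assumes "X \<in> nc_mat g' g N" "a \<in> {..<g'} \<times> {..<g}" "r < N" "s < N"
  shows "entries N (z \<cdot>\<^sub>m X) a r s = z * entries N X a r s"
  using assms by (auto simp: entries_def nc_mat_def block_index_less)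

lemma kron_index:
  assumes "A \<in> carrier_mat m n" "B \<in> carrier_mat N M" "a < m" "b < n" "r < N" "s < M"
  shows "kron A B $$ (a * N + r, b * M + s) = A $$ (a, b) * B $$ (r, s)"
  using assms by (auto simp: kron_def block_index_less)

lemma homog_term_index:
  assumes "\<And>w. c w \<in> carrier_mat m n" "a < m" "b < n" "r < N" "s < N"
  shows "homog_term g' g m n c p N X $$ (a * N + r, b * N + s)
     = (\<Sum>w\<in>words g' g p. c w $$ (a, b) * wev N (entries N X) w r s)"
proof -
  have "kron (c w) (word_eval N X w) $$ (a * N + r, b * N + s) = c w $$ (a, b) * wev N (entries N X) w r s" for w
    using assms kron_index[OF assms(1) word_eval_carrier] by (simp add: word_eval_index)
  then show ?thesis using assms by (simp add: homog_term_def block_index_less)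
qed

lemma homog_term_smult:
  assumes c: "\<And>w. c w \<in> carrier_mat m n" and X: "X \<in> nc_mat g' g N" and ij: "i < m * N" "j < n * N"
  shows "homog_term g' g m n c p N (z \<cdot>\<^sub>m X) $$ (i, j) = z ^ p * homog_term g' g m n c p N X $$ (i, j)"
proof -
  obtain a r where i: "a < m" "r < N" "i = a * N + r" using ij(1) by (rule block_index_cases)
  obtain b s where j: "b < n" "s < N" "j = b * N + s" using ij(2) by (rule block_index_cases)
  have "wev N (entries N (z \<cdot>\<^sub>m X)) w r s = z ^ p * wev N (entries N X) w r s" if "w \<in> words g' g p" for w
    using that wev_scaled[where S = "{..<g'} \<times> {..<g}", OF entries_smult[OF X]] i j by (auto simp: words_def)
  then show ?thesis using i j
    by (simp add: homog_term_index[OF c] sum_distrib_left mult.left_commute)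
qed

lemma pencil_eval_index:
  assumes "truly_linear_pencil g' g d' d A" "a < d'" "b < d" "r < N" "s < N"
  shows "pencil_eval g' g d' d A N Y $$ (a * N + r, b * N + s)
     = (\<Sum>i<g'. \<Sum>j<g. A i j $$ (a, b) * Y $$ (i * N + r, j * N + s))"
proof -
  have "kron (A i j) (nc_block N Y i j) $$ (a * N + r, b * N + s) = A i j $$ (a, b) * Y $$ (i * N + r, j * N + s)"
    if "i < g'" "j < g" for i j
    using that assms by (subst kron_index[where m = d' and n = d]) (auto simp: truly_linear_pencil_def nc_block_def)
  then show ?thesis using assms by (simp add: pencil_eval_def block_index_less)
qed

section \<open>Analytic maps and linear pencils\<close>

lemma cfun_analytic_onE:
  assumes "cfun_analytic_on K F W" "p \<in> W"
  obtains c r where "r > 0" and "\<And>z. z \<in> W \<Longrightarrow> \<forall>i<K. cmod (z i - p i) < r \<Longrightarrow>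
       ((\<lambda>m. c m * (\<Prod>i<K. (z i - p i) ^ m i)) has_sum F z) {m. \<forall>i\<ge>K. m i = 0}"
  using assms unfolding cfun_analytic_on_def by blast

lemma cfun_analytic_on_mult_const:
  assumes "cfun_analytic_on K F W"
  shows "cfun_analytic_on K (\<lambda>z. q * F z) W"
  unfolding cfun_analytic_on_def
proof
  fix p assume "p \<in> W"
  from cfun_analytic_onE[OF assms this] obtain c r where cr: "r > 0"
    "\<And>z. z \<in> W \<Longrightarrow> \<forall>i<K. cmod (z i - p i) < r \<Longrightarrow>
       ((\<lambda>m. c m * (\<Prod>i<K. (z i - p i) ^ m i)) has_sum F z) {m. \<forall>i\<ge>K. m i = 0}" by blast
  show "\<exists>c r. r > 0 \<and> (\<forall>z\<in>W. (\<forall>i<K. cmod (z i - p i) < r) \<longrightarrow>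
       ((\<lambda>m. c m * (\<Prod>i<K. (z i - p i) ^ m i)) has_sum q * F z) {m. \<forall>i\<ge>K. m i = 0})"
    using cr(1) has_sum_cmult_right[OF cr(2), of _ q]
    by (intro exI[of _ "\<lambda>m. q * c m"] exI[of _ r]) (auto simp: mult.assoc)
qed

lemma cfun_analytic_on_add:
  assumes "cfun_analytic_on K F W" "cfun_analytic_on K G W"
  shows "cfun_analytic_on K (\<lambda>z. F z + G z) W"
  unfolding cfun_analytic_on_def
proof
  fix p assume p: "p \<in> W"
  obtain c r where cr: "r > 0"
    "\<And>z. z \<in> W \<Longrightarrow> \<forall>i<K. cmod (z i - p i) < r \<Longrightarrow>
       ((\<lambda>m. c m * (\<Prod>i<K. (z i - p i) ^ m i)) has_sum F z) {m. \<forall>i\<ge>K. m i = 0}"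
    using cfun_analytic_onE[OF assms(1) p] by blast
  obtain c' r' where cr': "r' > 0"
    "\<And>z. z \<in> W \<Longrightarrow> \<forall>i<K. cmod (z i - p i) < r' \<Longrightarrow>
       ((\<lambda>m. c' m * (\<Prod>i<K. (z i - p i) ^ m i)) has_sum G z) {m. \<forall>i\<ge>K. m i = 0}"
    using cfun_analytic_onE[OF assms(2) p] by blast
  show "\<exists>c r. r > 0 \<and> (\<forall>z\<in>W. (\<forall>i<K. cmod (z i - p i) < r) \<longrightarrow>
       ((\<lambda>m. c m * (\<Prod>i<K. (z i - p i) ^ m i)) has_sum F z + G z) {m. \<forall>i\<ge>K. m i = 0})"
    using cr(1) cr'(1) has_sum_add[OF cr(2) cr'(2)]
    by (intro exI[of _ "\<lambda>m. c m + c' m"] exI[of _ "min r r'"]) (auto simp: distrib_right)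
qed

lemma cfun_analytic_on_zero: "cfun_analytic_on K (\<lambda>_. 0) W"
  unfolding cfun_analytic_on_def by (auto intro!: exI[of _ "\<lambda>_. 0"] exI[of _ 1])

lemma cfun_analytic_on_sum:
  assumes "\<And>i. i \<in> I \<Longrightarrow> cfun_analytic_on K (F i) W"
  shows "cfun_analytic_on K (\<lambda>z. \<Sum>i\<in>I. F i z) W"
  using assms
  by (induction I rule: infinite_finite_induct) (auto intro: cfun_analytic_on_zero cfun_analytic_on_add)

lemma cfun_analytic_on_coordinate:
  assumes "W \<subseteq> cspace (Suc 0)"
  shows "cfun_analytic_on (Suc 0) (\<lambda>z. z 0) W"
  unfolding cfun_analytic_on_def
proof
  fix p assume "p \<in> W"
  define e where "e = (\<lambda>i :: nat. if i = 0 then 1 else 0 :: nat)"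
  let ?c = "\<lambda>m. if m = (\<lambda>_. 0) then p 0 else if m = e then 1 else 0"
  have ne: "e \<noteq> (\<lambda>_. 0)" by (auto simp: e_def fun_eq_iff)
  have "((\<lambda>m. ?c m * (\<Prod>i<Suc 0. (z i - p i) ^ m i)) has_sum z 0) {m. \<forall>i\<ge>Suc 0. m i = 0}" for z
    using ne by (intro has_sum_finite_neutralI[where B = "{(\<lambda>_. 0), e}"]) (auto simp: e_def)
  then show "\<exists>c r. r > 0 \<and> (\<forall>z\<in>W. (\<forall>i<Suc 0. cmod (z i - p i) < r) \<longrightarrow>
       ((\<lambda>m. c m * (\<Prod>i<Suc 0. (z i - p i) ^ m i)) has_sum z 0) {m. \<forall>i\<ge>Suc 0. m i = 0})"
    by (intro exI[of _ ?c] exI[of _ 1]) auto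
qed

text \<open>In one variable, a multi-index is determined by its value at \<open>0\<close>.\<close>

lemma cfun_analytic_on_imp_holomorphic:
  assumes "cfun_analytic_on (Suc 0) F {z \<in> cspace (Suc 0). cmod (z 0) < \<rho>}"
  shows "(\<lambda>w. F (\<lambda>i. if i = 0 then w else 0)) holomorphic_on ball 0 \<rho>"
proof -
  let ?e = "\<lambda>w i. if i = (0::nat) then w else (0 :: complex)"
  let ?W = "{z \<in> cspace (Suc 0). cmod (z 0) < \<rho>}"
  have W: "?e w \<in> ?W" if "w \<in> ball 0 \<rho>" for w using that by (auto simp: cspace_def)
  have "(\<lambda>w. F (?e w)) analytic_on {w0}" if w0: "w0 \<in> ball 0 \<rho>" for w0
  proof -
    obtain c r where cr: "r > 0"
      "\<And>z. z \<in> ?W \<Longrightarrow> \<forall>i<Suc 0. cmod (z i - ?e w0 i) < r \<Longrightarrow>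
       ((\<lambda>m. c m * (\<Prod>i<Suc 0. (z i - ?e w0 i) ^ m i)) has_sum F z) {m. \<forall>i\<ge>Suc 0. m i = 0}"
      by (rule cfun_analytic_onE[OF assms W[OF w0]]) (rule that)
    let ?m = "\<lambda>n i. if i = (0::nat) then n else (0::nat)"
    have bij: "bij_betw ?m UNIV {m. \<forall>i\<ge>Suc 0. m i = 0}"
    proof (rule bij_betwI[where g = "\<lambda>m. m 0"])
      fix m :: "nat \<Rightarrow> nat" assume "m \<in> {m. \<forall>i\<ge>Suc 0. m i = 0}"
      then show "?m (m 0) = m" by (simp add: fun_eq_iff)
    qed auto
    obtain r' where r': "r' > 0" "ball w0 r' \<subseteq> ball 0 \<rho>"
      using openE[OF open_ball w0] by blast
    have "(\<lambda>n. c (?m n) * (w - w0) ^ n) sums F (?e w)" if w: "w \<in> ball w0 (min r r')" for w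
    proof -
      have "w \<in> ball 0 \<rho>" using w r' by auto
      moreover have "\<forall>i<Suc 0. cmod (?e w i - ?e w0 i) < r"
        using w by (simp add: dist_norm norm_minus_commute)
      ultimately have "((\<lambda>m. c m * (\<Prod>i<Suc 0. (?e w i - ?e w0 i) ^ m i)) has_sum F (?e w)) {m. \<forall>i\<ge>Suc 0. m i = 0}"
        using cr(2) W by blast
      then have "((\<lambda>n. c (?m n) * (\<Prod>i<Suc 0. (?e w i - ?e w0 i) ^ ?m n i)) has_sum F (?e w)) UNIV"
        by (rule has_sum_reindex_bij_betw[OF bij, THEN iffD2])
      from has_sum_imp_sums[OF this] show ?thesis by (simp only: prod.lessThan_Suc) simp
    qed
    then have "(\<lambda>w. F (?e w)) holomorphic_on ball w0 (min r r')" by (rule power_series_holomorphic)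
    then show ?thesis using cr(1) r'(1) by (auto simp: analytic_at_ball intro!: exI[of _ "min r r'"])
  qed
  then show ?thesis using analytic_on_analytic_at analytic_imp_holomorphic by blast
qed

lemma cdomain_disc:
  assumes "\<rho> > 0"
  shows "cdomain (Suc 0) {z \<in> cspace (Suc 0). cmod (z 0) < \<rho>}"
proof -
  let ?W = "{z \<in> cspace (Suc 0). cmod (z 0) < \<rho>}"
  let ?e = "\<lambda>w i. if i = (0::nat) then w else (0 :: complex)"
  have "open {z :: nat \<Rightarrow> complex. cmod (z 0) < \<rho>}"
    by (intro open_Collect_less continuous_intros continuous_on_product_coordinates)
  then have "openin (top_of_set (cspace (Suc 0))) ?W"
    by (auto simp: openin_open)
  moreover have "continuous_on (ball 0 \<rho>) ?e"
  proof (rule continuous_on_coordinatewise_then_product)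
    fix i show "continuous_on (ball 0 \<rho>) (\<lambda>w. ?e w i)" by (cases "i = 0") auto
  qed
  then have "connected (?e ` ball 0 \<rho>)" by (rule connected_continuous_image) simp
  moreover have "?e ` ball 0 \<rho> = ?W"
  proof
    show "?W \<subseteq> ?e ` ball 0 \<rho>"
    proof
      fix z assume "z \<in> ?W"
      then have "z = ?e (z 0)" "z 0 \<in> ball 0 \<rho>" by (auto simp: cspace_def fun_eq_iff)
      then show "z \<in> ?e ` ball 0 \<rho>" by blast
    qed
  qed (auto simp: cspace_def)
  moreover have "(\<lambda>_. 0) \<in> ?W" using assms by (auto simp: cspace_def)
  ultimately show ?thesis unfolding cdomain_def by auto
qed

lemma nc_mat_smult: "X \<in> nc_mat g' g N \<Longrightarrow> z \<cdot>\<^sub>m X \<in> nc_mat g' g N"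
  by (simp add: nc_mat_def)

text \<open>
  The function \<open>z \<mapsto> f(z X)\<close> is holomorphic on a disc of radius larger than 1, so that it is determined by
  its values near \<open>0\<close>.  This is how information on the power series reaches the whole ball.
\<close>

lemma nc_identity_on_disc:
  assumes f: "nc_analytic_along_maps g' g k' k f" and "N > 0" and X: "X \<in> nc_int_ball g' g N"
    and ij: "i < k' * N" "j < k * N" and p: "p holomorphic_on UNIV" and "\<delta> > 0"
    and eq: "\<And>z. cmod z < \<delta> \<Longrightarrow> f N (z \<cdot>\<^sub>m X) $$ (i, j) = p z"
  shows "f N X $$ (i, j) = p 1"
proof -
  define q where "q = op_norm X"
  have Xc: "X \<in> nc_mat g' g N" and q: "0 \<le> q" "q < 1"
    using X op_norm_nonneg by (auto simp: nc_int_ball_def q_def)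
  \<comment> \<open>Any radius strictly between \<open>1\<close> and \<open>1 / q\<close> would do, but \<open>q\<close> may be \<open>0\<close>.\<close>
  define \<rho> where "\<rho> = 2 / (1 + q)"
  have \<rho>: "\<rho> > 1" "\<rho> * q < 1" using q by (auto simp: \<rho>_def field_simps)
  define W where "W = {z \<in> cspace (Suc 0). cmod (z 0) < \<rho>}"
  have "op_norm (z 0 \<cdot>\<^sub>m X) < 1" if "z \<in> W" for z
  proof -
    have "op_norm (z 0 \<cdot>\<^sub>m X) \<le> cmod (z 0) * q"
      using Xc unfolding q_def nc_mat_def by (rule op_norm_smult_le)
    also have "\<dots> \<le> \<rho> * q" using that q by (intro mult_right_mono) (auto simp: W_def)
    finally show ?thesis using \<rho> by simp
  qed
  then have sub: "(\<lambda>z. z 0 \<cdot>\<^sub>m X) ` W \<subseteq> nc_int_ball g' g N"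
    using Xc by (auto simp: nc_int_ball_def nc_mat_smult)
  have an: "mat_analytic_on (Suc 0) (g' * N) (g * N) (\<lambda>z. z 0 \<cdot>\<^sub>m X) W"
    unfolding mat_analytic_on_def
  proof (intro conjI allI impI ballI)
    fix i j assume "i < g' * N" "j < g * N"
    then have "(z 0 \<cdot>\<^sub>m X) $$ (i, j) = X $$ (i, j) * z 0" for z :: "nat \<Rightarrow> complex"
      using Xc by (simp add: nc_mat_def)
    then show "cfun_analytic_on (Suc 0) (\<lambda>z. (z 0 \<cdot>\<^sub>m X) $$ (i, j)) W"
      by (simp only:) (intro cfun_analytic_on_mult_const cfun_analytic_on_coordinate, auto simp: W_def)
  qed (use Xc in \<open>simp add: nc_mat_def\<close>)
  have "mat_analytic_on (Suc 0) (k' * N) (k * N) (\<lambda>z. f N (z 0 \<cdot>\<^sub>m X)) W"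
    using f[unfolded nc_analytic_along_maps_def, rule_format, of "Suc 0" N W "\<lambda>z. z 0 \<cdot>\<^sub>m X"]
      \<open>N > 0\<close> sub an cdomain_disc[of \<rho>] \<rho> by (auto simp: W_def)
  then have "cfun_analytic_on (Suc 0) (\<lambda>z. f N (z 0 \<cdot>\<^sub>m X) $$ (i, j)) W"
    using ij by (simp add: mat_analytic_on_def)
  then have holo: "(\<lambda>w. f N (w \<cdot>\<^sub>m X) $$ (i, j)) holomorphic_on ball 0 \<rho>"
    using cfun_analytic_on_imp_holomorphic[of "\<lambda>z. f N (z 0 \<cdot>\<^sub>m X) $$ (i, j)" \<rho>] by (simp add: W_def)
  have "f N (1 \<cdot>\<^sub>m X) $$ (i, j) = p 1"
  proof (rule analytic_continuation_open[of "ball 0 (min \<delta> \<rho>)" "ball 0 \<rho>" _ p])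
    show "p holomorphic_on ball 0 \<rho>" using p by (rule holomorphic_on_subset) simp
  qed (use \<rho> \<open>\<delta> > 0\<close> eq holo in \<open>auto simp: dist_norm\<close>)
  moreover have "1 \<cdot>\<^sub>m X = X" by auto
  ultimately show ?thesis by simp
qed

text \<open>The power series condition with given coefficients and radius.\<close>

definition nc_series_on ::
  "nat \<Rightarrow> nat \<Rightarrow> nat \<Rightarrow> nat \<Rightarrow> (word \<Rightarrow> complex mat) \<Rightarrow> real \<Rightarrow> (nat \<Rightarrow> complex mat \<Rightarrow> complex mat) \<Rightarrow> bool" where
  "nc_series_on g' g k' k a \<epsilon> f \<longleftrightarrow> (\<forall>w. a w \<in> carrier_mat k' k) \<and> \<epsilon> > 0 \<and>
     (\<forall>N>0. \<forall>X\<in>nc_mat g' g N. op_norm X < \<epsilon> \<longrightarrow>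
           (\<forall>i < k' * N. \<forall>j < k * N.
              (\<lambda>n. homog_term g' g k' k a n N X $$ (i, j)) sums (f N X $$ (i, j))))"

lemma nc_power_series_iff: "nc_power_series g' g k' k f \<longleftrightarrow> (\<exists>a \<epsilon>. nc_series_on g' g k' k a \<epsilon> f)"
  by (simp add: nc_power_series_def nc_series_on_def)

lemma nc_series_on_ray:
  assumes f: "nc_series_on g' g k' k a \<epsilon> f" and "N > 0" and X: "X \<in> nc_int_ball g' g N"
    and ij: "i < k' * N" "j < k * N" and z: "cmod z < \<epsilon>"
  shows "(\<lambda>n. z ^ n * homog_term g' g k' k a n N X $$ (i, j)) sums (f N (z \<cdot>\<^sub>m X) $$ (i, j))"
proof -
  have Xc: "X \<in> nc_mat g' g N" "op_norm X \<le> 1" using X by (auto simp: nc_int_ball_def)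
  have "op_norm (z \<cdot>\<^sub>m X) \<le> cmod z * op_norm X"
    using Xc(1) unfolding nc_mat_def by (rule op_norm_smult_le)
  also have "\<dots> \<le> cmod z" using Xc(2) by (simp add: mult_left_le)
  finally have "op_norm (z \<cdot>\<^sub>m X) < \<epsilon>" using z by simp
  then have "(\<lambda>n. homog_term g' g k' k a n N (z \<cdot>\<^sub>m X) $$ (i, j)) sums (f N (z \<cdot>\<^sub>m X) $$ (i, j))"
    using f \<open>N > 0\<close> ij nc_mat_smult[OF Xc(1)] by (simp add: nc_series_on_def)
  then show ?thesis using f Xc ij by (simp add: homog_term_smult nc_series_on_def)
qed

text \<open>All words of length at least \<open>m\<close> vanish at \<open>X\<close>.\<close>

definition nc_nilpotent :: "nat \<Rightarrow> nat \<Rightarrow> nat \<Rightarrow> complex mat \<Rightarrow> nat \<Rightarrow> bool" where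
  "nc_nilpotent g' g N X m \<longleftrightarrow>
     (\<forall>w r s. set w \<subseteq> {..<g'} \<times> {..<g} \<longrightarrow> m \<le> length w \<longrightarrow> r < N \<longrightarrow> s < N \<longrightarrow>
        wev N (entries N X) w r s = 0)"

lemma homog_term_nilpotent:
  assumes a: "\<And>w. a w \<in> carrier_mat k' k" and X: "nc_nilpotent g' g N X m" and "m \<le> n"
    and ij: "i < k' * N" "j < k * N"
  shows "homog_term g' g k' k a n N X $$ (i, j) = 0"
proof -
  obtain \<alpha> r where i: "\<alpha> < k'" "r < N" "i = \<alpha> * N + r" using ij(1) by (rule block_index_cases)
  obtain \<beta> s where j: "\<beta> < k" "s < N" "j = \<beta> * N + s" using ij(2) by (rule block_index_cases)
  show ?thesis using X \<open>m \<le> n\<close> i j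
    by (simp add: homog_term_index[OF a] words_def nc_nilpotent_def)
qed

lemma nilpotent_value:
  assumes f: "nc_series_on g' g k' k a \<epsilon> f" "nc_analytic_along_maps g' g k' k f" and "N > 0"
    and X: "X \<in> nc_int_ball g' g N" and nil: "nc_nilpotent g' g N X m"
    and ij: "i < k' * N" "j < k * N"
  shows "f N X $$ (i, j) = (\<Sum>n<m. homog_term g' g k' k a n N X $$ (i, j))"
proof -
  let ?h = "\<lambda>n. homog_term g' g k' k a n N X $$ (i, j)"
  let ?p = "\<lambda>z. \<Sum>n<m. z ^ n * ?h n"
  have a: "\<And>w. a w \<in> carrier_mat k' k" and "\<epsilon> > 0" using f(1) by (auto simp: nc_series_on_def)
  have "f N X $$ (i, j) = ?p 1"
  proof (rule nc_identity_on_disc[OF f(2) \<open>N > 0\<close> X ij _ \<open>\<epsilon> > 0\<close>])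
    show "?p holomorphic_on UNIV" by (intro holomorphic_intros)
    fix z :: complex assume z: "cmod z < \<epsilon>"
    have "(\<lambda>n. z ^ n * ?h n) sums ?p z"
      using homog_term_nilpotent[OF a nil _ ij] by (intro sums_finite) auto
    then show "f N (z \<cdot>\<^sub>m X) $$ (i, j) = ?p z"
      using nc_series_on_ray[OF f(1) \<open>N > 0\<close> X ij z] sums_unique2 by blast
  qed
  then show ?thesis by simp
qed

text \<open>The coefficients of \<open>L \<circ> f\<close>, where \<open>a\<close> are the coefficients of \<open>f\<close> and \<open>A\<close> those of \<open>L\<close>.\<close>

definition pencil_coeff ::
  "nat \<Rightarrow> nat \<Rightarrow> nat \<Rightarrow> nat \<Rightarrow> (nat \<Rightarrow> nat \<Rightarrow> complex mat) \<Rightarrow> (word \<Rightarrow> complex mat) \<Rightarrow> word \<Rightarrow> complex mat" where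
  "pencil_coeff g' g d' d A a w =
     mat d' d (\<lambda>(\<alpha>, \<beta>). \<Sum>i<g'. \<Sum>j<g. A i j $$ (\<alpha>, \<beta>) * a w $$ (i, j))"

lemma homog_term_pencil:
  assumes A: "truly_linear_pencil g' g d' d A" and a: "\<And>w. a w \<in> carrier_mat g' g"
    and "\<alpha> < d'" "\<beta> < d" "r < N" "s < N"
  shows "homog_term g' g d' d (pencil_coeff g' g d' d A a) n N X $$ (\<alpha> * N + r, \<beta> * N + s)
     = (\<Sum>i<g'. \<Sum>j<g. A i j $$ (\<alpha>, \<beta>) * homog_term g' g g' g a n N X $$ (i * N + r, j * N + s))"
proof -
  have "homog_term g' g d' d (pencil_coeff g' g d' d A a) n N X $$ (\<alpha> * N + r, \<beta> * N + s)
     = (\<Sum>w\<in>words g' g n. \<Sum>i<g'. \<Sum>j<g. A i j $$ (\<alpha>, \<beta>) * (a w $$ (i, j) * wev N (entries N X) w r s))"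
  proof -
    have c: "pencil_coeff g' g d' d A a w \<in> carrier_mat d' d" for w by (simp add: pencil_coeff_def)
    show ?thesis using assms(3-)
      unfolding homog_term_index[OF c assms(3-)]
      by (simp add: pencil_coeff_def sum_distrib_right mult.assoc)
  qed
  also have "\<dots> = (\<Sum>i<g'. \<Sum>j<g. \<Sum>w\<in>words g' g n. A i j $$ (\<alpha>, \<beta>) * (a w $$ (i, j) * wev N (entries N X) w r s))"
    by (subst sum.swap) (intro sum.cong refl sum.swap)
  finally show ?thesis using assms by (simp add: homog_term_index[OF a] sum_distrib_left)
qed

lemma nc_series_on_pencil:
  assumes A: "truly_linear_pencil g' g d' d A" and f: "nc_series_on g' g g' g a \<epsilon> f"
  shows "nc_series_on g' g d' d (pencil_coeff g' g d' d A a) \<epsilon> (\<lambda>N X. pencil_eval g' g d' d A N (f N X))"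
  unfolding nc_series_on_def
proof (intro conjI allI ballI impI)
  show "\<epsilon> > 0" using f by (simp add: nc_series_on_def)
  show "pencil_coeff g' g d' d A a w \<in> carrier_mat d' d" for w by (simp add: pencil_coeff_def)
  fix N X i j assume "0 < N" and X: "X \<in> nc_mat g' g N" "op_norm X < \<epsilon>" and ij: "i < d' * N" "j < d * N"
  obtain \<alpha> r where i: "\<alpha> < d'" "r < N" "i = \<alpha> * N + r" using ij(1) by (rule block_index_cases)
  obtain \<beta> s where j: "\<beta> < d" "s < N" "j = \<beta> * N + s" using ij(2) by (rule block_index_cases)
  have a: "\<And>w. a w \<in> carrier_mat g' g" using f by (simp add: nc_series_on_def)
  have sums: "(\<lambda>n. homog_term g' g g' g a n N X $$ (k * N + r, l * N + s)) sums (f N X $$ (k * N + r, l * N + s))"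
    if "k < g'" "l < g" for k l
    using f \<open>0 < N\<close> X that i j by (simp add: nc_series_on_def block_index_less)
  show "(\<lambda>n. homog_term g' g d' d (pencil_coeff g' g d' d A a) n N X $$ (i, j))
     sums (pencil_eval g' g d' d A N (f N X) $$ (i, j))"
    unfolding i(3) j(3) homog_term_pencil[OF A a i(1) j(1) i(2) j(2)] pencil_eval_index[OF A i(1) j(1) i(2) j(2)]
    by (intro sums_sum sums_mult sums) auto
qed

lemma nc_analytic_along_maps_pencil:
  assumes A: "truly_linear_pencil g' g d' d A" and f: "nc_analytic_along_maps g' g g' g f"
  shows "nc_analytic_along_maps g' g d' d (\<lambda>N X. pencil_eval g' g d' d A N (f N X))"
  unfolding nc_analytic_along_maps_def
proof (intro allI impI)
  fix K N :: nat and W a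
  assume "0 < K" "0 < N" and a: "cdomain K W \<and> mat_analytic_on K (g' * N) (g * N) a W \<and> a ` W \<subseteq> nc_int_ball g' g N"
  have fa: "mat_analytic_on K (g' * N) (g * N) (\<lambda>z. f N (a z)) W"
    and fc: "mat_continuous_on (g' * N) (g * N) a (closure W) \<and> a ` closure W \<subseteq> nc_int_ball g' g N \<Longrightarrow>
           mat_continuous_on (g' * N) (g * N) (\<lambda>z. f N (a z)) (closure W)"
    using f[unfolded nc_analytic_along_maps_def, rule_format, OF \<open>0 < K\<close> \<open>0 < N\<close> a] by auto
  have carr: "pencil_eval g' g d' d A N Y \<in> carrier_mat (d' * N) (d * N)" for Y
    by (simp add: pencil_eval_def)
  have 1: "mat_analytic_on K (d' * N) (d * N) (\<lambda>z. pencil_eval g' g d' d A N (f N (a z))) W"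
    unfolding mat_analytic_on_def
  proof (intro conjI ballI allI impI carr)
    fix i j assume ij: "i < d' * N" "j < d * N"
    obtain \<alpha> r where i: "\<alpha> < d'" "r < N" "i = \<alpha> * N + r" using ij(1) by (rule block_index_cases)
    obtain \<beta> s where j: "\<beta> < d" "s < N" "j = \<beta> * N + s" using ij(2) by (rule block_index_cases)
    show "cfun_analytic_on K (\<lambda>z. pencil_eval g' g d' d A N (f N (a z)) $$ (i, j)) W"
      unfolding i(3) j(3) pencil_eval_index[OF A i(1) j(1) i(2) j(2)]
      using fa i j
      by (intro cfun_analytic_on_sum cfun_analytic_on_mult_const) (simp add: mat_analytic_on_def block_index_less)
  qed
  have 2: "mat_continuous_on (d' * N) (d * N) (\<lambda>z. pencil_eval g' g d' d A N (f N (a z))) (closure W)"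
    if "mat_continuous_on (g' * N) (g * N) (\<lambda>z. f N (a z)) (closure W)"
    unfolding mat_continuous_on_def
  proof (intro conjI ballI allI impI carr)
    fix i j assume ij: "i < d' * N" "j < d * N"
    obtain \<alpha> r where i: "\<alpha> < d'" "r < N" "i = \<alpha> * N + r" using ij(1) by (rule block_index_cases)
    obtain \<beta> s where j: "\<beta> < d" "s < N" "j = \<beta> * N + s" using ij(2) by (rule block_index_cases)
    show "continuous_on (closure W) (\<lambda>z. pencil_eval g' g d' d A N (f N (a z)) $$ (i, j))"
      unfolding i(3) j(3) pencil_eval_index[OF A i(1) j(1) i(2) j(2)]
      using that i j
      by (intro continuous_intros) (simp add: mat_continuous_on_def block_index_less)
  qed
  show "mat_analytic_on K (d' * N) (d * N) (\<lambda>z. pencil_eval g' g d' d A N (f N (a z))) W \<and>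
     (mat_continuous_on (g' * N) (g * N) a (closure W) \<and> a ` closure W \<subseteq> nc_int_ball g' g N \<longrightarrow>
      mat_continuous_on (d' * N) (d * N) (\<lambda>z. pencil_eval g' g d' d A N (f N (a z))) (closure W))"
    using 1 2 fc by blast
qed

lemma pencil_eval_carrier: "pencil_eval g' g d' d A N Y \<in> carrier_mat (d' * N) (d * N)"
  by (simp add: pencil_eval_def)

lemma nc_analytic_pencil:
  assumes "truly_linear_pencil g' g d' d A" "nc_analytic g' g g' g f"
  shows "nc_analytic g' g d' d (\<lambda>N X. pencil_eval g' g d' d A N (f N X))"
  unfolding nc_analytic_def nc_power_series_iff
proof (intro conjI allI impI ballI)
  show "\<exists>a \<epsilon>. nc_series_on g' g d' d a \<epsilon> (\<lambda>N X. pencil_eval g' g d' d A N (f N X))"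
    using assms(2) nc_series_on_pencil[OF assms(1)] unfolding nc_analytic_def nc_power_series_iff by blast
  show "nc_analytic_along_maps g' g d' d (\<lambda>N X. pencil_eval g' g d' d A N (f N X))"
    using assms(2) nc_analytic_along_maps_pencil[OF assms(1)] by (simp add: nc_analytic_def)
qed (simp add: nc_mat_def pencil_eval_carrier)

section \<open>The coefficients of a pencil ball map\<close>

text \<open>The block matrix whose block \<open>(k, l)\<close> has the entries \<open>x (k, l) r s\<close>.\<close>

definition mat_of_entries ::
  "nat \<Rightarrow> nat \<Rightarrow> nat \<Rightarrow> (nat \<times> nat \<Rightarrow> nat \<Rightarrow> nat \<Rightarrow> complex) \<Rightarrow> complex mat" where
  "mat_of_entries g' g N x =
     mat (g' * N) (g * N) (\<lambda>(p, q). x (p div N, q div N) (p mod N) (q mod N))"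

lemma mat_of_entries_nc_mat: "mat_of_entries g' g N x \<in> nc_mat g' g N"
  by (simp add: mat_of_entries_def nc_mat_def)

lemma mat_of_entries_index:
  assumes "k < g'" "l < g" "r < N" "s < N"
  shows "mat_of_entries g' g N x $$ (k * N + r, l * N + s) = x (k, l) r s"
  using assms by (simp add: mat_of_entries_def block_index_less)

lemma wev_mat_of_entries:
  assumes "set w \<subseteq> {..<g'} \<times> {..<g}" "r < N" "s < N"
  shows "wev N (entries N (mat_of_entries g' g N x)) w r s = wev N x w r s"
proof -
  have "wev N (entries N (mat_of_entries g' g N x)) w r s = 1 ^ length w * wev N x w r s"
    by (rule wev_scaled[OF _ assms]) (auto simp: entries_def mat_of_entries_index)
  then show ?thesis by simp
qed

lemma op_norm_mat_of_entries_le_1_iff: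
  "op_norm (mat_of_entries g' g N x) \<le> 1 \<longleftrightarrow>
     contr ({..<g'} \<times> {..<N}) ({..<g} \<times> {..<N}) (\<lambda>(k, r) (l, s). x (k, l) r s)"
proof -
  have "op_norm (mat_of_entries g' g N x) \<le> 1 \<longleftrightarrow>
      contr ({..<g'} \<times> {..<N}) ({..<g} \<times> {..<N})
        (\<lambda>(k, r) (l, s). mat_of_entries g' g N x $$ (k * N + r, l * N + s))"
    using mat_of_entries_nc_mat[of g' g N x] unfolding nc_mat_def
    by (simp only: op_norm_le_1_iff contr_blocks_iff)
  also have "\<dots> \<longleftrightarrow> contr ({..<g'} \<times> {..<N}) ({..<g} \<times> {..<N}) (\<lambda>(k, r) (l, s). x (k, l) r s)"
    by (rule iffI; erule contr_cong) (auto simp: mat_of_entries_index)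
  finally show ?thesis .
qed

lemma contr_limit:
  assumes "finite I" "finite J" and ev: "\<forall>\<^sub>F t in F. contr I J (A t)" and "F \<noteq> bot"
    and lim: "\<And>i j. i \<in> I \<Longrightarrow> j \<in> J \<Longrightarrow> ((\<lambda>t. A t i j) \<longlongrightarrow> B i j) F"
  shows "contr I J B"
  unfolding contr_def
proof (intro allI)
  fix \<xi> :: "'b \<Rightarrow> complex"
  have "((\<lambda>t. \<Sum>i\<in>I. (cmod (\<Sum>j\<in>J. A t i j * \<xi> j))\<^sup>2) \<longlongrightarrow> (\<Sum>i\<in>I. (cmod (\<Sum>j\<in>J. B i j * \<xi> j))\<^sup>2)) F"
    by (intro tendsto_intros lim)
  then show "(\<Sum>i\<in>I. (cmod (\<Sum>j\<in>J. B i j * \<xi> j))\<^sup>2) \<le> (\<Sum>j\<in>J. (cmod (\<xi> j))\<^sup>2)"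
    by (rule tendsto_upperbound) (use ev \<open>F \<noteq> bot\<close> in \<open>auto simp: contr_def elim: eventually_mono\<close>)
qed

lemma nc_nilpotent_smult:
  assumes X: "X \<in> nc_mat g' g N" and "nc_nilpotent g' g N X m"
  shows "nc_nilpotent g' g N (z \<cdot>\<^sub>m X) m"
  using assms(2) wev_scaled[where S = "{..<g'} \<times> {..<g}", OF entries_smult[OF X]]
  unfolding nc_nilpotent_def by simp

lemma smult_nc_int_ball:
  assumes "X \<in> nc_mat g' g N" "op_norm X \<le> 1" "cmod z < 1"
  shows "z \<cdot>\<^sub>m X \<in> nc_int_ball g' g N"
proof -
  have "op_norm (z \<cdot>\<^sub>m X) \<le> cmod z * op_norm X"
    using assms(1) unfolding nc_mat_def by (rule op_norm_smult_le)
  also have "\<dots> \<le> cmod z" using assms(2) by (simp add: mult_left_le)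
  finally show ?thesis using assms by (simp add: nc_int_ball_def nc_mat_smult)
qed

text \<open>
  At a nilpotent point \<open>f(t X)\<close> is a polynomial in \<open>t\<close>, so its radial limit exists without any
  boundedness assumption on \<open>f\<close>.
\<close>

lemma nilpotent_radial_limit:
  assumes f: "nc_series_on g' g k' k a \<epsilon> f" "nc_analytic_along_maps g' g k' k f" and "N > 0"
    and X: "X \<in> nc_mat g' g N" "op_norm X \<le> 1" and nil: "nc_nilpotent g' g N X m"
    and ij: "i < k' * N" "j < k * N"
  shows "((\<lambda>t. f N (complex_of_real t \<cdot>\<^sub>m X) $$ (i, j)) \<longlongrightarrow> (\<Sum>n<m. homog_term g' g k' k a n N X $$ (i, j)))
    (at_left 1)"
proof -
  let ?h = "\<lambda>n. homog_term g' g k' k a n N X $$ (i, j)"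
  have a: "\<And>w. a w \<in> carrier_mat k' k" using f(1) by (simp add: nc_series_on_def)
  have "((\<lambda>t. \<Sum>n<m. complex_of_real t ^ n * ?h n) \<longlongrightarrow> (\<Sum>n<m. complex_of_real 1 ^ n * ?h n)) (at_left 1)"
    by (intro tendsto_intros)
  moreover have "\<forall>\<^sub>F t in at_left (1 :: real). 0 < t \<and> t < 1"
    by (rule eventually_at_leftI[of 0]) auto
  then have "\<forall>\<^sub>F t in at_left 1. (\<Sum>n<m. complex_of_real t ^ n * ?h n) = f N (complex_of_real t \<cdot>\<^sub>m X) $$ (i, j)"
  proof eventually_elim
    case (elim t)
    then have "complex_of_real t \<cdot>\<^sub>m X \<in> nc_int_ball g' g N"
      using X by (intro smult_nc_int_ball) auto
    from nilpotent_value[OF f \<open>N > 0\<close> this nc_nilpotent_smult[OF X(1) nil] ij]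
    show ?case using ij by (simp add: homog_term_smult[OF a X(1)])
  qed
  ultimately show ?thesis by (simp add: tendsto_cong)
qed

lemma contr_of_nilpotent:
  assumes f: "nc_series_on g' g k' k a \<epsilon> f" "nc_analytic_along_maps g' g k' k f"
    and car: "\<And>X. X \<in> nc_int_ball g' g N \<Longrightarrow> f N X \<in> nc_mat k' k N"
    and le: "\<And>X. X \<in> nc_int_ball g' g N \<Longrightarrow> op_norm (f N X) \<le> 1"
    and "N > 0" and X: "X \<in> nc_mat g' g N" "op_norm X \<le> 1" and nil: "nc_nilpotent g' g N X m"
  shows "contr ({..<k'} \<times> {..<N}) ({..<k} \<times> {..<N})
    (\<lambda>(\<alpha>, r) (\<beta>, s). \<Sum>n<m. \<Sum>w\<in>words g' g n. a w $$ (\<alpha>, \<beta>) * wev N (entries N X) w r s)"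
proof -
  have a: "\<And>w. a w \<in> carrier_mat k' k" using f(1) by (simp add: nc_series_on_def)
  have "contr {..<k' * N} {..<k * N} (\<lambda>i j. \<Sum>n<m. homog_term g' g k' k a n N X $$ (i, j))"
  proof (rule contr_limit)
    show "((\<lambda>t. f N (complex_of_real t \<cdot>\<^sub>m X) $$ (i, j)) \<longlongrightarrow> (\<Sum>n<m. homog_term g' g k' k a n N X $$ (i, j))) (at_left 1)"
      if "i \<in> {..<k' * N}" "j \<in> {..<k * N}" for i j
      using that by (intro nilpotent_radial_limit[OF f \<open>N > 0\<close> X nil]) auto
    have "\<forall>\<^sub>F t in at_left (1 :: real). 0 < t \<and> t < 1"
      by (rule eventually_at_leftI[of 0]) auto
    then show "\<forall>\<^sub>F t in at_left 1. contr {..<k' * N} {..<k * N} (\<lambda>i j. f N (complex_of_real t \<cdot>\<^sub>m X) $$ (i, j))"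
    proof eventually_elim
      case (elim t)
      then have "complex_of_real t \<cdot>\<^sub>m X \<in> nc_int_ball g' g N"
        using X by (intro smult_nc_int_ball) auto
      from car[OF this] le[OF this] show ?case by (simp add: nc_mat_def op_norm_le_1_iff)
    qed
  qed auto
  then have "contr ({..<k'} \<times> {..<N}) ({..<k} \<times> {..<N})
     (\<lambda>(\<alpha>, r) (\<beta>, s). \<Sum>n<m. homog_term g' g k' k a n N X $$ (\<alpha> * N + r, \<beta> * N + s))"
    unfolding contr_blocks_iff .
  then show ?thesis by (rule contr_cong) (auto simp: homog_term_index[OF a])
qed

lemma words_0: "words g' g 0 = {[]}"
  by (auto simp: words_def)

lemma sum_words_1: "(\<Sum>w\<in>words g' g (Suc 0). F w) = (\<Sum>k<g'. \<Sum>l<g. F [(k, l)])"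
proof -
  have "words g' g (Suc 0) = (\<lambda>a. [a]) ` ({..<g'} \<times> {..<g})"
    by (auto simp: words_def length_Suc_conv)
  then have "(\<Sum>w\<in>words g' g (Suc 0). F w) = (\<Sum>a\<in>{..<g'} \<times> {..<g}. F [a])"
    by (simp add: sum.reindex inj_on_def)
  then show ?thesis by (simp add: sum.cartesian_product')
qed

lemma op_norm_zero: "op_norm (0\<^sub>m m n) \<le> 0"
proof (rule op_norm_le[OF zero_carrier_mat])
  fix v :: "complex Matrix.vec" assume "v \<in> carrier_vec n"
  then have "(eucl_norm (0\<^sub>m m n *\<^sub>v v))\<^sup>2 = 0" by (subst eucl_norm_mult_mat_vec[of _ m n]) auto
  then show "eucl_norm (0\<^sub>m m n *\<^sub>v v) \<le> 0" by simp
qed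

lemma coeff_Nil_eq_0:
  assumes f: "nc_series_on g' g k' k a \<epsilon> f" and f0: "f 1 (0\<^sub>m g' g) = 0\<^sub>m k' k" and "\<alpha> < k'" "\<beta> < k"
  shows "a [] $$ (\<alpha>, \<beta>) = 0"
proof -
  have a: "\<And>w. a w \<in> carrier_mat k' k" and e: "\<epsilon> > 0" using f by (auto simp: nc_series_on_def)
  have X: "0\<^sub>m g' g \<in> nc_mat g' g 1" by (simp add: nc_mat_def)
  have small: "op_norm (0\<^sub>m g' g) < \<epsilon>" using op_norm_zero[of g' g] e by linarith
  have sums: "(\<lambda>n. homog_term g' g k' k a n 1 (0\<^sub>m g' g) $$ (\<alpha>, \<beta>)) sums (f 1 (0\<^sub>m g' g) $$ (\<alpha>, \<beta>))"
    by (rule f[unfolded nc_series_on_def, THEN conjunct2, THEN conjunct2, rule_format, OF _ X small])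
       (use assms in auto)
  have zero: "homog_term g' g k' k a n 1 (0\<^sub>m g' g) $$ (\<alpha>, \<beta>) = (if n = 0 then a [] $$ (\<alpha>, \<beta>) else 0)" for n
  proof -
    have "0 \<cdot>\<^sub>m 0\<^sub>m g' g = (0\<^sub>m g' g :: complex mat)" by auto
    then have "homog_term g' g k' k a n 1 (0\<^sub>m g' g) $$ (\<alpha>, \<beta>)
        = 0 ^ n * homog_term g' g k' k a n 1 (0\<^sub>m g' g) $$ (\<alpha>, \<beta>)"
      using homog_term_smult[OF a X, where i = \<alpha> and j = \<beta> and p = n and z = 0] assms by simp
    moreover have "homog_term g' g k' k a 0 1 (0\<^sub>m g' g) $$ (\<alpha>, \<beta>) = a [] $$ (\<alpha>, \<beta>)"
      using homog_term_index[OF a, where a = \<alpha> and b = \<beta> and r = 0 and s = 0 and N = 1 and p = 0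
          and g' = g' and g = g and X = "0\<^sub>m g' g"] assms by (simp add: words_0)
    ultimately show ?thesis by (cases n) auto
  qed
  have "(\<lambda>n. if n = 0 then a [] $$ (\<alpha>, \<beta>) else 0) sums (a [] $$ (\<alpha>, \<beta>))"
    using sums_single[of 0 "\<lambda>_. a [] $$ (\<alpha>, \<beta>)"] by simp
  with sums show ?thesis unfolding zero using sums_unique2 f0 assms by fastforce
qed

lemma contractive_series_of_coeffs:
  assumes f: "nc_series_on g' g k' k a \<epsilon> f" "nc_analytic_along_maps g' g k' k f"
    and car: "\<And>N X. N > 0 \<Longrightarrow> X \<in> nc_int_ball g' g N \<Longrightarrow> f N X \<in> nc_mat k' k N"
    and le: "\<And>N X. N > 0 \<Longrightarrow> X \<in> nc_int_ball g' g N \<Longrightarrow> op_norm (f N X) \<le> 1"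
    and f0: "f 1 (0\<^sub>m g' g) = 0\<^sub>m k' k"
  shows "contractive_series g' g k' k (\<lambda>w \<alpha> \<beta>. a w $$ (\<alpha>, \<beta>))"
proof
  fix N m :: nat and x :: "nat \<times> nat \<Rightarrow> nat \<Rightarrow> nat \<Rightarrow> complex"
  assume N: "0 < N" and con: "contr ({..<g'} \<times> {..<N}) ({..<g} \<times> {..<N}) (\<lambda>(k, r) (l, s). x (k, l) r s)"
    and nil: "\<And>w r s. set w \<subseteq> {..<g'} \<times> {..<g} \<Longrightarrow> m \<le> length w \<Longrightarrow> r < N \<Longrightarrow> s < N \<Longrightarrow> wev N x w r s = 0"
  let ?X = "mat_of_entries g' g N x"
  have "nc_nilpotent g' g N ?X m"
    using nil by (simp add: nc_nilpotent_def wev_mat_of_entries)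
  then have "contr ({..<k'} \<times> {..<N}) ({..<k} \<times> {..<N})
    (\<lambda>(\<alpha>, r) (\<beta>, s). \<Sum>n<m. \<Sum>w\<in>words g' g n. a w $$ (\<alpha>, \<beta>) * wev N (entries N ?X) w r s)"
    using N con car le
    by (intro contr_of_nilpotent[OF f] mat_of_entries_nc_mat) (simp_all add: op_norm_mat_of_entries_le_1_iff)
  then show "contr ({..<k'} \<times> {..<N}) ({..<k} \<times> {..<N})
    (\<lambda>(\<alpha>, r) (\<beta>, s). \<Sum>n<m. \<Sum>w\<in>words g' g n. a w $$ (\<alpha>, \<beta>) * wev N x w r s)"
    by (rule contr_cong) (auto simp: wev_mat_of_entries words_def intro!: sum.cong)
qed (use coeff_Nil_eq_0[OF f(1) f0] in auto)

lemma sum_lessThan_add: "(\<Sum>s<m + n. F s) = (\<Sum>s<m. F s) + (\<Sum>l<n. F (m + l))" for n :: nat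
  by (induction n) (auto simp: add.assoc)

text \<open>
  The test matrix \<open>(g' g)\<^sup>-\<^sup>1\<^sup>/\<^sup>2 \<Sum> E\<^sub>k\<^sub>l \<otimes> e\<^sub>k e\<^sub>g\<^sub>'\<^sub>+\<^sub>l\<^sup>T\<close> of block size \<open>N = g' + g\<close>, a matrix of rank one and norm one.
  The ranges of its blocks lie in the span of the first \<open>g'\<close> basis vectors, on which all blocks vanish,
  so products of two blocks are zero.
\<close>

definition entangled :: "nat \<Rightarrow> nat \<Rightarrow> nat \<times> nat \<Rightarrow> nat \<Rightarrow> nat \<Rightarrow> complex" where
  "entangled g' g = (\<lambda>(k, l) r s. if r = k \<and> s = g' + l then 1 / of_real (sqrt (g' * g)) else 0)"

lemma op_norm_entangled:
  assumes g: "0 < g'" "0 < g"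
  shows "op_norm (mat_of_entries g' g (g' + g) (entangled g' g)) = 1"
proof (rule order_antisym)
  let ?N = "g' + g" and ?q = "1 / complex_of_real (sqrt (g' * g))"
  have q: "(cmod ?q)\<^sup>2 = 1 / (g' * g)" by (simp add: norm_divide power_divide)
  have inner: "(\<Sum>l<g. \<Sum>s<?N. entangled g' g (k, l) r s * F l s) = (if r = k then ?q * (\<Sum>l<g. F l (g' + l)) else 0)"
    for k r F
  proof -
    have "(\<Sum>s<?N. entangled g' g (k, l) r s * F l s) = (if r = k then ?q * F l (g' + l) else 0)" if "l < g" for l
    proof -
      have "(\<Sum>s<?N. entangled g' g (k, l) r s * F l s)
          = (\<Sum>s<?N. if s = g' + l then (if r = k then ?q * F l s else 0) else 0)"
        by (intro sum.cong) (auto simp: entangled_def)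
      then show ?thesis using that by (simp add: sum.delta)
    qed
    then show ?thesis by (simp add: sum_distrib_left)
  qed
  have outer: "(\<Sum>k<g'. \<Sum>r<?N. (cmod (if r = k then z else 0))\<^sup>2) = g' * (cmod z)\<^sup>2" for z
  proof -
    have "(\<Sum>r<?N. (cmod (if r = k then z else 0))\<^sup>2) = (cmod z)\<^sup>2" if "k < g'" for k
      using that sum.delta[of "{..<?N}" k "\<lambda>_. (cmod z)\<^sup>2"]
      by (simp add: if_distrib[of cmod] if_distrib[of "\<lambda>z. z\<^sup>2"] cong: if_cong)
    then show ?thesis by simp
  qed
  show "op_norm (mat_of_entries g' g ?N (entangled g' g)) \<le> 1"
    unfolding op_norm_mat_of_entries_le_1_iff contr_def
  proof (intro allI)
    fix \<xi> :: "nat \<times> nat \<Rightarrow> complex"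
    have "(\<Sum>i\<in>{..<g'} \<times> {..<?N}. (cmod (\<Sum>j\<in>{..<g} \<times> {..<?N}. (case i of (k, r) \<Rightarrow> \<lambda>(l, s). entangled g' g (k, l) r s) j * \<xi> j))\<^sup>2)
       = (\<Sum>k<g'. \<Sum>r<?N. (cmod (\<Sum>l<g. \<Sum>s<?N. entangled g' g (k, l) r s * \<xi> (l, s)))\<^sup>2)"
      by (simp add: sum.cartesian_product')
    also have "\<dots> = g' * ((cmod ?q)\<^sup>2 * (cmod (\<Sum>l<g. \<xi> (l, g' + l)))\<^sup>2)"
      unfolding inner outer by (simp only: norm_mult power_mult_distrib)
    also have "\<dots> = (cmod (\<Sum>l<g. 1 * \<xi> (l, g' + l)))\<^sup>2 / g"
      unfolding q using g by simp
    also have "\<dots> \<le> ((\<Sum>l<g. (cmod 1)\<^sup>2) * (\<Sum>l<g. (cmod (\<xi> (l, g' + l)))\<^sup>2)) / g"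
      by (intro divide_right_mono Cauchy_Schwarz_complex_sum) simp
    also have "\<dots> = (\<Sum>l<g. (cmod (\<xi> (l, g' + l)))\<^sup>2)" using g by simp
    also have "\<dots> \<le> (\<Sum>l<g. \<Sum>s<?N. (cmod (\<xi> (l, s)))\<^sup>2)"
    proof (rule sum_mono)
      fix l assume "l \<in> {..<g}"
      then show "(cmod (\<xi> (l, g' + l)))\<^sup>2 \<le> (\<Sum>s<?N. (cmod (\<xi> (l, s)))\<^sup>2)"
        by (intro member_le_sum) auto
    qed
    also have "\<dots> = (\<Sum>j\<in>{..<g} \<times> {..<?N}. (cmod (\<xi> j))\<^sup>2)"
      by (simp add: sum.cartesian_product')
    finally show "(\<Sum>i\<in>{..<g'} \<times> {..<?N}. (cmod (\<Sum>j\<in>{..<g} \<times> {..<?N}. (case i of (k, r) \<Rightarrow> \<lambda>(l, s). entangled g' g (k, l) r s) j * \<xi> j))\<^sup>2)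
       \<le> (\<Sum>j\<in>{..<g} \<times> {..<?N}. (cmod (\<xi> j))\<^sup>2)" .
  qed
  show "1 \<le> op_norm (mat_of_entries g' g ?N (entangled g' g))"
  proof -
    let ?X = "mat_of_entries g' g ?N (entangled g' g)"
    define v where "v = Matrix.vec (g * ?N) (\<lambda>q. if q mod ?N = g' + q div ?N then 1 / complex_of_real (sqrt g) else 0)"
    have X: "?X \<in> carrier_mat (g' * ?N) (g * ?N)" using mat_of_entries_nc_mat by (simp add: nc_mat_def)
    have v: "v \<in> carrier_vec (g * ?N)" by (simp add: v_def)
    have vi: "vec_index v (l * ?N + s) = (if s = g' + l then 1 / complex_of_real (sqrt g) else 0)"
      if "l < g" "s < ?N" for l s
      using that block_index_less[of l g s ?N] by (simp add: v_def)
    have "(eucl_norm v)\<^sup>2 = (\<Sum>j<g * ?N. (cmod (vec_index v j))\<^sup>2)" using v unfolding eucl_norm_square by simp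
    also have "\<dots> = (\<Sum>l<g. \<Sum>s<?N. if s = g' + l then 1 / real g else 0)"
      unfolding sum_block_index by (intro sum.cong refl) (auto simp: vi norm_divide power_divide)
    also have "\<dots> = 1" using g by simp
    finally have v1: "eucl_norm v \<le> 1" using eucl_norm_nonneg[of v] by (auto simp: power2_eq_1_iff)
    have "(eucl_norm (?X *\<^sub>v v))\<^sup>2
       = (\<Sum>k<g'. \<Sum>r<?N. (cmod (\<Sum>l<g. \<Sum>s<?N. ?X $$ (k * ?N + r, l * ?N + s) * vec_index v (l * ?N + s)))\<^sup>2)"
      unfolding eucl_norm_mult_mat_vec[OF X v] sum_block_index ..
    also have "\<dots> = (\<Sum>k<g'. \<Sum>r<?N. (cmod (\<Sum>l<g. \<Sum>s<?N. entangled g' g (k, l) r s * (if s = g' + l then 1 / complex_of_real (sqrt g) else 0)))\<^sup>2)"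
      by (intro sum.cong refl arg_cong[where f = "\<lambda>z. (cmod z)\<^sup>2"]) (simp add: mat_of_entries_index vi)
    also have "\<dots> = g' * ((cmod ?q)\<^sup>2 * (cmod (of_nat g * (1 / complex_of_real (sqrt g))))\<^sup>2)"
      unfolding inner outer
      by (simp only: simp_thms if_True sum_constant card_lessThan norm_mult power_mult_distrib)
    also have "(cmod (of_nat g * (1 / complex_of_real (sqrt g))))\<^sup>2 = g"
      using g by (simp add: norm_divide power_divide power2_eq_square)
    also have "g' * ((cmod ?q)\<^sup>2 * g) = 1" unfolding q using g by simp
    finally have "eucl_norm (?X *\<^sub>v v) = 1" using eucl_norm_nonneg[of "?X *\<^sub>v v"] by (auto simp: power2_eq_1_iff)
    then show ?thesis using op_norm_ge[OF X v v1] by simp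
  qed
qed

lemma wev_entangled_zero:
  assumes "2 \<le> length w" "set w \<subseteq> {..<g'} \<times> {..<g}"
  shows "wev N (entangled g' g) w r s = 0"
proof -
  obtain a b w' where w: "w = a # b # w'" using assms(1) by (cases w; cases "tl w") auto
  have "entangled g' g a r t * (entangled g' g b t t' * z) = 0" for t t' z
    using assms(2) w by (auto simp: entangled_def split_def)
  then have "entangled g' g a r t * (\<Sum>t'<N. entangled g' g b t t' * wev N (entangled g' g) w' t' s) = 0" for t
    unfolding sum_distrib_left by simp
  then show ?thesis unfolding w by simp
qed

text \<open>
  The boundary condition is used only here, at the test matrix \<open>entangled\<close>, where
  \<open>h\<close> reduces to its linear part.
\<close>

lemma attained_of_pencil_ball_map:
  assumes A: "truly_linear_pencil g' g d' d A" and pbm: "pencil_ball_map g' g d' d A f"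
    and f: "nc_series_on g' g g' g a \<epsilon> f" and g: "0 < g'" "0 < g"
    and Nil: "\<And>\<alpha> \<beta>. \<alpha> < d' \<Longrightarrow> \<beta> < d \<Longrightarrow> pencil_coeff g' g d' d A a [] $$ (\<alpha>, \<beta>) = 0"
  obtains \<zeta> where "(\<Sum>l<g. \<Sum>b<d. (cmod (\<zeta> l b))\<^sup>2) \<le> 1"
    and "(\<Sum>k<g'. \<Sum>\<alpha><d'. (cmod (\<Sum>l<g. \<Sum>\<beta><d. pencil_coeff g' g d' d A a [(k, l)] $$ (\<alpha>, \<beta>) * \<zeta> l \<beta>))\<^sup>2) = g' * g"
proof -
  define N where "N = g' + g"
  have N: "N > 0" using g by (simp add: N_def)
  define X where "X = mat_of_entries g' g N (entangled g' g)"
  have X: "X \<in> nc_mat g' g N" "op_norm X = 1"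
    using op_norm_entangled[OF g] by (simp_all add: X_def N_def mat_of_entries_nc_mat)
  have nil: "nc_nilpotent g' g N X 2"
    by (simp add: nc_nilpotent_def X_def wev_mat_of_entries wev_entangled_zero)
  define Y where "Y = mat (g' * N) (g * N) (\<lambda>ij. \<Sum>n<2. homog_term g' g g' g a n N X $$ ij)"
  have along: "nc_analytic_along_maps g' g g' g f" using pbm by (simp add: pencil_ball_map_def nc_analytic_def)
  have "mat_tendsto (g' * N) (g * N) (\<lambda>r. f N (complex_of_real r \<cdot>\<^sub>m X)) Y (at_left 1)"
    unfolding mat_tendsto_def
    using nilpotent_radial_limit[OF f along N X(1) _ nil] X(2) by (simp add: Y_def)
  then have norm1: "op_norm (pencil_eval g' g d' d A N Y) = 1"
    using pbm N X unfolding pencil_ball_map_def by blast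
  let ?c = "pencil_coeff g' g d' d A a" and ?P = "pencil_eval g' g d' d A N Y" and ?q = "1 / complex_of_real (sqrt (g' * g))"
  have c: "?c w \<in> carrier_mat d' d" for w by (simp add: pencil_coeff_def)
  have a: "\<And>w. a w \<in> carrier_mat g' g" using f by (simp add: nc_series_on_def)
  have P: "?P $$ (\<alpha> * N + r, \<beta> * N + s) = (\<Sum>k<g'. \<Sum>l<g. ?c [(k, l)] $$ (\<alpha>, \<beta>) * entangled g' g (k, l) r s)"
    if "\<alpha> < d'" "\<beta> < d" "r < N" "s < N" for \<alpha> \<beta> r s
  proof -
    have "?P $$ (\<alpha> * N + r, \<beta> * N + s)
        = (\<Sum>i<g'. \<Sum>j<g. \<Sum>n<2. A i j $$ (\<alpha>, \<beta>) * homog_term g' g g' g a n N X $$ (i * N + r, j * N + s))"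
      using that by (simp add: pencil_eval_index[OF A] Y_def block_index_less sum_distrib_left)
    also have "\<dots> = (\<Sum>n<2. homog_term g' g d' d ?c n N X $$ (\<alpha> * N + r, \<beta> * N + s))"
      using that by (simp add: homog_term_pencil[OF A a] numeral_2_eq_2 sum.distrib)
    also have "\<dots> = (\<Sum>n<2. \<Sum>w\<in>words g' g n. ?c w $$ (\<alpha>, \<beta>) * wev N (entangled g' g) w r s)"
      using that by (auto simp: homog_term_index[OF c] X_def words_def wev_mat_of_entries intro!: sum.cong)
    also have "\<dots> = (\<Sum>k<g'. \<Sum>l<g. ?c [(k, l)] $$ (\<alpha>, \<beta>) * (\<Sum>t<N. entangled g' g (k, l) r t * (if t = s then 1 else 0)))"
      using that Nil by (simp add: numeral_2_eq_2 words_0 sum_words_1)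
    also have "\<dots> = (\<Sum>k<g'. \<Sum>l<g. ?c [(k, l)] $$ (\<alpha>, \<beta>) * entangled g' g (k, l) r s)"
      using that by (simp add: if_distrib[of "\<lambda>z. _ * z"] cong: if_cong)
    finally show ?thesis .
  qed
  have P': "?P $$ (\<alpha> * N + r, \<beta> * N + s)
       = (if r < g' then if g' \<le> s then ?q * ?c [(r, s - g')] $$ (\<alpha>, \<beta>) else 0 else 0)"
    if "\<alpha> < d'" "\<beta> < d" "r < N" "s < N" for \<alpha> \<beta> r s
  proof -
    have "(\<Sum>l<g. ?c [(k, l)] $$ (\<alpha>, \<beta>) * entangled g' g (k, l) r s)
       = (if k = r then if g' \<le> s then ?q * ?c [(r, s - g')] $$ (\<alpha>, \<beta>) else 0 else 0)" for k
    proof -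
      have "(\<Sum>l<g. ?c [(k, l)] $$ (\<alpha>, \<beta>) * entangled g' g (k, l) r s)
        = (\<Sum>l<g. if l = s - g' then if k = r \<and> g' \<le> s then ?q * ?c [(r, l)] $$ (\<alpha>, \<beta>) else 0 else 0)"
        by (intro sum.cong) (auto simp: entangled_def)
      then show ?thesis using that g by (auto simp: sum.delta N_def)
    qed
    then show ?thesis unfolding P[OF that] by (simp add: sum.delta')
  qed
  have Pcar: "?P \<in> carrier_mat (d' * N) (d * N)" by (rule pencil_eval_carrier)
  obtain \<xi> where xi: "(\<Sum>j<d * N. (cmod (\<xi> j))\<^sup>2) \<le> 1"
    "(\<Sum>i<d' * N. (cmod (\<Sum>j<d * N. ?P $$ (i, j) * \<xi> j))\<^sup>2) = 1"
    by (rule op_norm_attained[OF Pcar, unfolded norm1 power_one])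
  define \<zeta> where "\<zeta> l \<beta> = \<xi> (\<beta> * N + (g' + l))" for l \<beta>
  let ?S = "\<lambda>k \<alpha>. \<Sum>l<g. \<Sum>\<beta><d. ?c [(k, l)] $$ (\<alpha>, \<beta>) * \<zeta> l \<beta>"
  show thesis
  proof (rule that)
    have "(\<Sum>l<g. \<Sum>\<beta><d. (cmod (\<zeta> l \<beta>))\<^sup>2) \<le> (\<Sum>\<beta><d. \<Sum>s<N. (cmod (\<xi> (\<beta> * N + s)))\<^sup>2)"
      unfolding N_def sum_lessThan_add
      by (subst sum.swap) (auto simp: \<zeta>_def N_def sum.distrib intro!: sum_nonneg)
    then show "(\<Sum>l<g. \<Sum>\<beta><d. (cmod (\<zeta> l \<beta>))\<^sup>2) \<le> 1" using xi(1) by (simp add: sum_block_index)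
    have inner: "(\<Sum>j<d * N. ?P $$ (\<alpha> * N + r, j) * \<xi> j) = (if r < g' then ?q * ?S r \<alpha> else 0)"
      if "\<alpha> < d'" "r < N" for \<alpha> r
    proof -
      have "(\<Sum>j<d * N. ?P $$ (\<alpha> * N + r, j) * \<xi> j)
          = (\<Sum>\<beta><d. \<Sum>s<N. (if r < g' then if g' \<le> s then ?q * ?c [(r, s - g')] $$ (\<alpha>, \<beta>) else 0 else 0) * \<xi> (\<beta> * N + s))"
        unfolding sum_block_index using that by (intro sum.cong refl) (simp add: P')
      also have "\<dots> = (\<Sum>\<beta><d. \<Sum>l<g. (if r < g' then ?q * ?c [(r, l)] $$ (\<alpha>, \<beta>) else 0) * \<xi> (\<beta> * N + (g' + l)))"
        by (rule sum.cong[OF refl], cases "r < g'") (simp_all add: N_def sum_lessThan_add cong: sum.cong_simp)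
      also have "\<dots> = (if r < g' then ?q * ?S r \<alpha> else 0)"
        by (subst sum.swap) (simp add: \<zeta>_def sum_distrib_left mult.assoc)
      finally show ?thesis .
    qed
    have "1 = (\<Sum>\<alpha><d'. \<Sum>r<N. (cmod (if r < g' then ?q * ?S r \<alpha> else 0))\<^sup>2)"
      using xi(2) unfolding sum_block_index[where m = d'] by (simp add: inner)
    also have "\<dots> = (\<Sum>\<alpha><d'. \<Sum>r<g'. (cmod (?q * ?S r \<alpha>))\<^sup>2)"
      by (simp add: N_def sum_lessThan_add)
    also have "\<dots> = (\<Sum>r<g'. \<Sum>\<alpha><d'. (cmod (?q * ?S r \<alpha>))\<^sup>2)" by (rule sum.swap)
    also have "\<dots> = (cmod ?q)\<^sup>2 * (\<Sum>r<g'. \<Sum>\<alpha><d'. (cmod (?S r \<alpha>))\<^sup>2)"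
      by (simp only: norm_mult power_mult_distrib sum_distrib_left[symmetric])
    also have "(cmod ?q)\<^sup>2 = 1 / (g' * g)" by (simp add: norm_divide power_divide)
    finally show "(\<Sum>k<g'. \<Sum>\<alpha><d'. (cmod (?S k \<alpha>))\<^sup>2) = g' * g" using g by (simp add: field_simps)
  qed
qed

section \<open>Unitary matrices\<close>

lemma mult_mat_index:
  assumes "A \<in> carrier_mat m n" "B \<in> carrier_mat n p" "i < m" "j < p"
  shows "(A * B) $$ (i, j) = (\<Sum>k<n. A $$ (i, k) * B $$ (k, j))"
  using assms by (auto simp: scalar_prod_def lessThan_atLeast0 intro!: sum.cong)

lemma mat_adjoint_carrier: "A \<in> carrier_mat m n \<Longrightarrow> mat_adjoint A \<in> carrier_mat n m"
  by (auto simp: mat_adjoint_def intro!: carrier_matI)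

lemma mat_adjoint_index:
  fixes A :: "complex mat"
  assumes "A \<in> carrier_mat m n" "i < n" "j < m"
  shows "mat_adjoint A $$ (i, j) = cnj (A $$ (j, i))"
  using assms by (simp add: mat_adjoint_def mat_of_rows_def)

lemma triple_mult_index:
  assumes A: "A \<in> carrier_mat m n" and B: "B \<in> carrier_mat n p" and C: "C \<in> carrier_mat p q"
    and ij: "i < m" "j < q"
  shows "(A * B * C) $$ (i, j) = (\<Sum>k<n. \<Sum>l<p. A $$ (i, k) * B $$ (k, l) * C $$ (l, j))"
proof -
  have "(A * B * C) $$ (i, j) = (\<Sum>l<p. \<Sum>k<n. A $$ (i, k) * B $$ (k, l) * C $$ (l, j))"
    using mult_mat_index[OF mult_carrier_mat[OF A B] C ij] mult_mat_index[OF A B ij(1)]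
    by (simp add: sum_distrib_right)
  then show ?thesis by (subst sum.swap)
qed

text \<open>The matrix with rows \<open>cnj u\<^sub>l\<close>, padded with zero rows, is singular.\<close>

lemma exists_unit_orthogonal:
  fixes u :: "nat \<Rightarrow> nat \<Rightarrow> complex"
  assumes "g < d"
  obtains w where "(\<Sum>b<d. (cmod (w b))\<^sup>2) = 1" "\<And>l. l < g \<Longrightarrow> (\<Sum>b<d. w b * cnj (u l b)) = 0"
proof -
  define M where "M = mat d d (\<lambda>(l, b). if l < g then cnj (u l b) else 0)"
  have M: "M \<in> carrier_mat d d" by (simp add: M_def)
  have "det M = (\<Sum>j<d. M $$ (g, j) * cofactor M g j)"
    using M assms by (rule laplace_expansion_row)
  also have "\<dots> = 0" using assms by (simp add: M_def)
  finally obtain v where v: "v \<in> carrier_vec d" "v \<noteq> 0\<^sub>v d" "M *\<^sub>v v = 0\<^sub>v d"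
    using det_0_iff_vec_prod_zero_field[OF M] by auto
  define S where "S = (\<Sum>b<d. (cmod (vec_index v b))\<^sup>2)"
  have "S > 0"
  proof -
    have "\<exists>b<d. vec_index v b \<noteq> 0" using v by (auto simp: vec_eq_iff)
    then show ?thesis unfolding S_def by (auto intro!: sum_pos2)
  qed
  show thesis
  proof (rule that[of "\<lambda>b. vec_index v b / of_real (sqrt S)"])
    have "(cmod (z / of_real (sqrt S)))\<^sup>2 = (cmod z)\<^sup>2 / S" for z
      using \<open>S > 0\<close> by (simp add: norm_divide power_divide)
    then show "(\<Sum>b<d. (cmod (vec_index v b / of_real (sqrt S)))\<^sup>2) = 1"
      using \<open>S > 0\<close> by (simp add: S_def flip: sum_divide_distrib)
  next
    fix l assume "l < g"
    then have "(\<Sum>b<d. M $$ (l, b) * vec_index v b) = vec_index (M *\<^sub>v v) l"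
      using assms by (intro mult_mat_vec_index[OF M v(1), symmetric]) simp
    then have "(\<Sum>b<d. cnj (u l b) * vec_index v b) = 0"
      using \<open>l < g\<close> assms unfolding v(3) by (simp add: M_def)
    then show "(\<Sum>b<d. vec_index v b / of_real (sqrt S) * cnj (u l b)) = 0"
      by (simp add: mult.commute flip: sum_divide_distrib)
  qed
qed

lemma extend_orthonormal_to_unitary:
  fixes u :: "nat \<Rightarrow> nat \<Rightarrow> complex"
  assumes orth: "\<And>l m. l < g \<Longrightarrow> m < g \<Longrightarrow> (\<Sum>b<d. u l b * cnj (u m b)) = (if l = m then 1 else 0)"
  obtains U where "g \<le> d" "unitary_mat d U" "\<And>b l. b < d \<Longrightarrow> l < g \<Longrightarrow> U $$ (b, l) = u l b"
proof -
  have gram: "mat_adjoint M * M = 1\<^sub>m n"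
    if "M \<in> carrier_mat k n"
      "\<And>l m. l < n \<Longrightarrow> m < n \<Longrightarrow> (\<Sum>b<k. M $$ (b, l) * cnj (M $$ (b, m))) = (if l = m then 1 else 0)"
    for M :: "complex mat" and k n
  proof (rule eq_matI)
    fix i j assume "i < dim_row (1\<^sub>m n :: complex mat)" "j < dim_col (1\<^sub>m n :: complex mat)"
    then have ij: "i < n" "j < n" by auto
    have "(mat_adjoint M * M) $$ (i, j) = (\<Sum>b<k. M $$ (b, j) * cnj (M $$ (b, i)))"
      using that(1) ij mult_mat_index[OF mat_adjoint_carrier[OF that(1)] that(1) ij]
      by (simp add: mat_adjoint_index[OF that(1)] mult.commute)
    then show "(mat_adjoint M * M) $$ (i, j) = 1\<^sub>m n $$ (i, j)" using that(2) ij by auto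
  qed (use that(1) mat_adjoint_carrier[OF that(1)] in auto)
  have "g \<le> d"
  proof (rule ccontr)
    assume "\<not> g \<le> d"
    then have dg: "d < g" by simp
    define M where "M = mat g g (\<lambda>(b, l). if b < d then u l b else 0)"
    have M: "M \<in> carrier_mat g g" by (simp add: M_def)
    have "(\<Sum>b<g. M $$ (b, l) * cnj (M $$ (b, m))) = (if l = m then 1 else 0)" if "l < g" "m < g" for l m
    proof -
      have "(\<Sum>b<g. M $$ (b, l) * cnj (M $$ (b, m))) = (\<Sum>b<d. u l b * cnj (u m b))"
        using that dg by (intro sum.mono_neutral_cong_right) (auto simp: M_def)
      then show ?thesis using orth that by simp
    qed
    then have "M * mat_adjoint M = 1\<^sub>m g"
      using gram[OF M] mat_mult_left_right_inverse[OF mat_adjoint_carrier[OF M] M] by blast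
    then have "(M * mat_adjoint M) $$ (d, d) = 1" using dg by simp
    moreover have "(M * mat_adjoint M) $$ (d, d) = 0"
      unfolding mult_mat_index[OF M mat_adjoint_carrier[OF M] dg dg] using dg by (simp add: M_def)
    ultimately show False by simp
  qed
  have "\<exists>u'. (\<forall>l<g + n. \<forall>m<g + n. (\<Sum>b<d. u' l b * cnj (u' m b)) = (if l = m then 1 else 0)) \<and> (\<forall>l<g. u' l = u l)"
    if "g + n \<le> d" for n
    using that
  proof (induction n)
    case 0
    then show ?case using orth by (intro exI[of _ u]) auto
  next
    case (Suc n)
    then obtain u' where u': "\<And>l m. l < g + n \<Longrightarrow> m < g + n \<Longrightarrow> (\<Sum>b<d. u' l b * cnj (u' m b)) = (if l = m then 1 else 0)"
      "\<And>l. l < g \<Longrightarrow> u' l = u l" by auto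
    have "g + n < d" using Suc by simp
    then obtain w where w: "(\<Sum>b<d. (cmod (w b))\<^sup>2) = 1" "\<And>l. l < g + n \<Longrightarrow> (\<Sum>b<d. w b * cnj (u' l b)) = 0"
      using exists_unit_orthogonal[of "g + n" d u'] by blast
    have w': "(\<Sum>b<d. u' l b * cnj (w b)) = 0" if "l < g + n" for l
    proof -
      have "(\<Sum>b<d. u' l b * cnj (w b)) = cnj (\<Sum>b<d. w b * cnj (u' l b))" by (simp add: mult.commute)
      then show ?thesis using w(2)[OF that] by simp
    qed
    have "(\<Sum>b<d. w b * cnj (w b)) = complex_of_real (\<Sum>b<d. (cmod (w b))\<^sup>2)"
      by (simp only: of_real_sum complex_norm_square)
    then have ww: "(\<Sum>b<d. w b * cnj (w b)) = 1" using w(1) by simp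
    show ?case
      by (rule exI[of _ "\<lambda>l. if l = g + n then w else u' l"]) (auto simp: u' w w' ww less_Suc_eq)
  qed
  from this[of "d - g"] \<open>g \<le> d\<close> obtain u' where
    u': "\<And>l m. l < d \<Longrightarrow> m < d \<Longrightarrow> (\<Sum>b<d. u' l b * cnj (u' m b)) = (if l = m then 1 else 0)"
      "\<And>l. l < g \<Longrightarrow> u' l = u l" by auto
  define U where "U = mat d d (\<lambda>(b, l). u' l b)"
  have U: "U \<in> carrier_mat d d" by (simp add: U_def)
  have "mat_adjoint U * U = 1\<^sub>m d" by (rule gram[OF U]) (simp add: U_def u')
  moreover from this have "U * mat_adjoint U = 1\<^sub>m d"
    using mat_mult_left_right_inverse[OF mat_adjoint_carrier[OF U] U] by blast
  ultimately have "unitary_mat d U" using U by (simp add: unitary_mat_def)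
  then show thesis using \<open>g \<le> d\<close> u'(2) by (intro that[of U]) (auto simp: U_def)
qed

lemma contr_unitary:
  assumes U: "unitary_mat n U"
  shows "contr {..<n} {..<n} (\<lambda>i j. U $$ (i, j))"
  unfolding contr_def
proof (intro allI)
  fix \<xi> :: "nat \<Rightarrow> complex"
  have Uc: "U \<in> carrier_mat n n" and UU: "mat_adjoint U * U = 1\<^sub>m n" using U by (auto simp: unitary_mat_def)
  have gram: "(\<Sum>i<n. U $$ (i, j) * cnj (U $$ (i, k))) = (if k = j then 1 else 0)" if "j < n" "k < n" for j k
  proof -
    have "(\<Sum>i<n. U $$ (i, j) * cnj (U $$ (i, k))) = (mat_adjoint U * U) $$ (k, j)"
      using mult_mat_index[OF mat_adjoint_carrier[OF Uc] Uc that(2,1)] that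
      by (simp add: mat_adjoint_index[OF Uc] mult.commute)
    then show ?thesis using that by (simp add: UU)
  qed
  have "complex_of_real (\<Sum>i<n. (cmod (\<Sum>j<n. U $$ (i, j) * \<xi> j))\<^sup>2)
      = (\<Sum>i<n. (\<Sum>j<n. U $$ (i, j) * \<xi> j) * cnj (\<Sum>k<n. U $$ (i, k) * \<xi> k))"
    by (simp only: of_real_sum complex_norm_square)
  also have "\<dots> = (\<Sum>i<n. \<Sum>j<n. \<Sum>k<n. \<xi> j * cnj (\<xi> k) * (U $$ (i, j) * cnj (U $$ (i, k))))"
    by (simp add: sum_product mult_ac)
  also have "\<dots> = (\<Sum>j<n. \<Sum>k<n. \<Sum>i<n. \<xi> j * cnj (\<xi> k) * (U $$ (i, j) * cnj (U $$ (i, k))))"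
    by (subst sum.swap) (intro sum.cong refl sum.swap)
  also have "\<dots> = (\<Sum>j<n. \<Sum>k<n. \<xi> j * cnj (\<xi> k) * (if k = j then 1 else 0))"
    by (intro sum.cong refl) (simp only: sum_distrib_left[symmetric] gram lessThan_iff)
  also have "\<dots> = (\<Sum>j<n. \<xi> j * cnj (\<xi> j))"
    by (simp add: if_distrib[of "\<lambda>z. _ * z"] sum.delta cong: if_cong)
  also have "\<dots> = complex_of_real (\<Sum>j<n. (cmod (\<xi> j))\<^sup>2)"
    by (simp only: of_real_sum complex_norm_square)
  finally show "(\<Sum>i<n. (cmod (\<Sum>j<n. U $$ (i, j) * \<xi> j))\<^sup>2) \<le> (\<Sum>j<n. (cmod (\<xi> j))\<^sup>2)"
    by (simp only: of_real_eq_iff)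
qed

lemma contr_mult:
  assumes "contr I J A" "contr J K B"
  shows "contr I K (\<lambda>i k. \<Sum>j\<in>J. A i j * B j k)"
  unfolding contr_def
proof (intro allI)
  fix \<xi> :: "'c \<Rightarrow> complex"
  have "(\<Sum>k\<in>K. (\<Sum>j\<in>J. A i j * B j k) * \<xi> k) = (\<Sum>j\<in>J. A i j * (\<Sum>k\<in>K. B j k * \<xi> k))" for i
    by (simp add: sum_distrib_left sum_distrib_right mult.assoc) (rule sum.swap)
  then have "(\<Sum>i\<in>I. (cmod (\<Sum>k\<in>K. (\<Sum>j\<in>J. A i j * B j k) * \<xi> k))\<^sup>2)
      \<le> (\<Sum>j\<in>J. (cmod (\<Sum>k\<in>K. B j k * \<xi> k))\<^sup>2)"
    using assms(1) by (simp add: contr_def)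
  also have "\<dots> \<le> (\<Sum>k\<in>K. (cmod (\<xi> k))\<^sup>2)" using assms(2) by (simp add: contr_def)
  finally show "(\<Sum>i\<in>I. (cmod (\<Sum>k\<in>K. (\<Sum>j\<in>J. A i j * B j k) * \<xi> k))\<^sup>2) \<le> (\<Sum>k\<in>K. (cmod (\<xi> k))\<^sup>2)" .
qed

text \<open>Contractivity of \<open>A \<otimes> I\<close>.\<close>

lemma contr_ampliation:
  assumes "contr I J A" "finite R"
  shows "contr (I \<times> R) (J \<times> R) (\<lambda>(i, r) (j, s). if s = r then A i j else 0)"
  unfolding contr_def
proof (intro allI)
  fix \<xi> :: "'b \<times> 'c \<Rightarrow> complex"
  have inner: "(\<Sum>q\<in>J \<times> R. (case q of (j, s) \<Rightarrow> if s = r then A i j else 0) * \<xi> q) = (\<Sum>j\<in>J. A i j * \<xi> (j, r))"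
    if "r \<in> R" for i r
    unfolding sum.cartesian_product' using that assms(2)
    by (simp add: if_distrib[of "\<lambda>z. z * _"] sum.delta cong: if_cong)
  have "(\<Sum>p\<in>I \<times> R. (cmod (\<Sum>q\<in>J \<times> R. (case p of (i, r) \<Rightarrow> \<lambda>(j, s). if s = r then A i j else 0) q * \<xi> q))\<^sup>2)
     = (\<Sum>i\<in>I. \<Sum>r\<in>R. (cmod (\<Sum>j\<in>J. A i j * \<xi> (j, r)))\<^sup>2)"
    unfolding sum.cartesian_product'[of _ I] by (intro sum.cong refl) (simp add: inner)
  also have "\<dots> = (\<Sum>r\<in>R. \<Sum>i\<in>I. (cmod (\<Sum>j\<in>J. A i j * \<xi> (j, r)))\<^sup>2)" by (rule sum.swap)
  also have "\<dots> \<le> (\<Sum>r\<in>R. \<Sum>j\<in>J. (cmod (\<xi> (j, r)))\<^sup>2)"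
    by (rule sum_mono) (rule assms(1)[unfolded contr_def, rule_format])
  also have "\<dots> = (\<Sum>q\<in>J \<times> R. (cmod (\<xi> q))\<^sup>2)"
    unfolding sum.cartesian_product' by (rule sum.swap)
  finally show "(\<Sum>p\<in>I \<times> R. (cmod (\<Sum>q\<in>J \<times> R. (case p of (i, r) \<Rightarrow> \<lambda>(j, s). if s = r then A i j else 0) q * \<xi> q))\<^sup>2)
     \<le> (\<Sum>q\<in>J \<times> R. (cmod (\<xi> q))\<^sup>2)" .
qed

lemma contr_subset:
  assumes "contr I J A" "I' \<subseteq> I" "J' \<subseteq> J" "finite I" "finite J"
  shows "contr I' J' A"
  unfolding contr_def
proof (intro allI)
  fix \<xi> :: "'b \<Rightarrow> complex"
  let ?\<eta> = "\<lambda>j. if j \<in> J' then \<xi> j else 0"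
  have "(\<Sum>j\<in>J'. A i j * \<xi> j) = (\<Sum>j\<in>J. A i j * ?\<eta> j)" for i
    using assms by (intro sum.mono_neutral_cong_left) auto
  then have "(\<Sum>i\<in>I'. (cmod (\<Sum>j\<in>J'. A i j * \<xi> j))\<^sup>2) \<le> (\<Sum>i\<in>I. (cmod (\<Sum>j\<in>J. A i j * ?\<eta> j))\<^sup>2)"
    using assms by (simp only:) (intro sum_mono2; simp)
  also have "\<dots> \<le> (\<Sum>j\<in>J. (cmod (?\<eta> j))\<^sup>2)"
    by (rule assms(1)[unfolded contr_def, rule_format])
  also have "\<dots> = (\<Sum>j\<in>J'. (cmod (\<xi> j))\<^sup>2)"
    using assms by (intro sum.mono_neutral_cong_right) auto
  finally show "(\<Sum>i\<in>I'. (cmod (\<Sum>j\<in>J'. A i j * \<xi> j))\<^sup>2) \<le> (\<Sum>j\<in>J'. (cmod (\<xi> j))\<^sup>2)" .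
qed

lemma contr_corner:
  fixes m' n' k' k N :: nat
  assumes "contr ({..<m'} \<times> {..<N}) ({..<n'} \<times> {..<N}) A" and "k' \<le> m'" "k \<le> n'"
  shows "contr ({..<m' - k'} \<times> {..<N}) ({..<n' - k} \<times> {..<N}) (\<lambda>(a, r) (b, s). A (k' + a, r) (k + b, s))"
    (is "contr ?I ?J _")
proof -
  let ?\<phi> = "\<lambda>(a, r). (k' + a, r :: nat)" and ?\<psi> = "\<lambda>(b, s). (k + b, s :: nat)"
  have "contr (?\<phi> ` ?I) (?\<psi> ` ?J) A"
    by (rule contr_subset[OF assms(1)]) auto
  then have "contr ?I ?J (\<lambda>i j. A (?\<phi> i) (?\<psi> j))"
    by (rule contr_reindex_imp) (auto simp: bij_betw_def inj_on_def)
  then show ?thesis by (rule contr_cong) auto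
qed

section \<open>Unitary change of coordinates in a pencil\<close>

lemma kron_carrier: "A \<in> carrier_mat m n \<Longrightarrow> B \<in> carrier_mat p q \<Longrightarrow> kron A B \<in> carrier_mat (m * p) (n * q)"
  by (auto simp: kron_def)

lemma kron_one_mult_index:
  assumes P: "P \<in> carrier_mat m n" and Y: "Y \<in> carrier_mat (n * N) q" and "a < m" "r < N" "j < q"
  shows "(kron P (1\<^sub>m N) * Y) $$ (a * N + r, j) = (\<Sum>k<n. P $$ (a, k) * Y $$ (k * N + r, j))"
proof -
  have "(kron P (1\<^sub>m N) * Y) $$ (a * N + r, j)
      = (\<Sum>k<n. \<Sum>t<N. kron P (1\<^sub>m N) $$ (a * N + r, k * N + t) * Y $$ (k * N + t, j))"
    using mult_mat_index[OF kron_carrier[OF P one_carrier_mat] Y _ \<open>j < q\<close>] assms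
    by (simp add: block_index_less sum_block_index)
  also have "\<dots> = (\<Sum>k<n. \<Sum>t<N. if t = r then P $$ (a, k) * Y $$ (k * N + t, j) else 0)"
    using assms kron_index[OF P one_carrier_mat] by (intro sum.cong refl) auto
  finally show ?thesis using assms by (simp add: sum.delta)
qed

lemma mult_adjoint_kron_one_index:
  assumes Q: "Q \<in> carrier_mat m n" and Y: "Y \<in> carrier_mat p (n * N)" and "i < p" "b < m" "s < N"
  shows "(Y * mat_adjoint (kron Q (1\<^sub>m N))) $$ (i, b * N + s) = (\<Sum>l<n. Y $$ (i, l * N + s) * cnj (Q $$ (b, l)))"
proof -
  have K: "kron Q (1\<^sub>m N) \<in> carrier_mat (m * N) (n * N)" by (rule kron_carrier[OF Q one_carrier_mat])
  have "(Y * mat_adjoint (kron Q (1\<^sub>m N))) $$ (i, b * N + s)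
      = (\<Sum>l<n. \<Sum>t<N. Y $$ (i, l * N + t) * cnj (kron Q (1\<^sub>m N) $$ (b * N + s, l * N + t)))"
    using mult_mat_index[OF Y mat_adjoint_carrier[OF K] \<open>i < p\<close>] assms
    by (simp add: block_index_less sum_block_index mat_adjoint_index[OF K])
  also have "\<dots> = (\<Sum>l<n. \<Sum>t<N. if t = s then Y $$ (i, l * N + t) * cnj (Q $$ (b, l)) else 0)"
    using assms kron_index[OF Q one_carrier_mat] by (intro sum.cong refl) auto
  finally show ?thesis using assms by (simp add: sum.delta)
qed

lemma pencil_eval_conjugate:
  assumes B: "truly_linear_pencil g' g d' d B" and A: "truly_linear_pencil g' g m n A"
    and P: "P \<in> carrier_mat d' m" and Q: "Q \<in> carrier_mat n d"
    and BA: "\<And>i j. i < g' \<Longrightarrow> j < g \<Longrightarrow> B i j = P * A i j * Q"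
    and ab: "a < d'" "b < d" "r < N" "s < N"
  shows "pencil_eval g' g d' d B N Y $$ (a * N + r, b * N + s)
     = (\<Sum>k<m. \<Sum>l<n. P $$ (a, k) * pencil_eval g' g m n A N Y $$ (k * N + r, l * N + s) * Q $$ (l, b))"
proof -
  have Ac: "A i j \<in> carrier_mat m n" if "i < g'" "j < g" for i j
    using A that by (simp add: truly_linear_pencil_def)
  have "pencil_eval g' g d' d B N Y $$ (a * N + r, b * N + s)
     = (\<Sum>i<g'. \<Sum>j<g. \<Sum>k<m. \<Sum>l<n. P $$ (a, k) * (A i j $$ (k, l) * Y $$ (i * N + r, j * N + s)) * Q $$ (l, b))"
    unfolding pencil_eval_index[OF B ab]
    by (intro sum.cong refl) (simp add: BA triple_mult_index[OF P Ac Q ab(1,2)] sum_distrib_left sum_distrib_right mult_ac)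
  also have "\<dots> = (\<Sum>k<m. \<Sum>l<n. \<Sum>i<g'. \<Sum>j<g. P $$ (a, k) * (A i j $$ (k, l) * Y $$ (i * N + r, j * N + s)) * Q $$ (l, b))"
  proof -
    have "(\<Sum>j<g. \<Sum>k<m. \<Sum>l<n. F j k l) = (\<Sum>k<m. \<Sum>l<n. \<Sum>j<g. F j k l)" for F :: "nat \<Rightarrow> nat \<Rightarrow> nat \<Rightarrow> complex"
      by (subst sum.swap) (intro sum.cong refl sum.swap)
    moreover have "(\<Sum>i<g'. \<Sum>k<m. \<Sum>l<n. F i k l) = (\<Sum>k<m. \<Sum>l<n. \<Sum>i<g'. F i k l)" for F :: "nat \<Rightarrow> nat \<Rightarrow> nat \<Rightarrow> complex"
      by (subst sum.swap) (intro sum.cong refl sum.swap)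
    ultimately show ?thesis by simp
  qed
  also have "\<dots> = (\<Sum>k<m. \<Sum>l<n. P $$ (a, k) * pencil_eval g' g m n A N Y $$ (k * N + r, l * N + s) * Q $$ (l, b))"
    using ab by (intro sum.cong refl) (simp add: pencil_eval_index[OF A] sum_distrib_left sum_distrib_right)
  finally show ?thesis .
qed

text \<open>Here \<open>B\<close> is evaluated as \<open>(V \<otimes> I)\<^sup>* L(Y) (U \<otimes> I)\<close>, a product of three contractions.\<close>

lemma contr_pencil_conjugate:
  assumes B: "truly_linear_pencil g' g d' d B" and A: "truly_linear_pencil g' g d' d A"
    and V: "unitary_mat d' V" and U: "unitary_mat d U"
    and BA: "\<And>i j. i < g' \<Longrightarrow> j < g \<Longrightarrow> B i j = mat_adjoint V * A i j * U"
    and le: "op_norm (pencil_eval g' g d' d A N Y) \<le> 1"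
  shows "contr ({..<d'} \<times> {..<N}) ({..<d} \<times> {..<N})
     (\<lambda>(a, r) (b, s). pencil_eval g' g d' d B N Y $$ (a * N + r, b * N + s))"
proof -
  let ?I = "{..<d'} \<times> {..<N}" and ?J = "{..<d} \<times> {..<N}" and ?H = "pencil_eval g' g d' d A N Y"
  have Vc: "V \<in> carrier_mat d' d'" and Uc: "U \<in> carrier_mat d d" using V U by (auto simp: unitary_mat_def)
  have H: "contr ?I ?J (\<lambda>(a, r) (b, s). ?H $$ (a * N + r, b * N + s))"
    using le unfolding op_norm_le_1_iff[OF pencil_eval_carrier] contr_blocks_iff .
  have V': "contr ?I ?I (\<lambda>(a, r) (a', r'). if r' = r then cnj (V $$ (a', a)) else 0)"
    by (intro contr_ampliation contr_adjoint contr_unitary[OF V]) simp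
  have U': "contr ?J ?J (\<lambda>(b, s) (b', s'). if s' = s then U $$ (b, b') else 0)"
    by (intro contr_ampliation contr_unitary[OF U]) simp
  have eq: "(\<Sum>q\<in>?J. (\<Sum>p\<in>?I. (if snd p = r then cnj (V $$ (fst p, a)) else 0) * ?H $$ (fst p * N + snd p, fst q * N + snd q))
        * (if s = snd q then U $$ (fst q, b) else 0))
      = pencil_eval g' g d' d B N Y $$ (a * N + r, b * N + s)"
    if "a < d'" "b < d" "r < N" "s < N" for a b r s
  proof -
    have inner: "(\<Sum>p\<in>?I. (if snd p = r then cnj (V $$ (fst p, a)) else 0) * ?H $$ (fst p * N + snd p, j)) = (\<Sum>k<d'. cnj (V $$ (k, a)) * ?H $$ (k * N + r, j))"
      for j
      unfolding sum.cartesian_product' using that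
      by (simp add: if_distrib[of "\<lambda>z. z * _"] sum.delta cong: if_cong)
    have "(\<Sum>q\<in>?J. (\<Sum>p\<in>?I. (if snd p = r then cnj (V $$ (fst p, a)) else 0) * ?H $$ (fst p * N + snd p, fst q * N + snd q))
        * (if s = snd q then U $$ (fst q, b) else 0))
       = (\<Sum>l<d. \<Sum>t<N. if s = t then (\<Sum>k<d'. cnj (V $$ (k, a)) * ?H $$ (k * N + r, l * N + t)) * U $$ (l, b) else 0)"
      by (simp only: inner) (simp add: sum.cartesian_product' if_distrib[of "\<lambda>z. _ * z"] cong: if_cong)
    also have "\<dots> = (\<Sum>k<d'. \<Sum>l<d. mat_adjoint V $$ (a, k) * ?H $$ (k * N + r, l * N + s) * U $$ (l, b))"
      using that by (subst (2) sum.swap) (simp add: sum.delta sum_distrib_right mat_adjoint_index[OF Vc])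
    also have "\<dots> = pencil_eval g' g d' d B N Y $$ (a * N + r, b * N + s)"
      using pencil_eval_conjugate[OF B A mat_adjoint_carrier[OF Vc] Uc BA that] by simp
    finally show ?thesis .
  qed
  show ?thesis
    using contr_mult[OF contr_mult[OF V' H] U']
    by (rule contr_cong) (auto simp: split_def eq)
qed

section \<open>The block form\<close>

lemma unitary_columns:
  assumes "unitary_mat n U" "i < n" "j < n"
  shows "(\<Sum>k<n. cnj (U $$ (k, i)) * U $$ (k, j)) = (if i = j then 1 else 0)"
proof -
  have U: "U \<in> carrier_mat n n" and UU: "mat_adjoint U * U = 1\<^sub>m n"
    using assms by (auto simp: unitary_mat_def)
  have "(mat_adjoint U * U) $$ (i, j) = (\<Sum>k<n. cnj (U $$ (k, i)) * U $$ (k, j))"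
    using mult_mat_index[OF mat_adjoint_carrier[OF U] U assms(2,3)] assms
    by (simp add: mat_adjoint_index[OF U])
  then show ?thesis using assms by (simp add: UU)
qed

text \<open>A single coefficient of \<open>f\<close> is a block matrix of block size 1.\<close>

lemma pencil_coeff_eq_pencil_eval:
  assumes "truly_linear_pencil g' g d' d A" "\<alpha> < d'" "\<beta> < d"
  shows "pencil_coeff g' g d' d A a w $$ (\<alpha>, \<beta>) = pencil_eval g' g d' d A 1 (a w) $$ (\<alpha>, \<beta>)"
  using pencil_eval_index[OF assms, of 0 1 0 "a w"] assms by (simp add: pencil_coeff_def)

lemma pencil_eval_unconjugate:
  assumes A: "truly_linear_pencil g' g d' d A" and B: "truly_linear_pencil g' g d' d B"
    and V: "unitary_mat d' V" and U: "unitary_mat d U"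
    and BA: "\<And>i j. i < g' \<Longrightarrow> j < g \<Longrightarrow> B i j = mat_adjoint V * A i j * U"
  shows "pencil_eval g' g d' d A N Y
     = kron V (1\<^sub>m N) * pencil_eval g' g d' d B N Y * mat_adjoint (kron U (1\<^sub>m N))"
proof (rule eq_matI)
  let ?G = "pencil_eval g' g d' d B N Y"
  have Vc: "V \<in> carrier_mat d' d'" "mat_adjoint V \<in> carrier_mat d' d'" "V * mat_adjoint V = 1\<^sub>m d'"
    and Uc: "U \<in> carrier_mat d d" "mat_adjoint U \<in> carrier_mat d d" "U * mat_adjoint U = 1\<^sub>m d"
    using V U mat_adjoint_carrier[of V d' d'] mat_adjoint_carrier[of U d d] by (auto simp: unitary_mat_def)
  have AB: "A i j = V * B i j * mat_adjoint U" if "i < g'" "j < g" for i j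
  proof -
    have Ac: "A i j \<in> carrier_mat d' d" using A that by (simp add: truly_linear_pencil_def)
    have 1: "mat_adjoint V * A i j \<in> carrier_mat d' d" by (rule mult_carrier_mat[OF Vc(2) Ac])
    have "V * B i j * mat_adjoint U = V * (mat_adjoint V * A i j) * U * mat_adjoint U"
      using assoc_mult_mat[OF Vc(1) 1 Uc(1)] BA[OF that] by simp
    also have "V * (mat_adjoint V * A i j) = A i j"
      using assoc_mult_mat[OF Vc(1,2) Ac] Vc(3) Ac by simp
    also have "A i j * U * mat_adjoint U = A i j"
      using assoc_mult_mat[OF Ac Uc(1,2)] Uc(3) Ac by simp
    finally show ?thesis by simp
  qed
  have KV: "kron V (1\<^sub>m N) \<in> carrier_mat (d' * N) (d' * N)" by (rule kron_carrier[OF Vc(1) one_carrier_mat])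
  have KU: "mat_adjoint (kron U (1\<^sub>m N)) \<in> carrier_mat (d * N) (d * N)"
    by (rule mat_adjoint_carrier[OF kron_carrier[OF Uc(1) one_carrier_mat]])
  have G: "?G \<in> carrier_mat (d' * N) (d * N)" by (rule pencil_eval_carrier)
  have KG: "kron V (1\<^sub>m N) * ?G \<in> carrier_mat (d' * N) (d * N)" by (rule mult_carrier_mat[OF KV G])
  have R: "kron V (1\<^sub>m N) * ?G * mat_adjoint (kron U (1\<^sub>m N)) \<in> carrier_mat (d' * N) (d * N)"
    by (rule mult_carrier_mat[OF KG KU])
  show "dim_row (pencil_eval g' g d' d A N Y) = dim_row (kron V (1\<^sub>m N) * ?G * mat_adjoint (kron U (1\<^sub>m N)))"
    "dim_col (pencil_eval g' g d' d A N Y) = dim_col (kron V (1\<^sub>m N) * ?G * mat_adjoint (kron U (1\<^sub>m N)))"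
    using R pencil_eval_carrier[of g' g d' d A N Y] by (metis carrier_matD)+
  fix i j
  assume "i < dim_row (kron V (1\<^sub>m N) * ?G * mat_adjoint (kron U (1\<^sub>m N)))"
    "j < dim_col (kron V (1\<^sub>m N) * ?G * mat_adjoint (kron U (1\<^sub>m N)))"
  then have ij: "i < d' * N" "j < d * N" using R by (metis carrier_matD)+
  obtain a r where i: "a < d'" "r < N" "i = a * N + r" using ij(1) by (rule block_index_cases)
  obtain b s where j: "b < d" "s < N" "j = b * N + s" using ij(2) by (rule block_index_cases)
  have "(kron V (1\<^sub>m N) * ?G * mat_adjoint (kron U (1\<^sub>m N))) $$ (i, j)
     = (\<Sum>l<d. (\<Sum>k<d'. V $$ (a, k) * ?G $$ (k * N + r, l * N + s)) * cnj (U $$ (b, l)))"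
    unfolding i(3) j(3) mult_adjoint_kron_one_index[OF Uc(1) KG block_index_less[OF i(1,2)] j(1,2)]
    by (intro sum.cong refl) (use j in \<open>simp add: kron_one_mult_index[OF Vc(1) G i(1,2)] block_index_less\<close>)
  also have "\<dots> = (\<Sum>k<d'. \<Sum>l<d. V $$ (a, k) * ?G $$ (k * N + r, l * N + s) * mat_adjoint U $$ (l, b))"
    using j by (subst sum.swap) (simp add: sum_distrib_right mat_adjoint_index[OF Uc(1)])
  also have "\<dots> = pencil_eval g' g d' d A N Y $$ (i, j)"
    unfolding i(3) j(3) by (rule pencil_eval_conjugate[OF A B Vc(1) Uc(2) AB i(1) j(1) i(2) j(2), symmetric])
  finally show "pencil_eval g' g d' d A N Y $$ (i, j)
     = (kron V (1\<^sub>m N) * ?G * mat_adjoint (kron U (1\<^sub>m N))) $$ (i, j)" by simp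
qed

lemma four_block_mat_of_corner:
  assumes G: "G \<in> carrier_mat (d' * N) (d * N)" and X: "X \<in> carrier_mat (g' * N) (g * N)"
    and Z: "Z \<in> carrier_mat ((d' - g') * N) ((d - g) * N)" and le: "g' \<le> d'" "g \<le> d"
    and corner: "\<And>a b r s. a < d' \<Longrightarrow> b < d \<Longrightarrow> r < N \<Longrightarrow> s < N \<Longrightarrow> a < g' \<or> b < g \<Longrightarrow>
          G $$ (a * N + r, b * N + s) = (if a < g' \<and> b < g then X $$ (a * N + r, b * N + s) else 0)"
    and rest: "\<And>a b r s. a < d' - g' \<Longrightarrow> b < d - g \<Longrightarrow> r < N \<Longrightarrow> s < N \<Longrightarrow>
          G $$ ((g' + a) * N + r, (g + b) * N + s) = Z $$ (a * N + r, b * N + s)"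
  shows "G = four_block_mat X (0\<^sub>m (g' * N) ((d - g) * N)) (0\<^sub>m ((d' - g') * N) (g * N)) Z"
    (is "G = ?F")
proof (rule eq_matI)
  have dims: "g' * N + (d' - g') * N = d' * N" "g * N + (d - g) * N = d * N"
    using le by (simp_all flip: add_mult_distrib)
  show row: "dim_row G = dim_row ?F" and col: "dim_col G = dim_col ?F" using G X Z dims by auto
  fix i j assume "i < dim_row ?F" "j < dim_col ?F"
  then have ij: "i < d' * N" "j < d * N" using row col G by auto
  obtain a r where i: "a < d'" "r < N" "i = a * N + r" using ij(1) by (rule block_index_cases)
  obtain b s where j: "b < d" "s < N" "j = b * N + s" using ij(2) by (rule block_index_cases)
  have lt: "k * N + t < m * N \<longleftrightarrow> k < m" if "t < N" for k t m
  proof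
    assume "k * N + t < m * N"
    then have "k * N < m * N" by linarith
    then show "k < m" by simp
  qed (rule block_index_less[OF _ that])
  have F: "?F $$ (i, j) = (if i < g' * N then if j < g * N then X $$ (i, j) else 0\<^sub>m (g' * N) ((d - g) * N) $$ (i, j - g * N)
      else if j < g * N then 0\<^sub>m ((d' - g') * N) (g * N) $$ (i - g' * N, j) else Z $$ (i - g' * N, j - g * N))"
    using X Z ij dims by (subst index_mat_four_block) auto
  have sub: "k * N + t - m * N = (k - m) * N + t" if "m \<le> k" for k t m
    using that mult_le_mono1[OF that, of N] by (simp add: diff_mult_distrib)
  show "G $$ (i, j) = ?F $$ (i, j)"
  proof (cases "a < g' \<or> b < g")
    case True
    then show ?thesis
      unfolding F using corner[OF i(1) j(1) i(2) j(2) True] i j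
      by (auto simp: lt sub block_index_less diff_less_mono)
  next
    case False
    then have "G $$ (i, j) = Z $$ ((a - g') * N + r, (b - g) * N + s)"
      using rest[of "a - g'" "b - g" r s] i j by auto
    then show ?thesis unfolding F using False i j by (simp add: lt sub)
  qed
qed

theorem theorem1p9:
  fixes g' g d' d :: nat
    and A :: "nat \<Rightarrow> nat \<Rightarrow> complex mat"
    and f h :: "nat \<Rightarrow> complex mat \<Rightarrow> complex mat"
  assumes "g' > 0" and "g > 0" and "d' > 0" and "d > 0"
    and "truly_linear_pencil g' g d' d A"
    and "pencil_ball_map g' g d' d A f"
    and "\<forall>N>0. f N (0\<^sub>m (g' * N) (g * N)) = 0\<^sub>m (g' * N) (g * N)"
    and h_def: "h = (\<lambda>N X. pencil_eval g' g d' d A N (f N X))"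
  shows "g' \<le> d' \<and> g \<le> d \<and>
    (\<exists>U V ht.
       unitary_mat d U \<and> unitary_mat d' V \<and>
       nc_analytic g' g (d' - g') (d - g) ht \<and>
       contraction_valued g' g ht \<and>
       (\<forall>N>0. \<forall>X\<in>nc_int_ball g' g N.
          h N X =
            kron V (1\<^sub>m N) *
            four_block_mat X (0\<^sub>m (g' * N) ((d - g) * N))
                           (0\<^sub>m ((d' - g') * N) (g * N)) (ht N X) *
            mat_adjoint (kron U (1\<^sub>m N))))"
proof -
  note g = \<open>g' > 0\<close> \<open>g > 0\<close> and A = \<open>truly_linear_pencil g' g d' d A\<close> and pbm = \<open>pencil_ball_map g' g d' d A f\<close>
  have f: "nc_analytic g' g g' g f" using pbm by (simp add: pencil_ball_map_def)
  then have along: "nc_analytic_along_maps g' g g' g f" by (simp add: nc_analytic_def)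
  obtain a \<epsilon> where series: "nc_series_on g' g g' g a \<epsilon> f"
    using f by (auto simp: nc_analytic_def nc_power_series_iff)
  define C where "C = pencil_coeff g' g d' d A a"
  have hs: "nc_series_on g' g d' d C \<epsilon> h" and ha: "nc_analytic_along_maps g' g d' d h"
    unfolding C_def h_def by (intro nc_series_on_pencil nc_analytic_along_maps_pencil A series along)+
  have hle: "op_norm (h N X) \<le> 1" if "N > 0" "X \<in> nc_int_ball g' g N" for N X
    using pbm that by (simp add: pencil_ball_map_def pencil_ball_def h_def)
  have h0: "h 1 (0\<^sub>m g' g) = 0\<^sub>m d' d"
  proof (rule eq_matI)
    fix i j assume "i < dim_row (0\<^sub>m d' d :: complex mat)" "j < dim_col (0\<^sub>m d' d :: complex mat)"
    then have ij: "i < d'" "j < d" by auto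
    have "f 1 (0\<^sub>m g' g) = 0\<^sub>m g' g" using assms(7)[rule_format, of 1] by simp
    then show "h 1 (0\<^sub>m g' g) $$ (i, j) = 0\<^sub>m d' d $$ (i, j)"
      using pencil_eval_index[OF A ij, of 0 1 0 "0\<^sub>m g' g"] ij by (simp add: h_def)
  qed (simp_all add: h_def pencil_eval_def)
  interpret contractive_series g' g d' d "\<lambda>w \<alpha> \<beta>. C w $$ (\<alpha>, \<beta>)"
    by (rule contractive_series_of_coeffs[OF hs ha _ hle h0]) (simp_all add: h_def nc_mat_def pencil_eval_carrier)
  obtain \<zeta> where "(\<Sum>l<g. \<Sum>b<d. (cmod (\<zeta> l b))\<^sup>2) \<le> 1"
    and "(\<Sum>k<g'. \<Sum>\<alpha><d'. (cmod (\<Sum>l<g. \<Sum>\<beta><d. C [(k, l)] $$ (\<alpha>, \<beta>) * \<zeta> l \<beta>))\<^sup>2) = g' * g"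
    using attained_of_pencil_ball_map[OF A pbm series g] c_Nil unfolding C_def by blast
  then obtain u v where u: "\<And>l. l < g \<Longrightarrow> (\<Sum>b<d. (cmod (u l b))\<^sup>2) = 1"
    and v: "\<And>k. k < g' \<Longrightarrow> (\<Sum>a<d'. (cmod (v k a))\<^sup>2) = 1"
    and cu: "\<And>k l a. k < g' \<Longrightarrow> l < g \<Longrightarrow> a < d' \<Longrightarrow> (\<Sum>b<d. C [(k, l)] $$ (a, b) * u l b) = v k a"
    by (rule exists_isometric_frames[OF g]) (rule that)
  have "\<forall>l<g. (\<Sum>b<d. (cmod (u l b))\<^sup>2) = 1" "\<forall>k<g'. (\<Sum>a<d'. (cmod (v k a))\<^sup>2) = 1"
    "\<forall>k<g'. \<forall>l<g. \<forall>a<d'. (\<Sum>b<d. C [(k, l)] $$ (a, b) * u l b) = v k a"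
    using u v cu by blast+
  note adjoint = adjoint_frame[OF g this]
    and right = right_annihilated[OF g this] and left = left_annihilated[OF g this]
    and orthogonal = right_orthogonal[OF g this] left_orthogonal[OF g this]
  have unit: "(\<Sum>b<n. x b * cnj (x b)) = 1" if "(\<Sum>b<n. (cmod (x b))\<^sup>2) = 1" for n and x :: "nat \<Rightarrow> complex"
  proof -
    have "(\<Sum>b<n. x b * cnj (x b)) = complex_of_real (\<Sum>b<n. (cmod (x b))\<^sup>2)"
      by (simp only: of_real_sum complex_norm_square)
    then show ?thesis using that by simp
  qed
  have orth_u: "(\<Sum>b<d. u l b * cnj (u m b)) = (if l = m then 1 else 0)" if "l < g" "m < g" for l m
    using that unit[OF u] orthogonal(1) by simp
  have orth_v: "(\<Sum>a<d'. v k a * cnj (v m a)) = (if k = m then 1 else 0)" if "k < g'" "m < g'" for k m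
    using that unit[OF v] orthogonal(2) by simp
  obtain U where U: "g \<le> d" "unitary_mat d U" "\<And>b l. b < d \<Longrightarrow> l < g \<Longrightarrow> U $$ (b, l) = u l b"
    by (rule extend_orthonormal_to_unitary[where g = g and u = u and d = d, OF orth_u]) (assumption | rule that)+
  obtain V where V: "g' \<le> d'" "unitary_mat d' V" "\<And>a k. a < d' \<Longrightarrow> k < g' \<Longrightarrow> V $$ (a, k) = v k a"
    by (rule extend_orthonormal_to_unitary[where g = g' and u = v and d = d', OF orth_v]) (assumption | rule that)+
  have Uc: "U \<in> carrier_mat d d" and Vc: "V \<in> carrier_mat d' d'" using U V by (auto simp: unitary_mat_def)
  define B where "B = (\<lambda>i j. mat_adjoint V * A i j * U)"
  have B: "truly_linear_pencil g' g d' d B"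
    using A Uc mat_adjoint_carrier[OF Vc] unfolding truly_linear_pencil_def B_def
    by (auto intro!: mult_carrier_mat)
  \<comment> \<open>The map \<open>h\<close> and its coefficients in the new coordinates.\<close>
  define C' where "C' = pencil_coeff g' g d' d B a"
  define G where "G = (\<lambda>N X. pencil_eval g' g d' d B N (f N X))"
  have gs: "nc_series_on g' g d' d C' \<epsilon> G" and ga: "nc_analytic_along_maps g' g d' d G"
    unfolding C'_def G_def by (intro nc_series_on_pencil nc_analytic_along_maps_pencil B series along)+
  have C'_eq: "C' w $$ (\<alpha>, \<beta>) = (\<Sum>k<d'. \<Sum>l<d. cnj (V $$ (k, \<alpha>)) * C w $$ (k, l) * U $$ (l, \<beta>))"
    if "\<alpha> < d'" "\<beta> < d" for w \<alpha> \<beta>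
  proof -
    have "C' w $$ (\<alpha>, \<beta>) = pencil_eval g' g d' d B 1 (a w) $$ (\<alpha> * 1 + 0, \<beta> * 1 + 0)"
      unfolding C'_def using that by (simp add: pencil_coeff_eq_pencil_eval[OF B])
    also have "\<dots> = (\<Sum>k<d'. \<Sum>l<d. mat_adjoint V $$ (\<alpha>, k) * pencil_eval g' g d' d A 1 (a w) $$ (k * 1 + 0, l * 1 + 0) * U $$ (l, \<beta>))"
      using that by (intro pencil_eval_conjugate[OF B A mat_adjoint_carrier[OF Vc] Uc]) (auto simp: B_def)
    finally show ?thesis
      using that by (simp add: mat_adjoint_index[OF Vc] pencil_coeff_eq_pencil_eval[OF A] C_def)
  qed
  have C': "C' w $$ (\<alpha>, \<beta>) = (if \<alpha> < g' \<and> \<beta> < g \<and> w = [(\<alpha>, \<beta>)] then 1 else 0)"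
    if w: "set w \<subseteq> {..<g'} \<times> {..<g}" and ab: "\<alpha> < d'" "\<beta> < d" and or: "\<alpha> < g' \<or> \<beta> < g" for w \<alpha> \<beta>
  proof (cases "\<beta> < g")
    case True
    have "C' w $$ (\<alpha>, \<beta>) = (\<Sum>k<d'. cnj (V $$ (k, \<alpha>)) * (\<Sum>l<d. C w $$ (k, l) * u \<beta> l))"
      unfolding C'_eq[OF ab] using True by (simp add: U(3) sum_distrib_left mult.assoc)
    also have "\<dots> = (if \<alpha> < g' \<and> w = [(\<alpha>, \<beta>)] then 1 else 0)"
    proof (cases "\<exists>k. w = [(k, \<beta>)]")
      case True
      then obtain k where k: "w = [(k, \<beta>)]" "k < g'" using w by auto
      have "(\<Sum>m<d'. cnj (V $$ (m, \<alpha>)) * (\<Sum>l<d. C w $$ (m, l) * u \<beta> l)) = (\<Sum>m<d'. cnj (V $$ (m, \<alpha>)) * V $$ (m, k))"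
        using k \<open>\<beta> < g\<close> by (simp add: cu V(3))
      then show ?thesis using unitary_columns[OF V(2) ab(1), of k] k V(1) by auto
    next
      case False
      then show ?thesis using right[OF w \<open>\<beta> < g\<close>] by auto
    qed
    finally show ?thesis using True by simp
  next
    case False
    then have "\<alpha> < g'" using or by simp
    have "C' w $$ (\<alpha>, \<beta>) = (\<Sum>l<d. cnj (\<Sum>k<d'. cnj (C w $$ (k, l)) * v \<alpha> k) * U $$ (l, \<beta>))"
      unfolding C'_eq[OF ab] using \<open>\<alpha> < g'\<close>
      by (subst sum.swap) (simp add: V(3) sum_distrib_left sum_distrib_right mult_ac)
    also have "\<dots> = 0"
    proof (cases "\<exists>l. w = [(\<alpha>, l)]")
      case True
      then obtain l where l: "w = [(\<alpha>, l)]" "l < g" using w by auto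
      have "(\<Sum>m<d. cnj (\<Sum>k<d'. cnj (C w $$ (k, m)) * v \<alpha> k) * U $$ (m, \<beta>)) = (\<Sum>m<d. cnj (U $$ (m, l)) * U $$ (m, \<beta>))"
        using l \<open>\<alpha> < g'\<close> adjoint by (simp add: U(3))
      then show ?thesis using unitary_columns[OF U(2) _ ab(2), of l] l U(1) False by auto
    next
      case 2: False
      then show ?thesis using left[OF w \<open>\<alpha> < g'\<close>] by auto
    qed
    finally show ?thesis using False by simp
  qed
  have corner: "G N X $$ (\<alpha> * N + r, \<beta> * N + s) = (if \<alpha> < g' \<and> \<beta> < g then X $$ (\<alpha> * N + r, \<beta> * N + s) else 0)"
    if N: "N > 0" and X: "X \<in> nc_int_ball g' g N" and ab: "\<alpha> < d'" "\<beta> < d" and rs: "r < N" "s < N"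
      and or: "\<alpha> < g' \<or> \<beta> < g" for N X \<alpha> \<beta> r s
  proof -
    let ?t = "if \<alpha> < g' \<and> \<beta> < g then X $$ (\<alpha> * N + r, \<beta> * N + s) else 0"
    have ij: "\<alpha> * N + r < d' * N" "\<beta> * N + s < d * N" using ab rs by (auto simp: block_index_less)
    have Cc: "C' w \<in> carrier_mat d' d" for w by (simp add: C'_def pencil_coeff_def)
    have "\<epsilon> > 0" using series by (simp add: nc_series_on_def)
    have hterm: "homog_term g' g d' d C' n N X $$ (\<alpha> * N + r, \<beta> * N + s) = (if n = 1 then ?t else 0)" for n
    proof -
      have "homog_term g' g d' d C' n N X $$ (\<alpha> * N + r, \<beta> * N + s)
          = (\<Sum>w\<in>words g' g n. if w = [(\<alpha>, \<beta>)] then (if \<alpha> < g' \<and> \<beta> < g then wev N (entries N X) w r s else 0) else 0)"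
        unfolding homog_term_index[OF Cc ab rs]
        by (intro sum.cong refl) (auto simp: words_def C' ab or)
      also have "\<dots> = (if n = 1 then if \<alpha> < g' \<and> \<beta> < g then wev N (entries N X) [(\<alpha>, \<beta>)] r s else 0 else 0)"
        by (subst sum.delta[OF finite_words]) (auto simp: words_def)
      also have "wev N (entries N X) [(\<alpha>, \<beta>)] r s = X $$ (\<alpha> * N + r, \<beta> * N + s)"
        using rs by (simp add: if_distrib[of "\<lambda>z. _ * z"] entries_def cong: if_cong)
      finally show ?thesis .
    qed
    have "G N X $$ (\<alpha> * N + r, \<beta> * N + s) = 1 * ?t"
    proof (rule nc_identity_on_disc[OF ga N X ij _ \<open>\<epsilon> > 0\<close>])
      show "(\<lambda>z. z * ?t) holomorphic_on UNIV" by (intro holomorphic_intros)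
      fix z :: complex assume z: "cmod z < \<epsilon>"
      have "(\<lambda>n. z ^ n * (if n = 1 then ?t else 0)) sums (G N (z \<cdot>\<^sub>m X) $$ (\<alpha> * N + r, \<beta> * N + s))"
        using nc_series_on_ray[OF gs N X ij z] unfolding hterm .
      moreover have "(\<lambda>n. z ^ n * (if n = 1 then ?t else 0)) = (\<lambda>n. if n = 1 then z ^ n * ?t else 0)"
        by auto
      ultimately have "(\<lambda>n. if n = 1 then z ^ n * ?t else 0) sums (G N (z \<cdot>\<^sub>m X) $$ (\<alpha> * N + r, \<beta> * N + s))"
        by (simp only:)
      moreover have "(\<lambda>n. if n = 1 then z ^ n * ?t else 0) sums (z ^ 1 * ?t)"
        by (rule sums_single)
      ultimately have "G N (z \<cdot>\<^sub>m X) $$ (\<alpha> * N + r, \<beta> * N + s) = z ^ 1 * ?t"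
        by (rule sums_unique2)
      then show "G N (z \<cdot>\<^sub>m X) $$ (\<alpha> * N + r, \<beta> * N + s) = z * ?t" by (simp only: power_one_right)
    qed
    then show ?thesis by simp
  qed
  \<comment> \<open>The lower right corner of \<open>G\<close> is again a pencil composed with \<open>f\<close>, hence NC analytic.\<close>
  define B' where "B' = (\<lambda>i j. mat (d' - g') (d - g) (\<lambda>(\<alpha>, \<beta>). B i j $$ (g' + \<alpha>, g + \<beta>)))"
  define ht where "ht = (\<lambda>N X. pencil_eval g' g (d' - g') (d - g) B' N (f N X))"
  have B': "truly_linear_pencil g' g (d' - g') (d - g) B'" by (simp add: truly_linear_pencil_def B'_def)
  have rest: "G N X $$ ((g' + \<alpha>) * N + r, (g + \<beta>) * N + s) = ht N X $$ (\<alpha> * N + r, \<beta> * N + s)"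
    if "\<alpha> < d' - g'" "\<beta> < d - g" "r < N" "s < N" for N X \<alpha> \<beta> r s
    unfolding G_def ht_def using that by (simp add: pencil_eval_index[OF B] pencil_eval_index[OF B']) (simp add: B'_def)
  have "nc_analytic g' g (d' - g') (d - g) ht" unfolding ht_def by (rule nc_analytic_pencil[OF B' f])
  moreover have "contraction_valued g' g ht"
    unfolding contraction_valued_def
  proof (intro allI ballI impI)
    fix N X assume "N > (0::nat)" "X \<in> nc_int_ball g' g N"
    then have "contr ({..<d'} \<times> {..<N}) ({..<d} \<times> {..<N}) (\<lambda>(a, r) (b, s). G N X $$ (a * N + r, b * N + s))"
      using hle unfolding G_def h_def
      by (intro contr_pencil_conjugate[OF B A V(2) U(2)]) (auto simp: B_def)
    from contr_corner[OF this V(1) U(1)]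
    have "contr ({..<d' - g'} \<times> {..<N}) ({..<d - g} \<times> {..<N}) (\<lambda>(a, r) (b, s). ht N X $$ (a * N + r, b * N + s))"
      by (rule contr_cong) (auto simp: rest)
    then show "op_norm (ht N X) \<le> 1"
      unfolding ht_def op_norm_le_1_iff[OF pencil_eval_carrier] contr_blocks_iff .
  qed
  moreover have "h N X = kron V (1\<^sub>m N) *
            four_block_mat X (0\<^sub>m (g' * N) ((d - g) * N)) (0\<^sub>m ((d' - g') * N) (g * N)) (ht N X) *
            mat_adjoint (kron U (1\<^sub>m N))" if "N > 0" "X \<in> nc_int_ball g' g N" for N X
  proof -
    have "G N X = four_block_mat X (0\<^sub>m (g' * N) ((d - g) * N)) (0\<^sub>m ((d' - g') * N) (g * N)) (ht N X)"
      using that corner[OF that] rest V(1) U(1)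
      by (intro four_block_mat_of_corner[where d' = d' and d = d])
         (auto simp: G_def ht_def pencil_eval_carrier nc_int_ball_def nc_mat_def)
    moreover have "h N X = kron V (1\<^sub>m N) * G N X * mat_adjoint (kron U (1\<^sub>m N))"
      unfolding h_def G_def by (rule pencil_eval_unconjugate[OF A B V(2) U(2)]) (simp add: B_def)
    ultimately show ?thesis by simp
  qed
  ultimately show ?thesis using U V by blast
qed

end
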